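(* Let $1<\alpha<\infty$, let $k_0\ge 0$ be an integer, and let $\{s_n\}_{n\ge1}$ be a sequence of positive numbers with $s_n\ge k_0+n-1$ for all $n\geq 1$ and $s_n/n\to\alpha$. Let $\{Z_n\}_{n\ge 1}$ be the Markov chain with $Z_1=k_0$ and, for $n\ge1$, $$\Pr(Z_{n+1}-Z_n=1\mid Z_n)=1-\frac{Z_n}{s_n},\qquad \Pr(Z_{n+1}-Z_n=0\mid Z_n)=\frac{Z_n}{s_n}.$$ For $0\le t\le1$ define $$X_n(t)=\frac1n Z_{\lfloor nt\rfloor-k_0+1}+\frac{nt-\lfloor nt\rfloor}{n}\left(Z_{\lfloor nt\rfloor-k_0+2}-Z_{\lfloor nt\rfloor-k_0+1}\right)\quad\text{for } t\ge \frac{k_0}{n},$$ and $X_n(t)=t$ for $0\le t\le k_0/n$. Then, as a sequence of $C([0,1];\mathbb{R})$-valued random variables, $X_n$ satisfies the large deviation principle with speed $n$ and rate function $I:C([0,1];\mathbb{R})\to[0,\infty]$ given by $$I(\varphi)=\int_0^1\left[\dot\varphi(t)\log\frac{\alpha t\,\dot\varphi(t)}{\alpha t-\varphi(t)}+(1-\dot\varphi(t))\log\frac{\alpha t(1-\dot\varphi(t))}{\varphi(t)}\right]dt$$ if $\varphi(t)$ is differentiable for almost all $t$, $\varphi(0)=0$, $0\le\dot\varphi\le1$, and the integral converges; otherwise $I(\varphi)=\infty$.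
   Context: A sequence $\{X_n\}$ of random variables with values in a separable complete metric space $\mathbf{X}$ satisfies the large deviation principle with speed $n$ and rate function $I:\mathbf{X}\to[0,\infty]$ if the level sets $\{x: I(x)\le a\}$ are compact and for every Borel set $U\subset\mathbf{X}$, $$-\inf_{x\in U^\circ}I(x)\le\liminf_{n\to\infty}\frac1n\log\Pr(X_n\in U)\le\limsup_{n\to\infty}\frac1n\log\Pr(X_n\in U)\le-\inf_{x\in\bar U}I(x),$$ where $U^\circ$ is the interior and $\bar U$ the closure of $U$. Here $\mathbf{X}=C([0,1];\mathbb{R})$ with the supremum norm. $\dot\varphi$ denotes the derivative of $\varphi$, where it exists. The conventions $0\log 0=0$ in the integrand and $0/0=0$ in the transition probabilities are used. Since $Z_n\le k_0+n-1\le s_n$, the transition probabilities lie in $[0,1]$. The trajectories of $X_n$ are nondecreasing Lipschitz functions with constant at most $1$.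
   Formalization: The rate function is finite only for absolutely continuous φ, not merely φ differentiable almost everywhere: otherwise the Cantor function would have finite I, although the 1-Lipschitz trajectories never come near it, and the lower bound would fail. *)

theory Defs
  imports "HOL-Probability.Probability"
begin

section \<open>The large deviation principle\<close>

definition borel_sets_of :: "'a metric \<Rightarrow> 'a measure" where
  "borel_sets_of m = sigma (mspace m) {U. openin (mtopology_of m) U}"

text \<open>The logarithm of a probability, with \<open>log 0 = -\<infinity>\<close>; note that HOL's \<open>ln 0\<close> is \<open>0\<close>.\<close>

definition log_prob :: "real \<Rightarrow> ereal" where
  "log_prob p = (if p = 0 then -\<infinity> else ereal (ln p))"

definition good_rate_function :: "'a metric \<Rightarrow> ('a \<Rightarrow> ereal) \<Rightarrow> bool" where
  "good_rate_function m I \<longleftrightarrow>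
     (\<forall>x\<in>mspace m. 0 \<le> I x) \<and>
     (\<forall>a::real. compactin (mtopology_of m) {x \<in> mspace m. I x \<le> ereal a})"

text \<open>
  The sequence \<open>X\<close> is indexed by \<open>n \<ge> 1\<close>; the value \<open>X 0\<close> is irrelevant.
\<close>

definition large_deviation_principle ::
    "'w measure \<Rightarrow> 'a metric \<Rightarrow> (nat \<Rightarrow> 'w \<Rightarrow> 'a) \<Rightarrow> ('a \<Rightarrow> ereal) \<Rightarrow> bool" where
  "large_deviation_principle M m X I \<longleftrightarrow>
     (\<forall>n\<ge>1. X n \<in> measurable M (borel_sets_of m)) \<and>
     good_rate_function m I \<and>
     (\<forall>U\<in>sets (borel_sets_of m).
        - (INF x\<in>mtopology_of m interior_of U. I x)
          \<le> liminf (\<lambda>n. ereal (1 / real n) * log_prob \<P>(\<omega> in M. X n \<omega> \<in> U)) \<and>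
        liminf (\<lambda>n. ereal (1 / real n) * log_prob \<P>(\<omega> in M. X n \<omega> \<in> U))
          \<le> limsup (\<lambda>n. ereal (1 / real n) * log_prob \<P>(\<omega> in M. X n \<omega> \<in> U)) \<and>
        limsup (\<lambda>n. ereal (1 / real n) * log_prob \<P>(\<omega> in M. X n \<omega> \<in> U))
          \<le> - (INF x\<in>mtopology_of m closure_of U. I x))"

section \<open>The space of continuous functions on the unit interval\<close>

text \<open>
  The continuous functions from \<open>[0,1]\<close> to the reals with the supremum metric.  The elements
  are represented as functions on the whole line that are \<open>undefined\<close> outside \<open>[0,1]\<close>.
\<close>

definition C01 :: "(real \<Rightarrow> real) metric" where
  "C01 = cfunspace (top_of_set {0..1}) euclidean_metric"

section \<open>The Markov chain and its interpolated trajectories\<close>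

text \<open>
  A Markov chain with values in the natural numbers and time \<open>1, 2, \<dots>\<close>.  The conditional
  probabilities are elementary ones, hence restricted to histories of positive probability.
\<close>

definition markov_chain :: "'w measure \<Rightarrow> (nat \<Rightarrow> 'w \<Rightarrow> nat) \<Rightarrow> bool" where
  "markov_chain M Z \<longleftrightarrow>
     (\<forall>n\<ge>1. Z n \<in> measurable M (count_space UNIV)) \<and>
     (\<forall>n\<ge>1. \<forall>h :: nat \<Rightarrow> nat. \<forall>j.
        \<P>(\<omega> in M. \<forall>i\<in>{1..n}. Z i \<omega> = h i) > 0 \<longrightarrow>
        \<P>(\<omega> in M. Z (n + 1) \<omega> = j \<bar> \<forall>i\<in>{1..n}. Z i \<omega> = h i)
          = \<P>(\<omega> in M. Z (n + 1) \<omega> = j \<bar> Z n \<omega> = h n))"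

text \<open>
  The rescaled trajectory of a sequence \<open>z\<close>.  In the second branch \<open>n * t \<ge> k0\<close>, so the
  subtraction of natural numbers is not truncated.  If \<open>z 1 = k0\<close>, the two branches agree
  at \<open>t = k0 / n\<close>.
\<close>

definition trajectory :: "nat \<Rightarrow> (nat \<Rightarrow> nat) \<Rightarrow> nat \<Rightarrow> real \<Rightarrow> real" where
  "trajectory k0 z n =
     (\<lambda>t\<in>{0..1}.
        if t \<le> real k0 / real n then t
        else (let m = nat \<lfloor>real n * t\<rfloor> - k0 + 1
              in 1 / real n * real (z m)
                 + (real n * t - of_int \<lfloor>real n * t\<rfloor>) / real n * (real (z (m + 1)) - real (z m))))"

section \<open>The rate function\<close>

text \<open>
  \<open>x * log (p / q)\<close> with \<open>0 log 0 = 0\<close>.  A vanishing denominator \<open>q\<close> with \<open>x \<noteq> 0\<close> gives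
  \<open>\<infinity>\<close>, whereas the expression \<open>x * ln (p / q)\<close> of HOL would be \<open>0\<close>.  This matters for the
  second term of the integrand, for paths that vanish on an initial interval.
\<close>

definition xlog_quot :: "real \<Rightarrow> real \<Rightarrow> real \<Rightarrow> ereal" where
  "xlog_quot x p q = (if x = 0 then 0 else if q = 0 then \<infinity> else ereal (x * ln (p / q)))"

definition rate_integrand :: "real \<Rightarrow> (real \<Rightarrow> real) \<Rightarrow> real \<Rightarrow> ereal" where
  "rate_integrand \<alpha> \<phi> t =
     xlog_quot (deriv \<phi> t) (\<alpha> * t * deriv \<phi> t) (\<alpha> * t - \<phi> t)
     + xlog_quot (1 - deriv \<phi> t) (\<alpha> * t * (1 - deriv \<phi> t)) (\<phi> t)"

definition absolutely_continuous_on :: "real set \<Rightarrow> (real \<Rightarrow> real) \<Rightarrow> bool" where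
  "absolutely_continuous_on S f \<longleftrightarrow>
     (\<forall>\<epsilon>>0. \<exists>\<delta>>0. \<forall>D T. D division_of T \<and> T \<subseteq> S \<and> (\<Sum>K\<in>D. Sup K - Inf K) < \<delta> \<longrightarrow>
        (\<Sum>K\<in>D. \<bar>f (Sup K) - f (Inf K)\<bar>) < \<epsilon>)"

text \<open>
  The conditions on the derivative determine \<open>\<phi>\<close> only among absolutely continuous functions:
  the Cantor function, for example, has derivative \<open>0\<close> almost everywhere, but is not a limit of
  trajectories, which are Lipschitz with constant 1.  Together with \<open>0 \<le> deriv \<phi> t \<le> 1\<close>, absolute
  continuity means that \<open>\<phi>\<close> is nondecreasing and Lipschitz with constant 1.
\<close>

definition rate_finite :: "real \<Rightarrow> (real \<Rightarrow> real) \<Rightarrow> bool" where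
  "rate_finite \<alpha> \<phi> \<longleftrightarrow>
     absolutely_continuous_on {0..1} \<phi> \<and>
     (AE t in lebesgue_on {0..1}. \<phi> differentiable (at t)) \<and>
     \<phi> 0 = 0 \<and>
     (AE t in lebesgue_on {0..1}. 0 \<le> deriv \<phi> t \<and> deriv \<phi> t \<le> 1) \<and>
     (AE t in lebesgue_on {0..1}. \<bar>rate_integrand \<alpha> \<phi> t\<bar> \<noteq> \<infinity>) \<and>
     integrable (lebesgue_on {0..1}) (\<lambda>t. real_of_ereal (rate_integrand \<alpha> \<phi> t))"

definition rate :: "real \<Rightarrow> (real \<Rightarrow> real) \<Rightarrow> ereal" where
  "rate \<alpha> \<phi> =
     (if rate_finite \<alpha> \<phi>
      then ereal (\<integral>t. real_of_ereal (rate_integrand \<alpha> \<phi> t) \<partial>(lebesgue_on {0..1}))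
      else \<infinity>)"

end

theory Submission
  imports Defs "HOL-Complex_Analysis.Great_Picard"
begin

text \<open>
  All trajectories lie in the compact set of nondecreasing functions with Lipschitz constant 1 that
  vanish at 0, so it suffices to find the exponential decay rate of the probability of small balls.
  Cut \<open>[0, 1]\<close> into \<open>m\<close> blocks.  In a small ball around \<open>\<phi>\<close> the transition probabilities are
  almost constant on each block except the first one, and so is the number of up-steps; hence the
  likelihood ratio between the chain and a chain with independent steps of block-wise constant
  probabilities \<open>q\<^sub>j\<close> is almost deterministic, with exponent \<open>n\<close> times a Riemann sum of relative
  entropies.  Summing over the ball gives the upper bound.  If \<open>q\<^sub>j\<close> are the slopes of \<open>\<phi>\<close>, then the
  ball has probability close to 1 for the independent steps by Chebyshev's inequality, which gives
  the lower bound.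

  As \<open>m \<rightarrow> \<infinity>\<close>, the difference quotients converge to the derivative almost everywhere.  Fatou's
  lemma yields the rate function as a lower bound for the upper Riemann sums.  For the lower bound
  \<open>\<phi>\<close> is first mixed with the line on which the rate vanishes, which makes all logarithms bounded,
  and dominated convergence applies.
\<close>

section \<open>Absolutely continuous and Lipschitz functions\<close>

text \<open>The obstacle is time 0. A tube of width \<open>\<delta>\<close> fixes the ratio of
  position to time, on which the transition probabilities depend, only up to
  \<open>\<delta> / t\<close>. The upper bound can afford to leave the first block out of the
  exponent. The lower bound cannot: the chain has to get through this block at a known price, and
  close to height 0 a flat step has almost no chance. Climbing costs at most
  \<open>ln (1 / \<rho>)\<close> per step, hence about \<open>ln (1 / \<rho>) / m\<close> in the
  exponent. This vanishes as \<open>m\<close> grows because \<open>\<rho>\<close> depends on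
  \<alpha> and on the mixing weight but not on \<open>m\<close>; so the mixing weight is fixed
  before the mesh. Away from 0 the error \<open>4 / j\<close> in block \<open>j\<close> is not
  uniform, but the block containing a fixed time \<open>t > 0\<close> has index about
  \<open>m * t\<close>. The integrands of the Riemann sums therefore converge pointwise, and
  integral convergence theorems take the place of uniform estimates. In the upper bound they must
  also cover paths of infinite rate, for which no integrability is known in advance.\<close>

lemma emeasure_interval_measure_add:
  fixes F G :: "real \<Rightarrow> real"
  assumes F: "mono F" "continuous_on UNIV F" and G: "mono G" "continuous_on UNIV G"
    and eq: "\<And>x. F x + G x = x" and A: "A \<in> sets borel"
  shows "emeasure (interval_measure F) A + emeasure (interval_measure G) A = emeasure lborel A"
proof -
  define \<mu> where "\<mu> = interval_measure F"
  define \<nu> where "\<nu> = interval_measure G"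
  define S where "S = measure_of UNIV (sets borel) (\<lambda>A. emeasure \<mu> A + emeasure \<nu> A)"
  have sets_S: "sets S = sets borel"
    unfolding S_def by (metis sets.sigma_sets_eq sets.space_closed sets_measure_of space_borel)
  have em: "emeasure S A = emeasure \<mu> A + emeasure \<nu> A" if "A \<in> sets borel" for A
  proof (rule emeasure_measure_of[OF S_def])
    show "sets borel \<subseteq> Pow (UNIV :: real set)" by auto
    show "positive (sets S) (\<lambda>A. emeasure \<mu> A + emeasure \<nu> A)" by (simp add: positive_def)
    show "countably_additive (sets S) (\<lambda>A. emeasure \<mu> A + emeasure \<nu> A)"
    proof (rule countably_additiveI)
      fix B :: "nat \<Rightarrow> real set"
      assume B: "range B \<subseteq> sets S" "disjoint_family B"
      have "(\<Sum>i. emeasure \<mu> (B i) + emeasure \<nu> (B i)) = (\<Sum>i. emeasure \<mu> (B i)) + (\<Sum>i. emeasure \<nu> (B i))"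
        by (rule suminf_add[symmetric]) auto
      also have "\<dots> = emeasure \<mu> (\<Union>i. B i) + emeasure \<nu> (\<Union>i. B i)"
        using B by (subst (1 2) suminf_emeasure) (auto simp: sets_S \<mu>_def \<nu>_def)
      finally show "(\<Sum>i. emeasure \<mu> (B i) + emeasure \<nu> (B i)) = emeasure \<mu> (\<Union>i. B i) + emeasure \<nu> (\<Union>i. B i)" .
    qed
    show "A \<in> sets S" using that sets_S by simp
  qed
  have Icc: "emeasure \<mu> {a..b} = ennreal (F b - F a)" "emeasure \<nu> {a..b} = ennreal (G b - G a)" if "a \<le> b" for a b
    unfolding \<mu>_def \<nu>_def using that F G by (auto intro!: emeasure_interval_measure_Icc dest: monoD)
  \<comment> \<open>A Borel measure that gives every box its volume is Lebesgue measure; on an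
    interval \<open>F u - F l\<close> and \<open>G u - G l\<close> add up to
    \<open>u - l\<close>.\<close>
  have "lborel = S"
  proof (rule lborel_eqI)
    fix l u :: real
    assume *: "\<And>b. b \<in> Basis \<Longrightarrow> l \<bullet> b \<le> u \<bullet> b"
    have lu: "l \<le> u" using *[of 1] by simp
    have null: "{l, u} \<in> null_sets \<mu>" "{l, u} \<in> null_sets \<nu>"
    proof -
      have "{x} \<in> null_sets \<mu>" "{x} \<in> null_sets \<nu>" for x
        using Icc[of x x] by (auto intro!: null_setsI simp: \<mu>_def \<nu>_def)
      then show "{l, u} \<in> null_sets \<mu>" "{l, u} \<in> null_sets \<nu>"
        by (metis insert_is_Un null_sets.Un)+
    qed
    have box: "{l<..<u} = {l..u} - {l,u}" by auto
    have "emeasure \<mu> {l<..<u} = ennreal (F u - F l)" "emeasure \<nu> {l<..<u} = ennreal (G u - G l)"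
      unfolding box using null Icc[OF lu] by (subst emeasure_Diff_null_set; auto simp: \<mu>_def \<nu>_def)+
    then have "emeasure S {l<..<u} = ennreal (F u - F l) + ennreal (G u - G l)"
      by (subst em) auto
    also have "\<dots> = ennreal (u - l)"
    proof -
      have "F l \<le> F u" "G l \<le> G u" using F G lu by (auto dest: monoD)
      moreover have "F u - F l + (G u - G l) = u - l" using eq[of u] eq[of l] by linarith
      ultimately show ?thesis by (subst ennreal_plus[symmetric]) auto
    qed
    finally show "emeasure S (box l u) = (\<Prod>b\<in>Basis. (u - l) \<bullet> b)" by (simp add: box_real)
  qed (simp add: sets_S)
  then show ?thesis using em[OF A] by (simp add: \<mu>_def \<nu>_def)
qed

text \<open>Lebesgue's theorem for this class: the Stieltjes measure of \<open>F\<close> is dominated by Lebesgue measure,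
  hence \<open>F\<close> is the indefinite integral of a density.\<close>

lemma mono_lipschitz_differentiable_ae:
  fixes F :: "real \<Rightarrow> real"
  assumes mono: "\<And>x y. x \<le> y \<Longrightarrow> F x \<le> F y" and lip: "\<And>x y. x \<le> y \<Longrightarrow> F y - F x \<le> y - x"
  obtains N where "negligible N" "\<And>x. x \<notin> N \<Longrightarrow> F differentiable (at x)"
proof -
  have lips: "\<bar>F x - F y\<bar> \<le> \<bar>x - y\<bar>" for x y
    using mono[of x y] mono[of y x] lip[of x y] lip[of y x] by linarith
  have contF: "continuous_on UNIV F"
    unfolding continuous_on_iff dist_real_def using lips by (metis le_less_trans)
  have contG: "continuous_on UNIV (\<lambda>x. x - F x)"
    by (intro continuous_intros contF)
  define \<mu> where "\<mu> = interval_measure F"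
  \<comment> \<open>The Lipschitz bound makes \<open>x - F x\<close> nondecreasing, so it has a
    Stieltjes measure of its own, and a Lebesgue null set is null for both summands.\<close>
  have sum: "emeasure \<mu> A + emeasure (interval_measure (\<lambda>x. x - F x)) A = emeasure lborel A"
    if "A \<in> sets borel" for A
    unfolding \<mu>_def using that contF contG mono lip
    by (intro emeasure_interval_measure_add) (auto simp: mono_def algebra_simps)
  have "absolutely_continuous lborel \<mu>"
    unfolding absolutely_continuous_def null_sets_def
    by (auto simp: \<mu>_def dest: sum[unfolded \<mu>_def])
  then obtain g where g: "g \<in> borel_measurable lborel" "density lborel g = \<mu>"
    using sigma_finite_measure.Radon_Nikodym[OF sigma_finite_lborel, of \<mu>]
    by (auto simp: \<mu>_def)
  have Icc: "(\<integral>\<^sup>+x\<in>{a..b}. g x \<partial>lborel) = ennreal (F b - F a)" if "a \<le> b" for a b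
  proof -
    have "emeasure \<mu> {a..b} = ennreal (F b - F a)"
      unfolding \<mu>_def using that mono contF by (intro emeasure_interval_measure_Icc)
    then show ?thesis using g(1) by (simp add: g(2)[symmetric] emeasure_density)
  qed
  \<comment> \<open>The density may be infinite on a null set; \<open>enn2real\<close> makes it a
    real function, as the gauge integral requires.\<close>
  define f where "f x = enn2real (g x)" for x
  have f_nn: "f x \<ge> 0" for x unfolding f_def by simp
  have fm: "f \<in> borel_measurable lborel" unfolding f_def using g by measurable
  have hi: "(f has_integral (F b - F a)) {a..b}" if "a \<le> b" for a b
  proof -
    have fin: "AE x in lborel. g x * indicator {a..b} x \<noteq> \<infinity>"
      using g Icc[OF that] by (intro nn_integral_noteq_infinite) auto
    have "(\<integral>\<^sup>+x. ennreal (f x * indicator {a..b} x) \<partial>lborel) = (\<integral>\<^sup>+x\<in>{a..b}. g x \<partial>lborel)"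
      using fin by (intro nn_integral_cong_AE, eventually_elim)
        (auto simp: f_def indicator_def less_top split: if_splits)
    then have nn: "(\<integral>\<^sup>+x. ennreal (f x * indicator {a..b} x) \<partial>lborel) = ennreal (F b - F a)"
      using Icc[OF that] by simp
    have "((\<lambda>x. f x * indicator {a..b} x) has_integral (F b - F a)) UNIV"
      using fm nn mono[OF that]
      by (intro nn_integral_has_integral) (auto simp: f_nn)
    then show ?thesis
      by (subst has_integral_restrict_UNIV[symmetric]) (simp add: indicator_def of_bool_def if_distrib cong: if_cong)
  qed
  have int: "f integrable_on cbox a b" for a b
    using hi[of a b] by (cases "a \<le> b") auto
  obtain N1 where N1: "negligible N1" and N1': "\<And>x e. \<lbrakk>x \<notin> N1; 0 < e\<rbrakk> \<Longrightarrow> \<exists>d>0. \<forall>h. 0 < h \<and> h < d \<longrightarrow>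
       norm (integral (cbox x (x + h *\<^sub>R One)) f /\<^sub>R h ^ DIM(real) - f x) < e"
    using integrable_ccontinuous_explicit[of f] int by metis
  \<comment> \<open>The differentiation theorem averages over cubes with \<open>x\<close> as their
    lower corner, which gives right derivatives only. Applied to the reflected density it gives the
    left ones.\<close>
  have "(\<lambda>x. f (- x)) integrable_on cbox a b" for a b
    using int[of "-b" "-a"] integrable_reflect[of f "-a" "-b"] by simp
  then obtain N2 where N2: "negligible N2" and N2': "\<And>x e. \<lbrakk>x \<notin> N2; 0 < e\<rbrakk> \<Longrightarrow> \<exists>d>0. \<forall>h. 0 < h \<and> h < d \<longrightarrow>
       norm (integral (cbox x (x + h *\<^sub>R One)) (\<lambda>x. f (- x)) /\<^sub>R h ^ DIM(real) - f (- x)) < e"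
    using integrable_ccontinuous_explicit[of "\<lambda>x. f (- x)"] by metis
  have "negligible (uminus ` N2)"
    using N2 by (intro negligible_differentiable_image_negligible) (auto intro!: derivative_intros simp: differentiable_on_def)
  then have "negligible (N1 \<union> uminus ` N2)" using N1 by simp
  moreover have "F differentiable (at x)" if x: "x \<notin> N1 \<union> uminus ` N2" for x
  proof -
    have x1: "x \<notin> N1" and x2: "- x \<notin> N2" using x by (auto simp: image_iff)
    have "(F has_real_derivative f x) (at x)"
      unfolding DERIV_def LIM_eq
    proof (intro allI impI)
      fix e :: real assume e: "0 < e"
      obtain d1 where d1: "d1 > 0" "\<And>h. 0 < h \<Longrightarrow> h < d1 \<Longrightarrow> \<bar>(F (x + h) - F x) / h - f x\<bar> < e"
      proof -
        obtain d where d: "d > 0" "\<forall>h. 0 < h \<and> h < d \<longrightarrow>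
          norm (integral (cbox x (x + h *\<^sub>R One)) f /\<^sub>R h ^ DIM(real) - f x) < e"
          using N1'[OF x1 e] by blast
        have "integral {x..x+h} f = F (x + h) - F x" if "0 < h" for h
          using hi[of x "x+h"] that by (intro integral_unique) auto
        then show ?thesis using d that[of d] by (auto simp: divide_inverse mult.commute)
      qed
      obtain d2 where d2: "d2 > 0" "\<And>h. 0 < h \<Longrightarrow> h < d2 \<Longrightarrow> \<bar>(F x - F (x - h)) / h - f x\<bar> < e"
      proof -
        obtain d where d: "d > 0" "\<forall>h. 0 < h \<and> h < d \<longrightarrow>
          norm (integral (cbox (- x) (- x + h *\<^sub>R One)) (\<lambda>x. f (- x)) /\<^sub>R h ^ DIM(real) - f (- (- x))) < e"
          using N2'[OF x2 e] by blast
        have "integral {-x..-x+h} (\<lambda>x. f (- x)) = F x - F (x - h)" if "0 < h" for h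
          using hi[of "x - h" x] that has_integral_reflect_real[of f "F x - F (x-h)" x "x-h"]
          by (intro integral_unique) (auto simp: algebra_simps)
        then show ?thesis using d that[of d] by (auto simp: divide_inverse mult.commute)
      qed
      show "\<exists>s>0. \<forall>h. h \<noteq> 0 \<and> norm (h - 0) < s \<longrightarrow> norm ((F (x + h) - F x) / h - f x) < e"
      proof (intro exI[of _ "min d1 d2"] conjI allI impI)
        fix h :: real assume h: "h \<noteq> 0 \<and> norm (h - 0) < min d1 d2"
        show "norm ((F (x + h) - F x) / h - f x) < e"
        proof (cases "h > 0")
          case True then show ?thesis using d1 h by auto
        next
          case False
          then have "(F (x + h) - F x) / h = (F x - F (x - (-h))) / (-h)"
            using h by (simp add: field_simps)
          then show ?thesis using d2(2)[of "-h"] h False by auto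
        qed
      qed (use d1 d2 in auto)
    qed
    then show ?thesis using real_differentiable_def by blast
  qed
  ultimately show ?thesis using that by blast
qed

text \<open>Take a tagged division fine for a gauge with two regimes. Intervals tagged in
  \<open>N\<close> lie in an open set \<open>U\<close> of measure below \<open>\<delta>\<close>, so
  by absolute continuity their increments sum to at least \<open>- \<epsilon>\<close>. At the other
  tags the derivative is nonnegative and the increment is at least \<open>- \<epsilon>\<close> times
  the length. The total loss is
  \<open>\<epsilon> * (b - a) + \<epsilon> = \<epsilon>0\<close>.\<close>

lemma absolutely_continuous_on_nondecreasing:
  fixes f f' :: "real \<Rightarrow> real"
  assumes ac: "absolutely_continuous_on {a..b} f" and ab: "a \<le> b" and N: "negligible N"
    and der: "\<And>x. x \<in> {a..b} - N \<Longrightarrow> (f has_real_derivative f' x) (at x within {a..b})"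
    and nonneg: "\<And>x. x \<in> {a..b} - N \<Longrightarrow> 0 \<le> f' x"
  shows "f a \<le> f b"
proof (rule field_le_epsilon)
  fix \<epsilon>0 :: real assume "0 < \<epsilon>0"
  define \<epsilon> where "\<epsilon> = \<epsilon>0 / (b - a + 1)"
  have e: "0 < \<epsilon>" unfolding \<epsilon>_def using \<open>0 < \<epsilon>0\<close> ab by auto
  have "\<epsilon> * (b - a + 1) = \<epsilon>0" unfolding \<epsilon>_def using ab by simp
  then have e0: "\<epsilon> * (b - a) + \<epsilon> = \<epsilon>0" by (simp add: algebra_simps)
  obtain \<delta> where d: "\<delta> > 0" "\<And>D T. D division_of T \<Longrightarrow> T \<subseteq> {a..b} \<Longrightarrow> (\<Sum>K\<in>D. Sup K - Inf K) < \<delta> \<Longrightarrow>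
        (\<Sum>K\<in>D. \<bar>f (Sup K) - f (Inf K)\<bar>) < \<epsilon>"
    using ac e unfolding absolutely_continuous_on_def by metis
  have "N \<in> sets lebesgue" using N by (simp add: negligible_iff_null_sets null_setsD2)
  then obtain U where U: "open U" "N \<subseteq> U" "U - N \<in> lmeasurable" "emeasure lebesgue (U - N) < ennreal \<delta>"
    using sets_lebesgue_outer_open[OF _ d(1)] by metis
  have UN: "U = (U - N) \<union> N" using U by auto
  have Um: "U \<in> lmeasurable"
    by (subst UN, rule fmeasurable.Un) (use U N negligible_iff_measure in auto)
  have Ul: "measure lebesgue U < \<delta>"
  proof -
    have "emeasure lebesgue U = emeasure lebesgue (U - N)"
      using N U by (intro emeasure_Diff_null_set[symmetric]) (auto simp: negligible_iff_null_sets)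
    then have "ennreal (measure lebesgue U) < ennreal \<delta>" using U(4) Um by (simp add: emeasure_eq_measure2)
    then show ?thesis by (simp add: ennreal_less_iff)
  qed
  have "\<exists>r>0. (x \<in> {a..b} - N \<longrightarrow> (\<forall>y\<in>{a..b}. \<bar>y - x\<bar> < r \<longrightarrow> \<bar>f y - f x - f' x * (y - x)\<bar> \<le> \<epsilon> * \<bar>y - x\<bar>))
      \<and> (x \<in> N \<longrightarrow> ball x r \<subseteq> U)" for x
  proof (cases "x \<in> N")
    case True then show ?thesis using U openE by blast
  next
    case False
    then show ?thesis
    proof (cases "x \<in> {a..b}")
      case True
      have "(f has_derivative (*) (f' x)) (at x within {a..b})"
        using der[of x] True False by (simp add: has_field_derivative_def)
      then show ?thesis
        using False e unfolding has_derivative_within_alt by (auto simp: abs_minus_commute)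
    qed (auto intro: exI[of _ 1] simp: False)
  qed
  then obtain r where r0: "\<And>x. r x > 0"
    and r1: "\<And>x y. x \<in> {a..b} - N \<Longrightarrow> y \<in> {a..b} \<Longrightarrow> \<bar>y - x\<bar> < r x \<Longrightarrow> \<bar>f y - f x - f' x * (y - x)\<bar> \<le> \<epsilon> * \<bar>y - x\<bar>"
    and r2: "\<And>x. x \<in> N \<Longrightarrow> ball x (r x) \<subseteq> U" by metis
  have "gauge (\<lambda>x. ball x (r x))" using r0 by (intro gauge_ball_dependent) auto
  then obtain p where p: "p tagged_division_of {a..b}" "(\<lambda>x. ball x (r x)) fine p"
    using fine_division_exists_real by blast
  have fin: "finite p" using p(1) by blast
  have pK: "\<exists>u v. K = {u..v} \<and> u \<le> x \<and> x \<le> v \<and> a \<le> u \<and> v \<le> b \<and> {u..v} \<subseteq> ball x (r x)" if xK: "(x, K) \<in> p" for x K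
  proof -
    obtain u v where K: "K = cbox u v" using tagged_division_ofD(4)[OF p(1) xK] by metis
    have "x \<in> K" "K \<subseteq> {a..b}" using tagged_division_ofD(2,3)[OF p(1) xK] by auto
    moreover have "K \<subseteq> ball x (r x)" using p(2) xK unfolding fine_def by auto
    ultimately show ?thesis using K by auto
  qed
  define p1 where "p1 = {(x, K) \<in> p. x \<in> N}"
  define p2 where "p2 = {(x, K) \<in> p. x \<notin> N}"
  have pp: "p = p1 \<union> p2" "p1 \<inter> p2 = {}" "p1 \<subseteq> p" "p2 \<subseteq> p" by (auto simp: p1_def p2_def)
  have fin1: "finite p1" "finite p2" using fin pp finite_subset by auto
  have tp1: "p1 tagged_partial_division_of {a..b}"
    using p(1) pp(3) tagged_partial_division_subset tagged_division_of_def by blast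
  define D where "D = snd ` p1"
  have D: "D division_of \<Union>D" unfolding D_def by (rule partial_division_of_tagged_division[OF tp1])
  have Dsub: "\<Union>D \<subseteq> {a..b}" using pK pp(3) unfolding D_def by fastforce
  have DU: "\<Union>D \<subseteq> U" using pK r2 unfolding D_def p1_def by fastforce
  have Dm: "\<Union>D \<in> lmeasurable"
    using D by (intro fmeasurable.finite_Union) (auto elim: division_ofD)
  have content_D: "Sup K - Inf K = integral K (\<lambda>x. 1)" if KD: "K \<in> D" for K
  proof -
    obtain x where "(x, K) \<in> p" using KD pp(3) unfolding D_def by auto
    from pK[OF this] obtain u v where "K = {u..v}" "u \<le> v" by (metis order_trans)
    then show ?thesis by (simp add: cSup_atLeastAtMost cInf_atLeastAtMost)
  qed
  have "(\<Sum>K\<in>D. Sup K - Inf K) = (\<Sum>K\<in>D. integral K (\<lambda>x. 1))"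
    using content_D by (intro sum.cong) auto
  also have "\<dots> = integral (\<Union>D) (\<lambda>x. 1)"
    using Dm D by (intro integral_combine_division_topdown[symmetric]) (auto simp: lmeasurable_iff_integrable_on)
  also have "\<dots> = measure lebesgue (\<Union>D)" using Dm by (simp add: lmeasure_integral)
  also have "\<dots> \<le> measure lebesgue U" using Dm Um DU by (intro measure_mono_fmeasurable) auto
  finally have "(\<Sum>K\<in>D. Sup K - Inf K) < \<delta>" using Ul by linarith
  then have *: "(\<Sum>K\<in>D. \<bar>f (Sup K) - f (Inf K)\<bar>) < \<epsilon>" using d(2)[OF D Dsub] by blast
  have s1: "(\<Sum>(x,K)\<in>p1. f (Sup K) - f (Inf K)) \<ge> - \<epsilon>"
  proof -
    \<comment> \<open>Passing from tagged intervals to the set of intervals requires a summand that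
      vanishes on degenerate intervals. The empty interval counts as one of them, and there
      \<open>Sup\<close> and \<open>Inf\<close> are unspecified.\<close>
    define d where "d K = (if K = {} then 0 else \<bar>f (Sup K) - f (Inf K)\<bar>)" for K
    have ne: "K \<noteq> {}" if "(x, K) \<in> p1" for x K
      using pK[of x K] that pp(3) by (metis atLeastatMost_empty_iff order_trans subsetD)
    have "(\<Sum>(x,K)\<in>p1. d K) = (\<Sum>K\<in>snd ` p1. d K)"
    proof (rule sum.over_tagged_division_lemma[OF tagged_partial_division_of_Union_self[OF tp1]])
      fix u v :: real assume "box u v = {}"
      then show "d (cbox u v) = 0"
        by (cases "u = v") (auto simp: d_def)
    qed
    moreover have "(\<Sum>(x,K)\<in>p1. d K) = (\<Sum>(x,K)\<in>p1. \<bar>f (Sup K) - f (Inf K)\<bar>)"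
      using ne by (intro sum.cong) (auto simp: d_def)
    moreover have "(\<Sum>K\<in>snd ` p1. d K) = (\<Sum>K\<in>snd ` p1. \<bar>f (Sup K) - f (Inf K)\<bar>)"
      using ne by (intro sum.cong) (auto simp: d_def)
    ultimately have "(\<Sum>(x,K)\<in>p1. \<bar>f (Sup K) - f (Inf K)\<bar>) = (\<Sum>K\<in>snd ` p1. \<bar>f (Sup K) - f (Inf K)\<bar>)"
      by simp
    moreover have "\<bar>\<Sum>(x,K)\<in>p1. f (Sup K) - f (Inf K)\<bar> \<le> (\<Sum>(x,K)\<in>p1. \<bar>f (Sup K) - f (Inf K)\<bar>)"
      using sum_abs[of "\<lambda>(x,K). f (Sup K) - f (Inf K)" p1] by (simp add: case_prod_unfold)
    ultimately show ?thesis using * unfolding D_def by linarith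
  qed
  have s2: "(\<Sum>(x,K)\<in>p2. f (Sup K) - f (Inf K)) \<ge> (\<Sum>(x,K)\<in>p2. - \<epsilon> * (Sup K - Inf K))"
  proof (rule sum_mono, clarify)
    fix x K assume xK: "(x, K) \<in> p2"
    obtain u v where uv: "K = {u..v}" "u \<le> x" "x \<le> v" "a \<le> u" "v \<le> b" "{u..v} \<subseteq> ball x (r x)"
      using pK[of x K] xK pp by blast
    have xN: "x \<in> {a..b} - N" using xK uv unfolding p2_def by auto
    have "u \<in> ball x (r x)" "v \<in> ball x (r x)" using subsetD[OF uv(6), of u] subsetD[OF uv(6), of v] uv(2,3) by simp_all
    then have "\<bar>u - x\<bar> < r x" "\<bar>v - x\<bar> < r x" by (simp_all add: dist_real_def abs_minus_commute)
    then have "\<bar>f u - f x - f' x * (u - x)\<bar> \<le> \<epsilon> * \<bar>u - x\<bar>" "\<bar>f v - f x - f' x * (v - x)\<bar> \<le> \<epsilon> * \<bar>v - x\<bar>"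
      using uv r1[OF xN, of u] r1[OF xN, of v] by simp_all
    moreover have "f' x * (u - x) \<le> 0" "0 \<le> f' x * (v - x)"
      using nonneg[OF xN] uv by (auto simp: mult_le_0_iff)
    ultimately have "f v - f u \<ge> - (\<epsilon> * (v - x)) - \<epsilon> * (x - u)"
      using uv by (auto simp: abs_if split: if_splits)
    also have "- (\<epsilon> * (v - x)) - \<epsilon> * (x - u) = - \<epsilon> * (v - u)" by (simp add: algebra_simps)
    finally show "- \<epsilon> * (Sup K - Inf K) \<le> f (Sup K) - f (Inf K)" using uv by simp
  qed
  have s3: "(\<Sum>(x,K)\<in>p2. Sup K - Inf K) \<le> b - a"
  proof -
    have "(\<Sum>(x,K)\<in>p2. Sup K - Inf K) \<le> (\<Sum>(x,K)\<in>p. Sup K - Inf K)"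
    proof (rule sum_mono2[OF fin pp(4)], clarify)
      fix x K assume "(x, K) \<in> p"
      from pK[OF this] show "0 \<le> Sup K - Inf K" by auto
    qed
    also have "\<dots> = b - a" using additive_tagged_division_1[OF ab p(1), of "\<lambda>x. x"] by simp
    finally show ?thesis .
  qed
  have "f b - f a = (\<Sum>(x,K)\<in>p. f (Sup K) - f (Inf K))"
    using additive_tagged_division_1[OF ab p(1), of f] by simp
  also have "\<dots> = (\<Sum>(x,K)\<in>p1. f (Sup K) - f (Inf K)) + (\<Sum>(x,K)\<in>p2. f (Sup K) - f (Inf K))"
    by (subst pp(1), rule sum.union_disjoint) (use fin1 pp(2) in auto)
  also have "\<dots> \<ge> - \<epsilon> + - \<epsilon> * (\<Sum>(x,K)\<in>p2. Sup K - Inf K)"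
    using s1 s2 by (simp add: sum_distrib_left case_prod_unfold)
  finally have "f b - f a \<ge> - \<epsilon> + - \<epsilon> * (\<Sum>(x,K)\<in>p2. Sup K - Inf K)" .
  moreover have "\<epsilon> * (\<Sum>(x,K)\<in>p2. Sup K - Inf K) \<le> \<epsilon> * (b - a)"
    using s3 e by (intro mult_left_mono) auto
  ultimately show "f a \<le> f b + \<epsilon>0" using e0 by simp
qed

lemma absolutely_continuous_on_subset:
  "absolutely_continuous_on S f \<Longrightarrow> T \<subseteq> S \<Longrightarrow> absolutely_continuous_on T f"
  unfolding absolutely_continuous_on_def by (meson order_trans)

text \<open>Serves the Lipschitz bound: \<open>f y - f x \<le> y - x\<close> says that
  \<open>x - f x\<close> is nondecreasing.\<close>

lemma absolutely_continuous_on_ident_minus: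
  assumes "absolutely_continuous_on S f"
  shows "absolutely_continuous_on S (\<lambda>x. x - f x)"
  unfolding absolutely_continuous_on_def
proof (intro allI impI)
  fix \<epsilon> :: real assume "\<epsilon> > 0"
  then obtain \<delta> where d: "\<delta> > 0" "\<And>D T. D division_of T \<Longrightarrow> T \<subseteq> S \<Longrightarrow> (\<Sum>K\<in>D. Sup K - Inf K) < \<delta> \<Longrightarrow>
        (\<Sum>K\<in>D. \<bar>f (Sup K) - f (Inf K)\<bar>) < \<epsilon>/2"
    using assms unfolding absolutely_continuous_on_def by (metis half_gt_zero)
  show "\<exists>\<delta>>0. \<forall>D T. D division_of T \<and> T \<subseteq> S \<and> (\<Sum>K\<in>D. Sup K - Inf K) < \<delta> \<longrightarrow>
        (\<Sum>K\<in>D. \<bar>Sup K - f (Sup K) - (Inf K - f (Inf K))\<bar>) < \<epsilon>"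
  proof (intro exI[of _ "min \<delta> (\<epsilon>/2)"] conjI allI impI)
    fix D T assume *: "D division_of T \<and> T \<subseteq> S \<and> (\<Sum>K\<in>D. Sup K - Inf K) < min \<delta> (\<epsilon>/2)"
    then have "(\<Sum>K\<in>D. \<bar>f (Sup K) - f (Inf K)\<bar>) < \<epsilon>/2" by (intro d) auto
    moreover have "(\<Sum>K\<in>D. \<bar>Sup K - f (Sup K) - (Inf K - f (Inf K))\<bar>)
        \<le> (\<Sum>K\<in>D. (Sup K - Inf K) + \<bar>f (Sup K) - f (Inf K)\<bar>)"
    proof (rule sum_mono)
      fix K assume "K \<in> D"
      then obtain u v where "K = cbox u v" "K \<noteq> {}" using * by (metis division_ofD(3,4))
      then have "Inf K \<le> Sup K" by auto
      then show "\<bar>Sup K - f (Sup K) - (Inf K - f (Inf K))\<bar> \<le> (Sup K - Inf K) + \<bar>f (Sup K) - f (Inf K)\<bar>"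
        by linarith
    qed
    ultimately show "(\<Sum>K\<in>D. \<bar>Sup K - f (Sup K) - (Inf K - f (Inf K))\<bar>) < \<epsilon>"
      using * by (simp add: sum.distrib)
  qed (use d \<open>\<epsilon> > 0\<close> in auto)
qed

lemma lipschitz_absolutely_continuous_on:
  assumes "\<And>x y. x \<in> S \<Longrightarrow> y \<in> S \<Longrightarrow> x \<le> y \<Longrightarrow> \<bar>f y - f x\<bar> \<le> y - x"
  shows "absolutely_continuous_on S f"
  unfolding absolutely_continuous_on_def
proof (intro allI impI)
  fix \<epsilon> :: real assume "\<epsilon> > 0"
  show "\<exists>\<delta>>0. \<forall>D T. D division_of T \<and> T \<subseteq> S \<and> (\<Sum>K\<in>D. Sup K - Inf K) < \<delta> \<longrightarrow>
        (\<Sum>K\<in>D. \<bar>f (Sup K) - f (Inf K)\<bar>) < \<epsilon>"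
  proof (intro exI[of _ \<epsilon>] conjI allI impI)
    fix D T assume *: "D division_of T \<and> T \<subseteq> S \<and> (\<Sum>K\<in>D. Sup K - Inf K) < \<epsilon>"
    have "(\<Sum>K\<in>D. \<bar>f (Sup K) - f (Inf K)\<bar>) \<le> (\<Sum>K\<in>D. (Sup K - Inf K))"
    proof (rule sum_mono)
      fix K assume K: "K \<in> D"
      then obtain u v where uv: "K = cbox u v" "K \<noteq> {}" using * by (metis division_ofD(3,4))
      moreover have "K \<subseteq> S" using K * by (meson division_ofD(2) order_trans)
      ultimately have "u \<le> v" "u \<in> S" "v \<in> S" by auto
      then show "\<bar>f (Sup K) - f (Inf K)\<bar> \<le> Sup K - Inf K" using assms[of u v] uv by simp
    qed
    then show "(\<Sum>K\<in>D. \<bar>f (Sup K) - f (Inf K)\<bar>) < \<epsilon>" using * by linarith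
  qed fact
qed

section \<open>Paths with steps of height 0 and 1\<close>

text \<open>
  A path of \<open>n\<close> steps of height \<open>0\<close> or \<open>1\<close> is encoded by the set \<open>A\<close> of its up-steps; \<open>a i y\<close> is the
  probability of an up-step at time \<open>i\<close> from position \<open>y\<close>.  The martingale part of the path is
  \<open>path_fluct\<close>.
\<close>

definition path_weight :: "(nat \<Rightarrow> nat \<Rightarrow> real) \<Rightarrow> nat \<Rightarrow> nat set \<Rightarrow> real" where
  "path_weight a n A = (\<Prod>i<n. if i \<in> A then a i (card (A \<inter> {..<i})) else 1 - a i (card (A \<inter> {..<i})))"

definition path_fluct :: "(nat \<Rightarrow> nat \<Rightarrow> real) \<Rightarrow> nat \<Rightarrow> nat set \<Rightarrow> real" where
  "path_fluct a n A = real (card (A \<inter> {..<n})) - (\<Sum>i<n. a i (card (A \<inter> {..<i})))"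

lemma card_Int_lessThan_le: "card (A \<inter> {..<i}) \<le> i"
  by (metis card_lessThan card_mono finite_lessThan inf_le2)

lemma card_Int_lessThan_Suc: "card (A \<inter> {..<Suc i}) = card (A \<inter> {..<i}) + of_bool (i \<in> A)"
  by (simp add: lessThan_Suc Int_insert_right)

lemma sum_Pow_lessThan_Suc:
  fixes g :: "nat set \<Rightarrow> real"
  shows "(\<Sum>A\<in>Pow {..<Suc n}. g A) = (\<Sum>A\<in>Pow {..<n}. g A + g (insert n A))"
proof -
  have "(\<Sum>A\<in>Pow {..<Suc n}. g A) = (\<Sum>A\<in>Pow {..<n}. g A) + (\<Sum>A\<in>insert n ` Pow {..<n}. g A)"
    unfolding lessThan_Suc Pow_insert by (intro sum.union_disjoint) auto
  also have "(\<Sum>A\<in>insert n ` Pow {..<n}. g A) = (\<Sum>A\<in>Pow {..<n}. g (insert n A))"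
    by (intro sum.reindex_cong[of "insert n"]) (auto simp: inj_on_def)
  finally show ?thesis by (simp add: sum.distrib)
qed

lemma path_weight_cong:
  assumes "A \<inter> {..<n} = B \<inter> {..<n}"
  shows "path_weight a n A = path_weight a n B"
proof -
  have "x \<in> A \<longleftrightarrow> x \<in> B" if "x < n" for x
    using assms that by (metis IntD1 IntI lessThan_iff)
  then have "A \<inter> {..<i} = B \<inter> {..<i}" "i \<in> A \<longleftrightarrow> i \<in> B" if "i < n" for i
    using that by auto
  then show ?thesis unfolding path_weight_def by (intro prod.cong) auto
qed

lemma path_fluct_cong:
  assumes "A \<inter> {..<n} = B \<inter> {..<n}"
  shows "path_fluct a n A = path_fluct a n B"
proof -
  have "x \<in> A \<longleftrightarrow> x \<in> B" if "x < n" for x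
    using assms that by (metis IntD1 IntI lessThan_iff)
  then have "A \<inter> {..<i} = B \<inter> {..<i}" if "i < n" for i
    using that by auto
  then show ?thesis unfolding path_fluct_def using assms by (intro arg_cong2[of _ _ _ _ minus] sum.cong) auto
qed

lemma path_weight_insert:
  assumes "A \<subseteq> {..<n}"
  shows "path_weight a n (insert n A) = path_weight a n A" "path_fluct a n (insert n A) = path_fluct a n A"
  using assms by (auto intro!: path_weight_cong path_fluct_cong)

lemma path_weight_Suc:
  assumes "A \<subseteq> {..<n}"
  shows "path_weight a (Suc n) A = path_weight a n A * (1 - a n (card A))"
    and "path_weight a (Suc n) (insert n A) = path_weight a n A * a n (card A)"
proof -
  have "A \<inter> {..<n} = A" "insert n A \<inter> {..<n} = A" "n \<notin> A" using assms by auto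
  then show "path_weight a (Suc n) A = path_weight a n A * (1 - a n (card A))"
    "path_weight a (Suc n) (insert n A) = path_weight a n A * a n (card A)"
    using path_weight_insert[OF assms, of a] by (simp_all add: path_weight_def)
qed

lemma path_fluct_Suc:
  assumes "A \<subseteq> {..<n}"
  shows "path_fluct a (Suc n) A = path_fluct a n A - a n (card A)"
    and "path_fluct a (Suc n) (insert n A) = path_fluct a n A + (1 - a n (card A))"
proof -
  have *: "A \<inter> {..<n} = A" "insert n A \<inter> {..<n} = A" "n \<notin> A" using assms by auto
  have "finite A" using assms finite_subset by blast
  have "A \<inter> {..<Suc n} = A" "insert n A \<inter> {..<Suc n} = insert n A" using assms by auto
  with * \<open>finite A\<close> path_weight_insert(2)[OF assms, of a]
  show "path_fluct a (Suc n) A = path_fluct a n A - a n (card A)"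
    "path_fluct a (Suc n) (insert n A) = path_fluct a n A + (1 - a n (card A))"
    by (simp_all add: path_fluct_def)
qed

lemma path_weight_nonneg:
  assumes "\<And>i y. i < n \<Longrightarrow> y \<le> i \<Longrightarrow> 0 \<le> a i y \<and> a i y \<le> 1"
  shows "0 \<le> path_weight a n A"
  unfolding path_weight_def using assms card_Int_lessThan_le by (intro prod_nonneg) auto

text \<open>Consistency of the laws of paths of different lengths: the two continuations of a path
  carry factors that add up to 1, so the later steps sum out.\<close>

lemma sum_path_weight_marginal:
  assumes "N \<le> n"
  shows "(\<Sum>A\<in>Pow {..<n}. path_weight a n A * g (A \<inter> {..<N})) = (\<Sum>A\<in>Pow {..<N}. path_weight a N A * g A)"
  using assms
proof (induction n rule: dec_induct)
  case base
  show ?case by (intro sum.cong refl) (simp add: Int_absorb2)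
next
  case (step n)
  have "(\<Sum>A\<in>Pow {..<Suc n}. path_weight a (Suc n) A * g (A \<inter> {..<N}))
      = (\<Sum>A\<in>Pow {..<n}. path_weight a n A * g (A \<inter> {..<N}))"
    unfolding sum_Pow_lessThan_Suc
  proof (intro sum.cong refl)
    fix A assume A: "A \<in> Pow {..<n}"
    then have "insert n A \<inter> {..<N} = A \<inter> {..<N}" using step by auto
    with A show "path_weight a (Suc n) A * g (A \<inter> {..<N}) + path_weight a (Suc n) (insert n A) * g (insert n A \<inter> {..<N}) =
        path_weight a n A * g (A \<inter> {..<N})"
      by (simp add: path_weight_Suc algebra_simps)
  qed
  then show ?case using step by simp
qed

lemma sum_path_weight: "(\<Sum>A\<in>Pow {..<n}. path_weight a n A) = 1"
  using sum_path_weight_marginal[of 0 n a "\<lambda>_. 1"] by (simp add: path_weight_def)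

text \<open>The increment of \<open>path_fluct\<close> is \<open>1 - a\<close> with probability
  \<open>a\<close> and \<open>- a\<close> with probability \<open>1 - a\<close>. Its mean is 0, so
  the cross term cancels and each step adds \<open>a * (1 - a) \<le> 1\<close> to the second
  moment.\<close>

lemma sum_path_weight_fluct_square:
  assumes "\<And>i y. i < n \<Longrightarrow> y \<le> i \<Longrightarrow> 0 \<le> a i y \<and> a i y \<le> 1"
  shows "(\<Sum>A\<in>Pow {..<n}. path_weight a n A * (path_fluct a n A)\<^sup>2) \<le> real n"
  using assms
proof (induction n)
  case 0
  show ?case by (simp add: path_fluct_def)
next
  case (Suc n)
  have "(\<Sum>A\<in>Pow {..<Suc n}. path_weight a (Suc n) A * (path_fluct a (Suc n) A)\<^sup>2)
     = (\<Sum>A\<in>Pow {..<n}. path_weight a n A * (path_fluct a n A)\<^sup>2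
          + path_weight a n A * (a n (card A) * (1 - a n (card A))))"
    unfolding sum_Pow_lessThan_Suc
    by (intro sum.cong refl) (simp add: path_weight_Suc path_fluct_Suc power2_eq_square algebra_simps)
  also have "\<dots> \<le> (\<Sum>A\<in>Pow {..<n}. path_weight a n A * (path_fluct a n A)\<^sup>2 + path_weight a n A)"
  proof (intro sum_mono add_left_mono)
    fix A assume "A \<in> Pow {..<n}"
    then have "card A \<le> n" using card_mono[of "{..<n}" A] by auto
    then have "0 \<le> a n (card A)" "a n (card A) \<le> 1" using Suc.prems by auto
    then have "a n (card A) * (1 - a n (card A)) \<le> 1" by (intro mult_le_one) auto
    moreover have "0 \<le> path_weight a n A" using Suc.prems by (intro path_weight_nonneg) auto
    ultimately show "path_weight a n A * (a n (card A) * (1 - a n (card A))) \<le> path_weight a n A"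
      by (metis mult.right_neutral mult_left_mono)
  qed
  also have "\<dots> \<le> real n + 1"
    using Suc.IH Suc.prems by (simp add: sum.distrib sum_path_weight)
  finally show ?case by simp
qed

text \<open>Chebyshev's inequality at each time \<open>N j\<close> and a union bound over
  \<open>J\<close>. The times will be the block boundaries; between them a path moves by at most the
  length of a block.\<close>

lemma path_weight_chebyshev:
  assumes a: "\<And>i y. i < n \<Longrightarrow> y \<le> i \<Longrightarrow> 0 \<le> a i y \<and> a i y \<le> 1"
    and J: "finite J" "\<And>j. j \<in> J \<Longrightarrow> N j \<le> n" and d: "0 < d"
  shows "1 - real (card J) * real n / d\<^sup>2
    \<le> (\<Sum>A | A \<subseteq> {..<n} \<and> (\<forall>j\<in>J. \<bar>path_fluct a (N j) A\<bar> \<le> d). path_weight a n A)"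
proof -
  define G where "G = {A. A \<subseteq> {..<n} \<and> (\<forall>j\<in>J. \<bar>path_fluct a (N j) A\<bar> \<le> d)}"
  have w: "0 \<le> path_weight a n A" for A using a by (rule path_weight_nonneg)
  have finG: "finite G" "G \<subseteq> Pow {..<n}" unfolding G_def by (auto intro: finite_subset[of _ "Pow {..<n}"])
  have "(\<Sum>A\<in>Pow {..<n} - G. path_weight a n A)
      \<le> (\<Sum>A\<in>Pow {..<n} - G. \<Sum>j\<in>J. path_weight a n A * ((path_fluct a (N j) A)\<^sup>2 / d\<^sup>2))"
  proof (rule sum_mono)
    fix A assume A: "A \<in> Pow {..<n} - G"
    then obtain j where j: "j \<in> J" "\<bar>path_fluct a (N j) A\<bar> > d"
      unfolding G_def by (auto simp: not_le)
    have "d\<^sup>2 \<le> (path_fluct a (N j) A)\<^sup>2" using j d by (simp add: abs_le_square_iff[symmetric])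
    then have "1 \<le> (path_fluct a (N j) A)\<^sup>2 / d\<^sup>2" using d by (simp add: field_simps)
    then have "path_weight a n A \<le> path_weight a n A * ((path_fluct a (N j) A)\<^sup>2 / d\<^sup>2)"
      using w[of A] by (metis mult.right_neutral mult_left_mono)
    also have "\<dots> \<le> (\<Sum>j\<in>J. path_weight a n A * ((path_fluct a (N j) A)\<^sup>2 / d\<^sup>2))"
      using J j w[of A] by (intro member_le_sum) auto
    finally show "path_weight a n A \<le> \<dots>" .
  qed
  also have "\<dots> \<le> (\<Sum>A\<in>Pow {..<n}. \<Sum>j\<in>J. path_weight a n A * ((path_fluct a (N j) A)\<^sup>2 / d\<^sup>2))"
    using w by (intro sum_mono2) (auto intro!: sum_nonneg)
  also have "\<dots> = (\<Sum>j\<in>J. (\<Sum>A\<in>Pow {..<n}. path_weight a n A * (path_fluct a (N j) (A \<inter> {..<N j}))\<^sup>2) / d\<^sup>2)"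
    unfolding sum_divide_distrib
    by (subst sum.swap) (auto intro!: sum.cong arg_cong[of _ _ "\<lambda>x. _ * x\<^sup>2 / _"] path_fluct_cong)
  also have "\<dots> \<le> (\<Sum>j\<in>J. real n / d\<^sup>2)"
  proof (intro sum_mono divide_right_mono)
    fix j assume "j \<in> J"
    then have N: "N j \<le> n" using J by auto
    have "(\<Sum>A\<in>Pow {..<n}. path_weight a n A * (path_fluct a (N j) (A \<inter> {..<N j}))\<^sup>2)
        = (\<Sum>A\<in>Pow {..<N j}. path_weight a (N j) A * (path_fluct a (N j) A)\<^sup>2)"
      by (rule sum_path_weight_marginal[OF N])
    also have "\<dots> \<le> real (N j)" using a N by (intro sum_path_weight_fluct_square) auto
    finally show "(\<Sum>A\<in>Pow {..<n}. path_weight a n A * (path_fluct a (N j) (A \<inter> {..<N j}))\<^sup>2) \<le> real n"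
      using N by linarith
  qed auto
  finally have "(\<Sum>A\<in>Pow {..<n} - G. path_weight a n A) \<le> real (card J) * real n / d\<^sup>2" by simp
  moreover have "(\<Sum>A\<in>Pow {..<n} - G. path_weight a n A) = 1 - (\<Sum>A\<in>G. path_weight a n A)"
    using finG by (simp add: sum_diff sum_path_weight)
  ultimately show ?thesis unfolding G_def by linarith
qed

text \<open>A bound on the likelihood ratio along a single path. The kernels are compared only at
  positions visited by \<open>A\<close>, and \<open>e\<close> may depend on \<open>A\<close>, so the
  hypotheses can exploit that \<open>A\<close> lies in a tube.\<close>

lemma path_weight_compare:
  assumes "\<And>i. i < n \<Longrightarrow> i \<in> A \<Longrightarrow> 0 \<le> a i (card (A \<inter> {..<i})) \<and>
      a i (card (A \<inter> {..<i})) \<le> exp (e i) * b i (card (A \<inter> {..<i}))"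
    and "\<And>i. i < n \<Longrightarrow> i \<notin> A \<Longrightarrow> 0 \<le> 1 - a i (card (A \<inter> {..<i})) \<and>
      1 - a i (card (A \<inter> {..<i})) \<le> exp (e i) * (1 - b i (card (A \<inter> {..<i})))"
  shows "path_weight a n A \<le> exp (\<Sum>i<n. e i) * path_weight b n A"
proof -
  have "path_weight a n A \<le> (\<Prod>i<n. exp (e i) * (if i \<in> A then b i (card (A \<inter> {..<i})) else 1 - b i (card (A \<inter> {..<i}))))"
    unfolding path_weight_def using assms by (intro prod_mono) auto
  also have "\<dots> = exp (\<Sum>i<n. e i) * path_weight b n A"
    unfolding path_weight_def by (simp add: prod.distrib exp_sum)
  finally show ?thesis .
qed

text \<open>The clamp is the part of step \<open>i\<close> completed by time \<open>t\<close>. As a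
  sum over the up-steps the linear interpolation needs no floor, and monotonicity and the Lipschitz
  bound can be read off term by term.\<close>

definition path_fn :: "nat \<Rightarrow> nat set \<Rightarrow> real \<Rightarrow> real" where
  "path_fn n A = (\<lambda>t\<in>{0..1}. (\<Sum>i\<in>A \<inter> {..<n}. min 1 (max 0 (real n * t - real i))) / real n)"

lemma sum_clamp: "(\<Sum>i<n. min 1 (max 0 (x - real i))) = min (real n) (max 0 x)"
  by (induction n) (auto simp: min_def max_def)

lemma path_fn_mono_lipschitz:
  assumes "0 < n" "0 \<le> s" "s \<le> t" "t \<le> 1"
  shows "0 \<le> path_fn n A t - path_fn n A s" "path_fn n A t - path_fn n A s \<le> t - s"
proof -
  define c where "c x i = min 1 (max 0 (real n * x - real i))" for x i
  have c: "c s i \<le> c t i" for i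
  proof -
    have "real n * s \<le> real n * t" using assms by (intro mult_left_mono) auto
    then show ?thesis unfolding c_def by auto
  qed
  have pf: "path_fn n A x = (\<Sum>i\<in>A \<inter> {..<n}. c x i) / n" if "0 \<le> x" "x \<le> 1" for x
    using that by (simp add: path_fn_def c_def)
  have diff: "path_fn n A t - path_fn n A s = (\<Sum>i\<in>A \<inter> {..<n}. c t i - c s i) / n"
    using assms by (simp add: pf sum_subtractf diff_divide_distrib)
  show "0 \<le> path_fn n A t - path_fn n A s"
    unfolding diff using c by (intro divide_nonneg_nonneg sum_nonneg) auto
  have "(\<Sum>i\<in>A \<inter> {..<n}. c t i - c s i) \<le> (\<Sum>i<n. c t i - c s i)"
    using c by (intro sum_mono2) auto
  also have "\<dots> = min (real n) (max 0 (real n * t)) - min (real n) (max 0 (real n * s))"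
    unfolding sum_subtractf c_def sum_clamp ..
  also have "\<dots> = real n * t - real n * s"
    using assms by (simp add: mult_left_le min_def max_def)
  finally show "path_fn n A t - path_fn n A s \<le> t - s"
    unfolding diff using assms(1) by (simp add: field_simps)
qed

text \<open>At \<open>x\<close> the steps before \<open>k\<close> are complete, step
  \<open>k\<close> is partly done and the others have not begun. The case \<open>k = n\<close>
  arises at \<open>t = 1\<close>, where there is no current step.\<close>

lemma sum_clamp_floor:
  fixes d :: "nat \<Rightarrow> real"
  assumes "real k \<le> x" "x \<le> real k + 1" "k \<le> n"
  shows "(\<Sum>i<n. d i * min 1 (max 0 (x - real i))) = (\<Sum>i<k. d i) + (if k < n then (x - real k) * d k else 0)"
proof -
  have "(\<Sum>i<n. d i * min 1 (max 0 (x - real i))) = (\<Sum>i<n. (if i < k then d i else 0) + (if i = k then (x - real k) * d k else 0))"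
  proof (intro sum.cong refl)
    fix i
    consider "i + 1 \<le> k" | "i = k" | "k + 1 \<le> i" by linarith
    then show "d i * min 1 (max 0 (x - real i)) = (if i < k then d i else 0) + (if i = k then (x - real k) * d k else 0)"
    proof cases
      case 1
      then have "real i + 1 \<le> real k" by linarith
      then have "min 1 (max 0 (x - real i)) = 1" using assms by linarith
      then show ?thesis using 1 by simp
    next
      case 2
      then have "min 1 (max 0 (x - real i)) = x - real k" using assms by auto
      then show ?thesis using 2 by simp
    next
      case 3
      then have "real k + 1 \<le> real i" by linarith
      then have "min 1 (max 0 (x - real i)) = 0" using assms by linarith
      then show ?thesis using 3 by simp
    qed
  qed
  also have "\<dots> = (\<Sum>i<n. if i < k then d i else 0) + (\<Sum>i<n. if i = k then (x - real k) * d k else 0)"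
    by (rule sum.distrib)
  also have "(\<Sum>i<n. if i < k then d i else 0) = (\<Sum>i<k. d i)"
    using assms(3) by (intro sum.mono_neutral_cong_right) auto
  also have "(\<Sum>i<n. if i = k then (x - real k) * d k else 0) = (if k < n then (x - real k) * d k else 0)"
    by (subst sum.delta) auto
  finally show ?thesis .
qed

lemma path_fn_eq_sum:
  assumes "t \<in> {0..1}"
  shows "path_fn n A t = (\<Sum>i<n. of_bool (i \<in> A) * min 1 (max 0 (real n * t - real i))) / real n"
proof -
  have "(\<Sum>i<n. of_bool (i \<in> A) * min 1 (max 0 (real n * t - real i)))
     = (\<Sum>i\<in>A \<inter> {..<n}. min 1 (max 0 (real n * t - real i)))"
    by (intro sum.mono_neutral_cong_right) auto
  then show ?thesis using assms unfolding path_fn_def by simp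
qed

lemma path_fn_grid:
  assumes "0 < n" "k \<le> n"
  shows "path_fn n A (real k / real n) = real (card (A \<inter> {..<k})) / real n"
proof -
  have "real n * (real k / real n) = real k" using assms by simp
  moreover have "(\<Sum>i<k. of_bool (i \<in> A)) = real (card (A \<inter> {..<k}))"
    by (subst sum_of_bool_eq) (simp_all add: Int_commute)
  ultimately show ?thesis
    using assms sum_clamp_floor[of k "real k" n "\<lambda>i. of_bool (i \<in> A)"]
    by (subst path_fn_eq_sum) auto
qed

lemma path_fn_zero: "0 < n \<Longrightarrow> path_fn n A 0 = 0"
  using path_fn_grid[of n 0 A] by simp

text \<open>The start of block \<open>j\<close> is the least \<open>i\<close> with \<open>j / m \<le> i / n\<close>.\<close>

definition block_start :: "nat \<Rightarrow> nat \<Rightarrow> nat \<Rightarrow> nat" where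
  "block_start m n j = (j * n + m - 1) div m"

lemma less_block_start_iff:
  assumes "0 < m"
  shows "i < block_start m n j \<longleftrightarrow> i * m < j * n"
proof -
  have "i < block_start m n j \<longleftrightarrow> Suc i \<le> (j * n + m - 1) div m" by (auto simp: block_start_def)
  also have "\<dots> \<longleftrightarrow> Suc i * m \<le> j * n + m - 1" using assms by (simp add: less_eq_div_iff_mult_less_eq)
  also have "\<dots> \<longleftrightarrow> i * m < j * n" using assms by auto
  finally show ?thesis .
qed

lemma block_start_0 [simp]: "0 < m \<Longrightarrow> block_start m n 0 = 0"
  by (simp add: block_start_def)

lemma block_start_self [simp]: "0 < m \<Longrightarrow> block_start m n m = n"
  using less_block_start_iff[where j=m] by (metis less_not_refl mult.commute mult_less_cancel1 nat_neq_iff)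

lemma block_start_mono: "0 < m \<Longrightarrow> i \<le> j \<Longrightarrow> block_start m n i \<le> block_start m n j"
  unfolding block_start_def by (intro div_le_mono diff_le_mono add_le_mono mult_le_mono) auto

lemma block_start_bounds:
  assumes "0 < m"
  shows "real j * real n / real m \<le> real (block_start m n j)"
    "real (block_start m n j) \<le> real j * real n / real m + 1"
proof -
  have "j * n \<le> block_start m n j * m"
    using less_block_start_iff[OF assms, of "block_start m n j" n j] by simp
  then have "real j * real n \<le> real (block_start m n j) * real m" by (metis of_nat_le_iff of_nat_mult)
  then show "real j * real n / real m \<le> real (block_start m n j)" using assms by (simp add: field_simps)
  show "real (block_start m n j) \<le> real j * real n / real m + 1"
  proof (cases "block_start m n j")
    case (Suc i)
    then have "i * m < j * n" using less_block_start_iff[OF assms, of i n j] by simp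
    then have "real i * real m \<le> real j * real n" by (metis less_imp_le of_nat_le_iff of_nat_mult)
    then show ?thesis using assms Suc by (simp add: field_simps)
  qed auto
qed

lemma block_index:
  assumes "0 < m" "0 < n" "i \<in> {block_start m n j..<block_start m n (Suc j)}"
  shows "i * m div n = j"
proof -
  have "\<not> i * m < j * n" "i * m < Suc j * n"
    using assms less_block_start_iff[of m i n j] less_block_start_iff[of m i n "Suc j"] by auto
  then show ?thesis by (simp add: div_nat_eqI mult.commute)
qed

lemma sum_blocks:
  fixes g :: "nat \<Rightarrow> real"
  assumes "0 < m"
  shows "(\<Sum>i<block_start m n k. g i) = (\<Sum>j<k. \<Sum>i\<in>{block_start m n j..<block_start m n (Suc j)}. g i)"
proof (induction k)
  case (Suc k)
  have "(\<Sum>i<block_start m n (Suc k). g i)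
      = (\<Sum>i<block_start m n k. g i) + (\<Sum>i\<in>{block_start m n k..<block_start m n (Suc k)}. g i)"
    using block_start_mono[OF assms, of k "Suc k" n]
    unfolding lessThan_atLeast0 by (subst sum.atLeastLessThan_concat) auto
  then show ?case using Suc by simp
qed (use assms in simp)

lemma card_block:
  assumes "0 < m"
  shows "real (card (A \<inter> {..<block_start m n (Suc j)})) - real (card (A \<inter> {..<block_start m n j}))
    = real (card (A \<inter> {block_start m n j..<block_start m n (Suc j)}))"
proof -
  have "A \<inter> {..<block_start m n (Suc j)} =
      (A \<inter> {..<block_start m n j}) \<union> (A \<inter> {block_start m n j..<block_start m n (Suc j)})"
    using block_start_mono[OF assms, of j "Suc j" n] by auto
  moreover have "card ((A \<inter> {..<block_start m n j}) \<union> (A \<inter> {block_start m n j..<block_start m n (Suc j)}))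
     = card (A \<inter> {..<block_start m n j}) + card (A \<inter> {block_start m n j..<block_start m n (Suc j)})"
    by (intro card_Un_disjoint) auto
  ultimately show ?thesis by simp
qed

text \<open>The log-likelihood ratio of a path is a sum with value \<open>c j\<close> on the
  up-steps and \<open>d j\<close> on the flat steps of block \<open>j\<close>. It depends on
  \<open>A\<close> only through the numbers of up-steps per block, which are within \<open>D\<close>
  of \<open>n / m * q j\<close>. The 1 in \<open>D + 1\<close> is the deviation of the block length
  from \<open>n / m\<close>, which affects the count of flat steps.\<close>

lemma sum_block_values:
  fixes c d :: "nat \<Rightarrow> real"
  assumes m: "0 < m" and n: "0 < n"
    and D: "\<And>j. j < m \<Longrightarrow> \<bar>real (card (A \<inter> {block_start m n j..<block_start m n (Suc j)})) - n / m * q j\<bar> \<le> D"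
  shows "\<bar>(\<Sum>i<n. if i \<in> A then c (i * m div n) else d (i * m div n)) - n / m * (\<Sum>j<m. q j * c j + (1 - q j) * d j)\<bar>
    \<le> (D + 1) * (\<Sum>j<m. \<bar>c j\<bar> + \<bar>d j\<bar>)"
proof -
  define B where "B j = {block_start m n j..<block_start m n (Suc j)}" for j
  define k where "k j = real (card (A \<inter> B j))" for j
  define l where "l j = real (block_start m n (Suc j)) - real (block_start m n j)" for j
  have cardB: "real (card (B j)) = l j" for j
    using block_start_mono[OF m, of j "Suc j" n] by (simp add: B_def l_def)
  have l: "\<bar>l j - n / m\<bar> \<le> 1" for j
    using block_start_bounds[OF m, where n=n and j=j] block_start_bounds[OF m, where n=n and j="Suc j"] m
    unfolding l_def by (simp add: add_divide_distrib distrib_right)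
  have kd: "real (card (B j - A)) = l j - k j" for j
  proof -
    have "card (B j) = card (B j \<inter> A) + card (B j - A)"
      by (subst card_Un_disjoint[symmetric]) (auto simp: B_def Int_Diff_Un)
    then show ?thesis using cardB[of j] unfolding k_def by (simp add: Int_commute)
  qed
  have "(\<Sum>i<n. if i \<in> A then c (i * m div n) else d (i * m div n))
      = (\<Sum>j<m. \<Sum>i\<in>B j. if i \<in> A then c (i * m div n) else d (i * m div n))"
    using sum_blocks[OF m, where n=n and k=m] m unfolding B_def by simp
  also have "\<dots> = (\<Sum>j<m. \<Sum>i\<in>B j. if i \<in> A then c j else d j)"
    using block_index[OF m n] unfolding B_def by (intro sum.cong) auto
  also have "\<dots> = (\<Sum>j<m. k j * c j + (l j - k j) * d j)"
  proof (intro sum.cong refl)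
    fix j
    have "(\<Sum>i\<in>B j. if i \<in> A then c j else d j) = real (card (B j \<inter> A)) * c j + real (card (B j - A)) * d j"
      by (subst sum.If_cases) (auto simp: B_def Diff_eq)
    then show "(\<Sum>i\<in>B j. if i \<in> A then c j else d j) = k j * c j + (l j - k j) * d j"
      unfolding kd by (simp add: k_def Int_commute)
  qed
  finally have eq: "(\<Sum>i<n. if i \<in> A then c (i * m div n) else d (i * m div n)) - n / m * (\<Sum>j<m. q j * c j + (1 - q j) * d j)
    = (\<Sum>j<m. (k j - n / m * q j) * c j + ((l j - n / m) - (k j - n / m * q j)) * d j)"
    by (simp add: sum_distrib_left sum_subtractf[symmetric] algebra_simps)
  have "\<bar>\<Sum>j<m. (k j - n / m * q j) * c j + ((l j - n / m) - (k j - n / m * q j)) * d j\<bar>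
      \<le> (\<Sum>j<m. \<bar>(k j - n / m * q j) * c j + ((l j - n / m) - (k j - n / m * q j)) * d j\<bar>)"
    by (rule sum_abs)
  also have "\<dots> \<le> (\<Sum>j<m. (D + 1) * (\<bar>c j\<bar> + \<bar>d j\<bar>))"
  proof (rule sum_mono)
    fix j assume "j \<in> {..<m}"
    then have "j < m" by simp
    have Dj: "\<bar>k j - n / m * q j\<bar> \<le> D" using D[OF \<open>j < m\<close>] unfolding k_def B_def .
    have "\<bar>(l j - n / m) - (k j - n / m * q j)\<bar> \<le> D + 1" using Dj l[of j] by linarith
    then have "\<bar>((l j - n / m) - (k j - n / m * q j)) * d j\<bar> \<le> (D + 1) * \<bar>d j\<bar>"
      unfolding abs_mult by (intro mult_right_mono) auto
    moreover have "\<bar>(k j - n / m * q j) * c j\<bar> \<le> (D + 1) * \<bar>c j\<bar>"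
      unfolding abs_mult using Dj by (intro mult_right_mono) auto
    ultimately show "\<bar>(k j - n / m * q j) * c j + ((l j - n / m) - (k j - n / m * q j)) * d j\<bar> \<le> (D + 1) * (\<bar>c j\<bar> + \<bar>d j\<bar>)"
      unfolding distrib_left by (intro order_trans[OF abs_triangle_ineq] add_mono)
  qed
  finally show ?thesis unfolding eq by (simp only: sum_distrib_left)
qed

section \<open>Probabilities of tubes\<close>

text \<open>The factor \<open>v i\<close> stands for a reciprocal \<open>1 / s\<close>. In this form
  \<open>v i = 0\<close> is allowed, which describes a certain up-step.\<close>

definition kern :: "(nat \<Rightarrow> real) \<Rightarrow> nat \<Rightarrow> nat \<Rightarrow> real" where
  "kern v i y = 1 - real y * v i"

text \<open>Values outside the unit interval are left free. Thus the mixed path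
  \<open>tilt e c \<phi>\<close> is admissible although it is not extensional and hence no point of
  \<open>C01\<close>.\<close>

definition admissible :: "(real \<Rightarrow> real) \<Rightarrow> bool" where
  "admissible \<phi> \<longleftrightarrow> \<phi> 0 = 0 \<and> (\<forall>s t. 0 \<le> s \<and> s \<le> t \<and> t \<le> 1 \<longrightarrow> 0 \<le> \<phi> t - \<phi> s \<and> \<phi> t - \<phi> s \<le> t - s)"

definition chord :: "(real \<Rightarrow> real) \<Rightarrow> nat \<Rightarrow> nat \<Rightarrow> real" where
  "chord \<phi> m j = real m * (\<phi> (real (Suc j) / real m) - \<phi> (real j / real m))"

text \<open>
  The cost of block \<open>j\<close> is the entropy of its slope \<open>q\<close> relative to the probability \<open>1 - u\<close> of an
  up-step.  Inside the block the transition probabilities vary by at most \<open>4 / j\<close>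
  (lemma \<open>block_ratio\<close>).  For the upper bound \<open>q\<close> is pushed to \<open>r\<close> inside \<open>(0, 1)\<close>, and block \<open>0\<close>,
  where \<open>\<phi> t / t\<close> is not controlled, is free of charge.  For the lower bound the path climbs with
  slope \<open>1\<close> in block \<open>0\<close>, and \<open>\<rho>\<close> is an a priori lower bound for the transition probabilities.
\<close>

definition upper_rate :: "real \<Rightarrow> (real \<Rightarrow> real) \<Rightarrow> nat \<Rightarrow> nat \<Rightarrow> real" where
  "upper_rate \<beta> \<phi> m j = (if j = 0 then 0 else
     (let q = chord \<phi> m j; r = (q + 1 / real m) / (1 + 2 / real m); u = \<beta> * \<phi> (real j / real m) / (real j / real m)
      in q * ln (r / (1 - u + 4 / real j)) + (1 - q) * ln ((1 - r) / (u + 4 / real j))))"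

definition lower_rate :: "real \<Rightarrow> real \<Rightarrow> (real \<Rightarrow> real) \<Rightarrow> nat \<Rightarrow> nat \<Rightarrow> real" where
  "lower_rate \<beta> \<rho> \<phi> m j = (if j = 0 then ln (1 / \<rho>) else
     (let q = chord \<phi> m j;
          u = \<beta> * (\<phi> (real j / real m) + 1 / real m - \<phi> (1 / real m)) / (real j / real m)
      in q * ln (q / max \<rho> (1 - u - 4 / real j)) + (1 - q) * ln ((1 - q) / max \<rho> (u - 4 / real j))))"

lemma admissibleD:
  assumes "admissible \<phi>"
  shows "\<phi> 0 = 0" "\<And>s t. 0 \<le> s \<Longrightarrow> s \<le> t \<Longrightarrow> t \<le> 1 \<Longrightarrow> \<phi> s \<le> \<phi> t"
    "\<And>s t. 0 \<le> s \<Longrightarrow> s \<le> t \<Longrightarrow> t \<le> 1 \<Longrightarrow> \<phi> t - \<phi> s \<le> t - s"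
    "\<And>t. 0 \<le> t \<Longrightarrow> t \<le> 1 \<Longrightarrow> 0 \<le> \<phi> t" "\<And>t. 0 \<le> t \<Longrightarrow> t \<le> 1 \<Longrightarrow> \<phi> t \<le> t"
    "\<And>s t. 0 \<le> s \<Longrightarrow> s \<le> 1 \<Longrightarrow> 0 \<le> t \<Longrightarrow> t \<le> 1 \<Longrightarrow> \<bar>\<phi> t - \<phi> s\<bar> \<le> \<bar>t - s\<bar>"
proof -
  have *: "0 \<le> \<phi> t - \<phi> s \<and> \<phi> t - \<phi> s \<le> t - s" if "0 \<le> s" "s \<le> t" "t \<le> 1" for s t
    using assms that unfolding admissible_def by blast
  show z: "\<phi> 0 = 0" using assms unfolding admissible_def by blast
  show "\<phi> s \<le> \<phi> t" "\<phi> t - \<phi> s \<le> t - s" if "0 \<le> s" "s \<le> t" "t \<le> 1" for s t using *[OF that] by linarith+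
  show "0 \<le> \<phi> t" "\<phi> t \<le> t" if "0 \<le> t" "t \<le> 1" for t using *[of 0 t] that z by linarith+
  show "\<bar>\<phi> t - \<phi> s\<bar> \<le> \<bar>t - s\<bar>" if "0 \<le> s" "s \<le> 1" "0 \<le> t" "t \<le> 1" for s t
    using *[of s t] *[of t s] that by (cases "s \<le> t") linarith+
qed

lemma chord_bounds:
  assumes "admissible \<phi>" "j < m"
  shows "0 \<le> chord \<phi> m j" "chord \<phi> m j \<le> 1"
proof -
  have m: "0 < m" using assms by simp
  have "real j / m \<le> real (Suc j) / m" "real (Suc j) / m \<le> 1" using assms m by (auto simp: field_simps)
  then have "0 \<le> \<phi> (real (Suc j) / m) - \<phi> (real j / m)"
      "\<phi> (real (Suc j) / m) - \<phi> (real j / m) \<le> real (Suc j) / m - real j / m"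
    using admissibleD(2,3)[OF assms(1), of "real j / m" "real (Suc j) / m"] by auto
  moreover have "real (Suc j) / m - real j / m = 1 / m" by (simp add: add_divide_distrib)
  ultimately show "0 \<le> chord \<phi> m j" "chord \<phi> m j \<le> 1"
    unfolding chord_def using m by (auto simp: field_simps)
qed

text \<open>Three replacements turn the flat-step probability \<open>Y * w\<close> at time
  \<open>i\<close> into its value at the start of block \<open>j\<close>. The position error
  \<open>2 / m\<close>, divided by a time of at least \<open>j / m\<close>, costs
  \<open>2 / j\<close>; replacing the time \<open>i / n\<close> by \<open>j / m\<close> costs
  \<open>1 / j\<close>; replacing \<open>i * w\<close> by \<open>\<beta>\<close> costs
  \<open>1 / m \<le> 1 / j\<close>.\<close>

lemma block_ratio:
  fixes i j m n :: nat and Y y w \<beta> :: real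
  assumes m: "0 < m" and i: "j * n \<le> i * m" "i * m < Suc j * n" and j: "0 < j" "j < m"
    and y: "0 \<le> y" "y \<le> real j / m" and Yy: "\<bar>Y / n - y\<bar> \<le> 2 / m" and Y: "0 \<le> Y" "Y \<le> i"
    and w: "\<bar>real i * w - \<beta>\<bar> \<le> 1 / m" and \<beta>: "0 \<le> \<beta>" "\<beta> \<le> 1"
  shows "\<bar>Y * w - \<beta> * y / (real j / m)\<bar> \<le> 4 / j"
proof -
  have n: "0 < n" using i by (cases n) auto
  define s where "s = real j / m"
  define t where "t = real i / n"
  define x where "x = Y / n"
  have "real j * real n \<le> real i * real m" using i(1) by (metis of_nat_le_iff of_nat_mult)
  moreover have "real i * real m \<le> (real j + 1) * real n"
    using i(2) by (metis less_imp_le of_nat_le_iff of_nat_mult of_nat_Suc add.commute)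
  ultimately have st: "s \<le> t" "t \<le> s + 1 / m" using m n unfolding s_def t_def by (simp_all add: field_simps)
  have s: "0 < s" using j m unfolding s_def by simp
  then have t: "0 < t" using st by simp
  then have i0: "0 < i" unfolding t_def using n by (simp add: zero_less_divide_iff)
  have xt: "Y / i = x / t" unfolding x_def t_def using n by simp
  have js: "1 / (m * s) = 1 / j" unfolding s_def using m by simp
  have "x / t - y / s = (x - y) / t - y / s * ((t - s) / t)"
    using s t by (simp add: field_simps)
  moreover have "\<bar>(x - y) / t\<bar> \<le> 2 / j"
  proof -
    have "\<bar>(x - y) / t\<bar> \<le> (2 / m) / s"
      unfolding abs_divide using Yy s t st unfolding x_def by (intro frac_le) auto
    then show ?thesis using js by simp
  qed
  moreover have "\<bar>y / s * ((t - s) / t)\<bar> \<le> 1 / j"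
  proof -
    have "0 \<le> y / s" "y / s \<le> 1" using y s unfolding s_def[symmetric] by auto
    moreover have "0 \<le> (t - s) / t" using s t st by simp
    moreover have "(t - s) / t \<le> (1 / m) / s" using s t st by (intro frac_le) auto
    ultimately have "y / s * ((t - s) / t) \<le> 1 * ((1 / m) / s)" "0 \<le> y / s * ((t - s) / t)"
      by (intro mult_mono mult_nonneg_nonneg; simp)+
    then show ?thesis using js by simp
  qed
  moreover have "\<bar>a - b\<bar> \<le> 3 / j" if "\<bar>a\<bar> \<le> 2 / j" "\<bar>b\<bar> \<le> 1 / j" for a b :: real
  proof -
    have "3 / real j = 2 / real j + 1 / real j" by simp
    then show ?thesis using that abs_triangle_ineq4[of a b] by linarith
  qed
  ultimately have "\<bar>x / t - y / s\<bar> \<le> 3 / j" by metis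
  then have "\<bar>\<beta> * (x / t - y / s)\<bar> \<le> 1 * (3 / j)"
    unfolding abs_mult using \<beta> by (intro mult_mono) auto
  moreover have "\<bar>x / t * (i * w - \<beta>)\<bar> \<le> 1 * (1 / m)"
    unfolding abs_mult using w Y i0 unfolding xt[symmetric] by (intro mult_mono) auto
  moreover have "1 / real m \<le> 1 / j" using j by (simp add: frac_le)
  moreover have "Y * w - \<beta> * y / s = x / t * (i * w - \<beta>) + \<beta> * (x / t - y / s)"
    unfolding xt[symmetric] using i0 by (simp add: field_simps)
  moreover have "\<bar>a + b\<bar> \<le> 4 / j" if "\<bar>b\<bar> \<le> 1 * (3 / j)" "\<bar>a\<bar> \<le> 1 * (1 / m)" "1 / real m \<le> 1 / j" for a b :: real
  proof -
    have "4 / real j = 3 / real j + 1 / real j" by simp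
    then show ?thesis using that abs_triangle_ineq[of a b] by linarith
  qed
  ultimately have "\<bar>Y * w - \<beta> * y / s\<bar> \<le> 4 / j" by metis
  then show ?thesis unfolding s_def .
qed

section \<open>Tube estimates for kernels of urn type\<close>

lemma eventually_real_ge: "\<forall>\<^sub>F n in sequentially. (x::real) \<le> real n"
  by (metis eventually_at_top_linorder of_nat_le_iff order_trans real_arch_simple)

text \<open>All that the tube estimates know of the chain. The bound \<open>i * v i \<le> 1\<close>
  makes \<open>kern v i y\<close> a probability for every reachable position
  \<open>y \<le> i\<close>, and \<open>\<beta>\<close> is \<open>1 / \<alpha>\<close>.\<close>

locale urn_kernel =
  fixes v :: "nat \<Rightarrow> real" and \<beta> :: real
  assumes v_nonneg: "\<And>i. 0 \<le> v i" and v_le: "\<And>i. real i * v i \<le> 1"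
    and \<beta>: "0 < \<beta>" "\<beta> < 1" and v_lim: "(\<lambda>i. real i * v i) \<longlonglongrightarrow> \<beta>"
begin

lemma kern_bounds:
  assumes "y \<le> i"
  shows "0 \<le> kern v i y" "kern v i y \<le> 1"
proof -
  have "real y * v i \<le> real i * v i" using assms v_nonneg by (intro mult_right_mono) auto
  then show "0 \<le> kern v i y" unfolding kern_def using v_le[of i] by linarith
  show "kern v i y \<le> 1" unfolding kern_def using v_nonneg by simp
qed

text \<open>On each path of the tube the weight of the chain is at most
  \<open>exp (- (n * a))\<close> times the weight under a comparison kernel whose weights sum to 1.
  The gap between the mean of \<open>upper_rate\<close> and \<open>a\<close> pays for the width of
  the tube and for rounding.\<close>

lemma upper_tube:
  fixes a :: real
  assumes \<phi>: "admissible \<phi>" and m: "0 < m" and a: "a < (\<Sum>j<m. upper_rate \<beta> \<phi> m j) / m"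
  shows "\<exists>\<delta>>0. \<forall>\<^sub>F n in sequentially.
    (\<Sum>A | A \<subseteq> {..<n} \<and> (\<forall>t\<in>{0..1}. \<bar>path_fn n A t - \<phi> t\<bar> \<le> \<delta>). path_weight (kern v) n A) \<le> exp (- (real n * a))"
proof -
  define q where "q = chord \<phi> m"
  define r where "r j = (q j + 1 / m) / (1 + 2 / m)" for j
  define u where "u j = \<beta> * \<phi> (real j / m) / (real j / m)" for j
  \<comment> \<open>\<open>c j\<close> and \<open>d j\<close> bound the logarithm of chain
    probability over comparison probability for an up-step and a flat step. Adding
    \<open>4 / j\<close> turns the values at the start of the block into upper bounds on the whole
    block.\<close>
  define c where "c j = (if j = 0 then 0 else ln ((1 - u j + 4 / j) / r j))" for j
  define d where "d j = (if j = 0 then 0 else ln ((u j + 4 / j) / (1 - r j)))" for j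
  define J where "J = (\<Sum>j<m. upper_rate \<beta> \<phi> m j) / m"
  define C where "C = (\<Sum>j<m. \<bar>c j\<bar> + \<bar>d j\<bar>)"
  have C0: "0 \<le> C" unfolding C_def by (intro sum_nonneg) auto
  have q01: "0 \<le> q j" "q j \<le> 1" if "j < m" for j
    using chord_bounds[OF \<phi> that] unfolding q_def by auto
  have r01: "0 < r j" "r j < 1" if "j < m" for j
  proof -
    have "0 < 1 / real m" using m by simp
    then have "0 < q j + 1 / m" "q j + 1 / m < 1 + (1 / m + 1 / m)" using q01[OF that] by linarith+
    then have "0 < q j + 1 / m" "q j + 1 / m < 1 + 2 / m" by simp_all
    then show "0 < r j" "r j < 1" unfolding r_def by (auto simp only: zero_less_divide_iff divide_less_eq_1)
  qed
  have u01: "0 \<le> u j" "u j \<le> 1" if "0 < j" "j < m" for j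
  proof -
    have t: "0 < real j / m" "real j / m \<le> 1" using that m by auto
    have "0 \<le> \<phi> (real j / m)" "\<phi> (real j / m) \<le> real j / m" using admissibleD(4,5)[OF \<phi>] t by auto
    then have "0 \<le> \<phi> (real j / m) / (real j / m)" "\<phi> (real j / m) / (real j / m) \<le> 1" using t by (auto simp only: divide_le_eq_1 zero_le_divide_iff)
    then have "0 \<le> \<beta> * (\<phi> (real j / m) / (real j / m))" "\<beta> * (\<phi> (real j / m) / (real j / m)) \<le> 1 * 1"
      using \<beta> by (intro mult_nonneg_nonneg mult_mono; simp)+
    then show "0 \<le> u j" "u j \<le> 1" unfolding u_def by simp_all
  qed
  have pos: "0 < 1 - u j + 4 / j" "0 < u j + 4 / j" if "0 < j" "j < m" for j
    using u01[OF that] that by (auto intro: add_nonneg_pos)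
  have J: "real m * J = - (\<Sum>j<m. q j * c j + (1 - q j) * d j)"
  proof -
    have "upper_rate \<beta> \<phi> m j = - (q j * c j + (1 - q j) * d j)" if "j < m" for j
    proof (cases "j = 0")
      case False
      have "ln (r j / (1 - u j + 4 / j)) = - c j" "ln ((1 - r j) / (u j + 4 / j)) = - d j"
        using False r01[OF that] pos[of j] that unfolding c_def d_def by (simp_all add: ln_div)
      then show ?thesis using False unfolding upper_rate_def Let_def q_def[symmetric] r_def[symmetric] u_def[symmetric]
        by simp
    qed (simp add: upper_rate_def c_def d_def)
    then have "(\<Sum>j<m. upper_rate \<beta> \<phi> m j) = (\<Sum>j<m. - (q j * c j + (1 - q j) * d j))"
      by (intro sum.cong) auto
    then show ?thesis unfolding J_def using m by (simp only: sum_negf) simp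
  qed
  \<comment> \<open>With \<open>\<delta> \<le> 1 / m\<close> the position error inside a block stays
    within the \<open>2 / m\<close> of \<open>block_ratio\<close>. The other bound limits the effect
    of the tube on the exponent, \<open>2 * \<delta> * C\<close> per step, to half of the gap
    \<open>J - a\<close>.\<close>
  define \<delta> where "\<delta> = min (1 / m) ((J - a) / (4 * (C + 1)))"
  have Ja: "0 < J - a" using a unfolding J_def by simp
  have \<delta>: "0 < \<delta>" unfolding \<delta>_def using m C0 Ja by simp
  have \<delta>C: "2 * \<delta> * C \<le> (J - a) / 2"
  proof -
    have "\<delta> \<le> (J - a) / (4 * (C + 1))" unfolding \<delta>_def by simp
    then have "\<delta> * (C + 1) \<le> (J - a) / 4" using C0 by (simp add: field_simps)
    moreover have "\<delta> * C \<le> \<delta> * (C + 1)" using \<delta> by simp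
    ultimately show ?thesis by simp
  qed
  have "\<forall>\<^sub>F i in sequentially. \<bar>real i * v i - \<beta>\<bar> < 1 / m"
    using v_lim m by (auto simp: tendsto_iff dist_real_def)
  then obtain i0 where i0: "\<And>i. i \<ge> i0 \<Longrightarrow> \<bar>real i * v i - \<beta>\<bar> < 1 / m"
    unfolding eventually_sequentially by blast
  \<comment> \<open>\<open>m * i0 \<le> n\<close> puts the first \<open>i0\<close> times into block
    0, so that afterwards \<open>i * v i\<close> is within \<open>1 / m\<close> of
    \<open>\<beta>\<close>. The third condition lets half of \<open>n * (J - a)\<close> absorb the
    rounding terms \<open>3 * C\<close>.\<close>
  have ev: "\<forall>\<^sub>F n in sequentially. real m \<le> n \<and> real (m * i0) \<le> n \<and> 8 * C / (J - a) \<le> n"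
    by (intro eventually_conj eventually_real_ge)
  have "\<forall>\<^sub>F n in sequentially.
    (\<Sum>A | A \<subseteq> {..<n} \<and> (\<forall>t\<in>{0..1}. \<bar>path_fn n A t - \<phi> t\<bar> \<le> \<delta>). path_weight (kern v) n A) \<le> exp (- (real n * a))"
    using ev
  proof eventually_elim
    case (elim n)
    have "m \<le> n" "m * i0 \<le> n" using elim by (simp_all only: of_nat_le_iff)
    then have n: "0 < n" "m \<le> n" "m * i0 \<le> n" using m by simp_all
    have nC: "4 * C \<le> n * (J - a) / 2" using elim Ja by (simp add: field_simps)
    define N where "N = block_start m n"
    \<comment> \<open>the comparison kernel: the chain itself in block \<open>0\<close>, independent steps afterwards\<close>
    define b where "b i y = (if i * m div n = 0 then kern v i y else r (i * m div n))" for i y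
    define tube where "tube = {A. A \<subseteq> {..<n} \<and> (\<forall>t\<in>{0..1}. \<bar>path_fn n A t - \<phi> t\<bar> \<le> \<delta>)}"
    have blk: "i * m div n < m" if "i < n" for i
      using that m n by (simp add: div_less_iff_less_mult mult.commute)
    have b01: "0 \<le> b i y \<and> b i y \<le> 1" if "i < n" "y \<le> i" for i y
      using kern_bounds[OF that(2)] r01[OF blk[OF that(1)]] unfolding b_def by auto
    have step: "path_weight (kern v) n A \<le> exp (- (real n * a)) * path_weight b n A" if "A \<in> tube" for A
    proof -
      define Y where "Y i = card (A \<inter> {..<i})" for i
      have Yi: "Y i \<le> i" for i unfolding Y_def by (rule card_Int_lessThan_le)
      have tube: "\<bar>path_fn n A t - \<phi> t\<bar> \<le> \<delta>" if "0 \<le> t" "t \<le> 1" for t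
        using \<open>A \<in> tube\<close> that unfolding tube_def by auto
      have grid: "\<bar>real (Y k) / n - \<phi> (real k / n)\<bar> \<le> \<delta>" if "k \<le> n" for k
        using tube[of "real k / n"] path_fn_grid[OF n(1) that, of A] that n unfolding Y_def by simp
      \<comment> \<open>The start of block \<open>j\<close> is within \<open>1 / n\<close> of
        \<open>j / m\<close>; after scaling by \<open>n\<close> this is the summand 1.\<close>
      have YN: "\<bar>real (Y (N j)) - n * \<phi> (real j / m)\<bar> \<le> n * \<delta> + 1" if "j \<le> m" for j
      proof -
        have Nn: "N j \<le> n" using block_start_mono[OF m that, of n] m unfolding N_def by simp
        have "\<bar>real (N j) / n - real j / m\<bar> \<le> 1 / n"
        proof -
          have "real (N j) / n - real j / m = (real (N j) - real j * real n / m) / n"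
            using n by (simp add: field_simps)
          moreover have "\<bar>real (N j) - real j * real n / m\<bar> \<le> 1"
            using block_start_bounds[OF m, where n=n and j=j] unfolding N_def by linarith
          ultimately show ?thesis by (simp add: divide_right_mono)
        qed
        moreover have "\<bar>\<phi> (real (N j) / n) - \<phi> (real j / m)\<bar> \<le> \<bar>real (N j) / n - real j / m\<bar>"
          using Nn that n m by (intro admissibleD(6)[OF \<phi>]) auto
        ultimately have "\<bar>real (Y (N j)) / n - \<phi> (real j / m)\<bar> \<le> \<delta> + 1 / n"
          using grid[OF Nn] by linarith
        then have "n * \<bar>real (Y (N j)) / n - \<phi> (real j / m)\<bar> \<le> n * (\<delta> + 1 / n)"
          by (intro mult_left_mono) auto
        moreover have "n * \<bar>real (Y (N j)) / n - \<phi> (real j / m)\<bar> = \<bar>n * (real (Y (N j)) / n - \<phi> (real j / m))\<bar>"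
          by (simp add: abs_mult)
        moreover have "n * (real (Y (N j)) / n - \<phi> (real j / m)) = real (Y (N j)) - n * \<phi> (real j / m)"
          "n * (\<delta> + 1 / n) = n * \<delta> + 1" using n by (simp_all add: field_simps)
        ultimately show ?thesis by simp
      qed
      have k: "\<bar>real (card (A \<inter> {block_start m n j..<block_start m n (Suc j)})) - n / m * q j\<bar> \<le> 2 * real n * \<delta> + 2"
        if "j < m" for j
      proof -
        have "n / m * q j = n * \<phi> (real (Suc j) / m) - n * \<phi> (real j / m)"
          unfolding q_def chord_def using m by (simp add: field_simps)
        moreover have "real (card (A \<inter> {block_start m n j..<block_start m n (Suc j)})) = real (Y (N (Suc j))) - real (Y (N j))"
          using card_block[OF m, of A n j] unfolding Y_def N_def by simp
        moreover have "\<bar>b' - a' - (y - x)\<bar> \<le> 2 * real n * \<delta> + 2"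
          if "\<bar>a' - x\<bar> \<le> n * \<delta> + 1" "\<bar>b' - y\<bar> \<le> n * \<delta> + 1" for a' b' x y :: real
          using that by (simp add: abs_le_iff algebra_simps)
        ultimately show ?thesis using YN[OF less_imp_le[OF that]] YN[OF Suc_leI[OF that]] by metis
      qed
      define e where "e i = (if i \<in> A then c (i * m div n) else d (i * m div n))" for i
      have u_close: "\<bar>real (Y i) * v i - u j\<bar> \<le> 4 / j" if "i < n" "j = i * m div n" "0 < j" for i j
      proof -
        have j: "j < m" using blk that by simp
        have ij: "j * n \<le> i * m" "i * m < Suc j * n"
          using that n by (simp_all add: div_less_iff_less_mult less_eq_div_iff_mult_less_eq[symmetric] dividend_less_div_times)
        have "1 * n \<le> i * m" using ij that by (metis One_nat_def Suc_leI le_trans mult_le_mono1)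
        then have "m * i0 \<le> m * i" using n(3) by (metis le_trans mult.commute mult_1)
        then have "i0 \<le> i" using m by simp
        have "\<bar>real (Y i) / n - \<phi> (real j / m)\<bar> \<le> 2 / m"
        proof -
          have "real j * real n \<le> real i * real m" "real i * real m \<le> (real j + 1) * real n"
            using ij by (metis of_nat_le_iff of_nat_mult, metis less_imp_le of_nat_le_iff of_nat_mult of_nat_Suc add.commute)
          then have "real j / m \<le> real i / n" "real i / n \<le> real j / m + 1 / m"
            using m n(1) by (simp_all add: field_simps)
          then have "\<bar>real i / n - real j / m\<bar> \<le> 1 / m" by linarith
          moreover have "\<bar>\<phi> (real i / n) - \<phi> (real j / m)\<bar> \<le> \<bar>real i / n - real j / m\<bar>"
            using that j n by (intro admissibleD(6)[OF \<phi>]) auto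
          moreover have "\<delta> \<le> 1 / m" unfolding \<delta>_def by simp
          ultimately show ?thesis using grid[of i] that by simp
        qed
        then show ?thesis unfolding u_def
          using ij j that m \<beta> Yi[of i] i0[OF \<open>i0 \<le> i\<close>] admissibleD(4,5)[OF \<phi>, of "real j / m"]
          by (intro block_ratio) auto
      qed
      have "path_weight (kern v) n A \<le> exp (\<Sum>i<n. e i) * path_weight b n A"
      proof (rule path_weight_compare)
        fix i assume i: "i < n"
        define j where "j = i * m div n"
        have jm: "j < m" using blk[OF i] unfolding j_def .
        have ke: "exp (c j) * r j = 1 - u j + 4 / j" "exp (d j) * (1 - r j) = u j + 4 / j" if "0 < j"
          using that pos[OF that jm] r01[OF jm] unfolding c_def d_def by auto
        have kb: "0 \<le> kern v i (Y i)" "kern v i (Y i) \<le> 1" using kern_bounds[OF Yi] by auto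
        show "0 \<le> kern v i (card (A \<inter> {..<i})) \<and>
          kern v i (card (A \<inter> {..<i})) \<le> exp (e i) * b i (card (A \<inter> {..<i}))" if "i \<in> A"
        proof (cases "j = 0")
          case True
          then show ?thesis using that kb unfolding e_def b_def Y_def[symmetric] j_def[symmetric] by (simp add: c_def)
        next
          case False
          then show ?thesis using that kb ke u_close[OF i j_def] unfolding e_def b_def Y_def[symmetric] j_def[symmetric]
            by (simp add: kern_def)
        qed
        show "0 \<le> 1 - kern v i (card (A \<inter> {..<i})) \<and>
          1 - kern v i (card (A \<inter> {..<i})) \<le> exp (e i) * (1 - b i (card (A \<inter> {..<i})))" if "i \<notin> A"
        proof (cases "j = 0")
          case True
          then show ?thesis using that kb unfolding e_def b_def Y_def[symmetric] j_def[symmetric] by (simp add: d_def)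
        next
          case False
          then show ?thesis using that kb ke u_close[OF i j_def] unfolding e_def b_def Y_def[symmetric] j_def[symmetric]
            by (simp add: kern_def)
        qed
      qed
      also have "(\<Sum>i<n. e i) \<le> - (real n * a)"
      proof -
        have "\<bar>(\<Sum>i<n. e i) - n / m * (\<Sum>j<m. q j * c j + (1 - q j) * d j)\<bar> \<le> (2 * real n * \<delta> + 2 + 1) * C"
          unfolding e_def C_def by (rule sum_block_values[OF m n(1) k])
        moreover have "n / m * (\<Sum>j<m. q j * c j + (1 - q j) * d j) = - (n * J)"
        proof -
          have "(\<Sum>j<m. q j * c j + (1 - q j) * d j) = - (real m * J)" using J by linarith
          then show ?thesis using m by simp
        qed
        moreover have "(2 * real n * \<delta> + 2 + 1) * C \<le> n * (J - a)"
        proof -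
          have "n * (2 * \<delta> * C) \<le> n * ((J - a) / 2)" using \<delta>C by (intro mult_left_mono) auto
          moreover have "3 * C \<le> 4 * C" using C0 by simp
          ultimately show ?thesis using nC by (simp add: algebra_simps)
        qed
        ultimately show ?thesis by (simp add: algebra_simps)
      qed
      then have "exp (\<Sum>i<n. e i) * path_weight b n A \<le> exp (- (real n * a)) * path_weight b n A"
        using b01 by (intro mult_right_mono path_weight_nonneg) auto
      finally show ?thesis .
    qed
    have fin: "tube \<subseteq> Pow {..<n}" unfolding tube_def by auto
    have "(\<Sum>A\<in>tube. path_weight (kern v) n A) \<le> (\<Sum>A\<in>tube. exp (- (real n * a)) * path_weight b n A)"
      using step by (rule sum_mono)
    also have "\<dots> \<le> (\<Sum>A\<in>Pow {..<n}. exp (- (real n * a)) * path_weight b n A)"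
      using fin b01 by (intro sum_mono2) (auto intro!: mult_nonneg_nonneg path_weight_nonneg)
    also have "\<dots> = exp (- (real n * a))"
      by (simp add: sum_distrib_left[symmetric] sum_path_weight)
    finally show ?case unfolding tube_def .
  qed
  then show ?thesis using \<delta> by blast
qed

end

section \<open>The lower bound for tubes\<close>

lemma path_fn_admissible: "0 < n \<Longrightarrow> admissible (path_fn n A)"
  unfolding admissible_def using path_fn_mono_lipschitz path_fn_zero by auto

lemma card_Int_lessThan_mono: "(k::nat) \<le> i \<Longrightarrow> card (A \<inter> {..<k}) \<le> card (A \<inter> {..<i})"
  by (rule card_mono) (auto intro: less_le_trans)

lemma card_Int_lessThan_diff:
  assumes "(k::nat) \<le> i"
  shows "card (A \<inter> {..<i}) \<le> card (A \<inter> {..<k}) + (i - k)"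
proof -
  have "card (A \<inter> {..<i}) \<le> card ((A \<inter> {..<k}) \<union> {k..<i})" by (intro card_mono) auto
  also have "\<dots> \<le> card (A \<inter> {..<k}) + card {k..<i}" by (rule card_Un_le)
  finally show ?thesis by simp
qed

text \<open>Here the independent steps are bounded by the chain, so the transition probabilities are
  needed from below. From time \<open>i0\<close> on an up-step has probability at least
  \<open>(1 - \<beta>) / 2\<close>, because
  \<open>y * v i \<le> i * v i \<le> (1 + \<beta>) / 2\<close>. After block 0 a flat step has
  probability at least \<open>\<beta> * \<kappa> / 8\<close>, because
  \<open>y \<ge> \<kappa> / 4 * i\<close> and \<open>i * v i \<ge> \<beta> / 2\<close>. Both are at
  least \<open>\<rho>\<close>.\<close>

lemma (in urn_kernel) lower_tube:
  fixes b \<delta> \<rho> \<kappa> :: real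
  assumes \<phi>: "admissible \<phi>" and m: "0 < m"
    and \<kappa>: "0 < \<kappa>" "\<And>t. 0 \<le> t \<Longrightarrow> t \<le> 1 \<Longrightarrow> \<kappa> * t \<le> \<phi> t"
    and chord: "\<And>j. j < m \<Longrightarrow> 0 < chord \<phi> m j \<and> chord \<phi> m j < 1"
    and \<rho>: "0 < \<rho>" "\<rho> \<le> (1 - \<beta>) / 2" "\<rho> \<le> \<beta> * \<kappa> / 8"
    and \<delta>: "5 / m \<le> \<delta>" and b: "(\<Sum>j<m. lower_rate \<beta> \<rho> \<phi> m j) / m < b"
  shows "\<forall>\<^sub>F n in sequentially. exp (- (real n * b)) \<le>
    (\<Sum>A | A \<subseteq> {..<n} \<and> (\<forall>t\<in>{0..1}. \<bar>path_fn n A t - \<phi> t\<bar> \<le> \<delta>). path_weight (kern v) n A)"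
proof -
  define q where "q j = (if j = 0 then 1 else chord \<phi> m j)" for j
  \<comment> \<open>The path aimed at: it climbs to height \<open>1 / m\<close> in block 0 and then
    copies the increments of \<open>\<phi>\<close>. It lies above \<open>\<phi>\<close> by at most
    \<open>1 / m\<close>.\<close>
  define \<psi> where "\<psi> j = \<phi> (real j / m) + 1 / m - \<phi> (1 / m)" for j
  define u where "u j = \<beta> * \<psi> j / (real j / m)" for j
  define P where "P j = max \<rho> (1 - u j - 4 / j)" for j
  define U where "U j = max \<rho> (u j - 4 / j)" for j
  define c where "c j = (if j = 0 then ln (1 / \<rho>) else ln (q j / P j))" for j
  define d where "d j = (if j = 0 then 0 else ln ((1 - q j) / U j))" for j
  define J where "J = (\<Sum>j<m. lower_rate \<beta> \<rho> \<phi> m j) / m"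
  define C where "C = (\<Sum>j<m. \<bar>c j\<bar> + \<bar>d j\<bar>)"
  have C0: "0 \<le> C" unfolding C_def by (intro sum_nonneg) auto
  have \<rho>1: "\<rho> < 1" using \<rho> \<beta> by simp
  have q01: "0 \<le> q j" "q j \<le> 1" if "j < m" for j
    using chord[OF that] unfolding q_def by auto
  have J: "(\<Sum>j<m. q j * c j + (1 - q j) * d j) = real m * J"
  proof -
    have "lower_rate \<beta> \<rho> \<phi> m j = q j * c j + (1 - q j) * d j" if "j < m" for j
      unfolding lower_rate_def Let_def q_def c_def d_def P_def U_def u_def \<psi>_def by simp
    then have "(\<Sum>j<m. lower_rate \<beta> \<rho> \<phi> m j) = (\<Sum>j<m. q j * c j + (1 - q j) * d j)"
      by (intro sum.cong) auto
    then show ?thesis unfolding J_def using m by simp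
  qed
  have Jb: "0 < b - J" using b unfolding J_def by simp
  \<comment> \<open>\<open>n * \<eta>\<close> is the fluctuation allowed at block boundaries, and
    \<open>3 * \<eta>\<close> will bound the scaled position error there. The bounds keep this error
    below \<open>1 / (2 * m)\<close>, as needed for \<open>block_ratio\<close>, and below
    \<open>\<kappa> / (2 * m)\<close>, so that the path stays off height 0. The last one limits the
    change of the exponent to half of the gap \<open>b - J\<close>.\<close>
  define \<eta> where "\<eta> = min (min (1 / (6 * m)) (\<kappa> / (6 * m))) ((b - J) / (4 * (C + 1)))"
  have \<eta>: "0 < \<eta>" unfolding \<eta>_def using m C0 Jb \<kappa> by simp
  have \<eta>1: "3 * \<eta> \<le> 1 / (2 * m)" and \<eta>2: "3 * \<eta> \<le> \<kappa> / (2 * m)"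
  proof -
    have "\<eta> \<le> 1 / (6 * m)" "\<eta> \<le> \<kappa> / (6 * m)" unfolding \<eta>_def by auto
    then show "3 * \<eta> \<le> 1 / (2 * m)" "3 * \<eta> \<le> \<kappa> / (2 * m)" using m by (auto simp: field_simps)
  qed
  have \<eta>C: "2 * \<eta> * C \<le> (b - J) / 2"
  proof -
    have "\<eta> \<le> (b - J) / (4 * (C + 1))" unfolding \<eta>_def by simp
    then have "\<eta> * (C + 1) \<le> (b - J) / 4" using C0 by (simp add: field_simps)
    moreover have "\<eta> * C \<le> \<eta> * (C + 1)" using \<eta> by simp
    ultimately show ?thesis by simp
  qed
  define \<epsilon> where "\<epsilon> = min (1 / m) (min (\<beta> / 2) ((1 - \<beta>) / 2))"
  have "0 < \<epsilon>" unfolding \<epsilon>_def using m \<beta> by simp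
  then have "\<forall>\<^sub>F i in sequentially. \<bar>real i * v i - \<beta>\<bar> < \<epsilon>"
    using v_lim by (auto simp: tendsto_iff dist_real_def)
  then obtain i0 where "\<And>i. i \<ge> i0 \<Longrightarrow> \<bar>real i * v i - \<beta>\<bar> < \<epsilon>"
    unfolding eventually_sequentially by blast
  then have i0: "\<bar>real i * v i - \<beta>\<bar> \<le> 1 / m" "\<beta> / 2 \<le> real i * v i" "real i * v i \<le> (1 + \<beta>) / 2"
    if "i \<ge> i0" for i
  proof -
    have "\<bar>real i * v i - \<beta>\<bar> < \<epsilon>"
      using \<open>\<And>i. i \<ge> i0 \<Longrightarrow> \<bar>real i * v i - \<beta>\<bar> < \<epsilon>\<close> that by blast
    moreover have "\<epsilon> \<le> 1 / m" "\<epsilon> \<le> \<beta> / 2" "\<epsilon> \<le> (1 - \<beta>) / 2"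
      unfolding \<epsilon>_def by (metis min.cobounded1 min.cobounded2 order_trans)+
    ultimately show "\<bar>real i * v i - \<beta>\<bar> \<le> 1 / m" "\<beta> / 2 \<le> real i * v i" "real i * v i \<le> (1 + \<beta>) / 2"
      by (linarith, linarith, simp add: abs_less_iff field_simps)
  qed
  \<comment> \<open>In order: \<open>1 / n\<close> is at most half a block; the first
    \<open>i0\<close> steps lie in block 0; the other half of the gap absorbs the constants in the
    exponent and a factor 2; the errors at block boundaries fit into \<open>n * \<eta>\<close>;
    Chebyshev's bound leaves a mass of at least \<open>1 / 2\<close>.\<close>
  have ev: "\<forall>\<^sub>F n in sequentially. real (2 * m) \<le> n \<and> real (m * i0) \<le> n \<and>
      2 * ((real i0 + 2) * C + ln 2) / (b - J) \<le> n \<and> (real i0 + 1 + m) / \<eta> \<le> n \<and> 2 * (real m + 1) / \<eta>\<^sup>2 \<le> n"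
    by (intro eventually_conj eventually_real_ge)
  show ?thesis using ev
  proof eventually_elim
    case (elim n)
    then have "2 * m \<le> n" "m * i0 \<le> n" by (simp_all only: of_nat_le_iff)
    then have n: "0 < n" "2 * m \<le> n" "m * i0 \<le> n" using m by simp_all
    have mn: "1 / n \<le> 1 / (2 * m)" using n m by (simp add: frac_le)
    have nC: "(real i0 + 2) * C + ln 2 \<le> n * (b - J) / 2" using elim Jb by (simp add: field_simps)
    have n\<eta>: "real i0 + 1 + m \<le> n * \<eta>" using elim \<eta> by (simp add: field_simps)
    have n\<eta>2: "2 * (real m + 1) \<le> n * \<eta>\<^sup>2" using elim \<eta> by (simp add: field_simps)
    define N where "N = block_start m n"
    \<comment> \<open>The first \<open>i0\<close> steps follow the chain because an up-step may have probability \<open>0\<close> there.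
      Climbing during the rest of block \<open>0\<close> puts the path above \<open>\<phi>\<close>, which keeps the probability of
      a flat step bounded away from \<open>0\<close>.\<close>
    define bk where "bk i y = (if i < i0 then kern v i y else q (i * m div n))" for i y
    define tube where "tube = {A. A \<subseteq> {..<n} \<and> (\<forall>t\<in>{0..1}. \<bar>path_fn n A t - \<phi> t\<bar> \<le> \<delta>)}"
    define G where "G = {A. A \<subseteq> {..<n} \<and> (\<forall>j\<in>{..m}. \<bar>path_fluct bk (N j) A\<bar> \<le> n * \<eta>)}"
    define E where "E = n * J + (2 * n * \<eta> + real i0 + 2) * C"
    have blk: "i * m div n < m" if "i < n" for i
      using that m n by (simp add: div_less_iff_less_mult mult.commute)
    have bk01: "0 \<le> bk i y \<and> bk i y \<le> 1" if "i < n" "y \<le> i" for i y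
      using kern_bounds[OF that(2)] q01[OF blk[OF that(1)]] unfolding bk_def by auto
    have Nn: "N j \<le> n" if "j \<le> m" for j
      using block_start_mono[OF m that, of n] m unfolding N_def by simp
    have Nb: "real j * n / m \<le> N j" "N j \<le> real j * n / m + 1" for j
      using block_start_bounds[OF m, where n=n and j=j] unfolding N_def by auto
    have Nmono: "N j \<le> N (Suc j)" for j
      using block_start_mono[OF m, of j "Suc j" n] unfolding N_def by simp
    have N1: "i0 \<le> N j" if "0 < j" for j
    proof -
      have "\<not> i * m < i0 * m" if "N j \<le> i" for i
      proof -
        have "j * n \<le> i * m" using less_block_start_iff[OF m, of i n j] that unfolding N_def by simp
        moreover have "n \<le> j * n" using \<open>0 < j\<close> by simp
        ultimately have "m * i0 \<le> i * m" using n(3) by (metis le_trans)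
        then show ?thesis by (metis mult.commute not_less)
      qed
      from this[of "N j"] show ?thesis using m by simp
    qed
    have l: "\<bar>real (N (Suc j)) - real (N j) - n / m\<bar> \<le> 1" for j
      using Nb[of j] Nb[of "Suc j"] by (simp add: add_divide_distrib distrib_right)
    have good: "A \<in> tube \<and> path_weight bk n A \<le> exp E * path_weight (kern v) n A"
      if AG: "A \<in> G" and Aw: "path_weight bk n A \<noteq> 0" for A
    proof -
      define Y where "Y i = card (A \<inter> {..<i})" for i
      define S where "S i = path_fluct bk i A" for i
      have Yi: "Y i \<le> i" for i unfolding Y_def by (rule card_Int_lessThan_le)
      have S: "\<bar>S (N j)\<bar> \<le> n * \<eta>" if "j \<le> m" for j using AG that unfolding G_def S_def by auto
      \<comment> \<open>In block 0 the comparison kernel has \<open>q 0 = 1\<close> from time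
        \<open>i0\<close> on, so a flat step there would make the weight of \<open>A\<close>
        vanish.\<close>
      have ups: "i \<in> A" if "i0 \<le> i" "i < N 1" for i
      proof (rule ccontr)
        assume "i \<notin> A"
        have "i * m < n" using that(2) less_block_start_iff[OF m, of i n 1] unfolding N_def by simp
        then have "i * m div n = 0" by simp
        moreover have "i < n" using that(2) Nn[of 1] m by simp
        ultimately have "path_weight bk n A = 0"
          unfolding path_weight_def using that \<open>i \<notin> A\<close> by (intro prod_zero) (auto intro!: bexI[of _ i] simp: bk_def q_def)
        then show False using Aw by simp
      qed
      have Y1: "\<bar>real (Y (N 1)) - n / m\<bar> \<le> real i0 + 1"
      proof -
        have "card {i0..<N 1} \<le> Y (N 1)" unfolding Y_def using ups by (intro card_mono) auto
        then have "N 1 - i0 \<le> Y (N 1)" by simp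
        then show ?thesis using N1[of 1] Yi[of "N 1"] Nb[of 1] by (simp add: abs_le_iff)
      qed
      have step: "real (Y (N (Suc j))) - S (N (Suc j)) = real (Y (N j)) - S (N j) + (real (N (Suc j)) - real (N j)) * q j"
        if "0 < j" for j
      proof -
        have "(\<Sum>i<N (Suc j). bk i (Y i)) = (\<Sum>i<N j. bk i (Y i)) + (\<Sum>i\<in>{N j..<N (Suc j)}. bk i (Y i))"
          unfolding lessThan_atLeast0 using Nmono by (subst sum.atLeastLessThan_concat) auto
        also have "(\<Sum>i\<in>{N j..<N (Suc j)}. bk i (Y i)) = (\<Sum>i\<in>{N j..<N (Suc j)}. q j)"
        proof (rule sum.cong[OF refl])
          fix i assume "i \<in> {N j..<N (Suc j)}"
          then have "i * m div n = j" "i0 \<le> i" using block_index[OF m n(1), of i j] N1[OF that] unfolding N_def by auto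
          then show "bk i (Y i) = q j" unfolding bk_def by simp
        qed
        also have "\<dots> = (real (N (Suc j)) - real (N j)) * q j" using Nmono[of j] by simp
        finally show ?thesis unfolding S_def path_fluct_def Y_def by simp
      qed
      have lq: "\<bar>(real (N (Suc j)) - real (N j)) * q j - n / m * q j\<bar> \<le> 1" if "j < m" for j
      proof -
        have "\<bar>(real (N (Suc j)) - real (N j) - n / m) * q j\<bar> \<le> 1 * 1"
          unfolding abs_mult using l[of j] q01[OF that] by (intro mult_mono) auto
        then show ?thesis by (simp add: algebra_simps)
      qed
      have \<psi>q: "n * \<psi> (Suc j) = n * \<psi> j + n / m * q j" if "0 < j" for j
        using that m unfolding \<psi>_def q_def chord_def by (simp add: field_simps)
      \<comment> \<open>Up to the fluctuation \<open>S\<close> the path follows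
        \<open>n * \<psi>\<close>; each block adds a rounding error of at most 1, since its length
        differs from \<open>n / m\<close> by at most 1.\<close>
      have dev: "1 \<le> j \<Longrightarrow> j \<le> m \<Longrightarrow> \<bar>(real (Y (N j)) - S (N j) - n * \<psi> j) - (real (Y (N 1)) - S (N 1) - n / m)\<bar> \<le> j" for j
      proof (induction j rule: dec_induct)
        case base
        show ?case by (simp add: \<psi>_def)
      next
        case (step j)
        then have "\<bar>(real (Y (N j)) - S (N j) - n * \<psi> j) - (real (Y (N 1)) - S (N 1) - n / m)\<bar> \<le> j" by simp
        moreover have "\<bar>(real (N (Suc j)) - real (N j)) * q j - n / m * q j\<bar> \<le> 1" using lq step by simp
        moreover have "real (Y (N (Suc j))) - S (N (Suc j)) - n * \<psi> (Suc j)
          = (real (Y (N j)) - S (N j) - n * \<psi> j) + ((real (N (Suc j)) - real (N j)) * q j - n / m * q j)"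
          using \<open>\<And>j. 0 < j \<Longrightarrow> real (Y (N (Suc j))) - S (N (Suc j)) = _\<close>[of j] \<psi>q[of j] step by simp
        moreover have "\<bar>x + y - z\<bar> \<le> real (Suc j)" if "\<bar>x - z\<bar> \<le> j" "\<bar>y\<bar> \<le> 1" for x y z :: real using that by simp
        ultimately show ?case by metis
      qed
      \<comment> \<open>One \<open>n * \<eta>\<close> for each of \<open>S (N j)\<close> and
        \<open>S (N 1)\<close>, and a third for the deterministic errors \<open>i0 + 1\<close> from
        block 0 and at most \<open>m\<close> from the later blocks.\<close>
      have YN: "\<bar>real (Y (N j)) - n * \<psi> j\<bar> \<le> 3 * (n * \<eta>)" if "0 < j" "j \<le> m" for j
      proof -
        have gen: "\<bar>y - x\<bar> \<le> 3 * e" if "\<bar>(y - s - x) - (y1 - s1 - z)\<bar> \<le> r" "\<bar>s\<bar> \<le> e" "\<bar>s1\<bar> \<le> e"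
            "\<bar>y1 - z\<bar> \<le> i + 1" "i + 1 + k \<le> e" "r \<le> k" for y x s y1 s1 z e i k r :: real
          using that by linarith
        have "\<bar>(real (Y (N j)) - S (N j) - n * \<psi> j) - (real (Y (N 1)) - S (N 1) - n / m)\<bar> \<le> j"
          using that dev[of j] by simp
        moreover have "1 \<le> m" "real j \<le> real m" using that m by simp_all
        ultimately show ?thesis using gen[OF _ S[OF that(2)] S[of 1] Y1 n\<eta>] by blast
      qed
      have YN': "\<bar>real (Y (N j)) / n - \<psi> j\<bar> \<le> 3 * \<eta>" if "0 < j" "j \<le> m" for j
      proof -
        have "real (Y (N j)) / n - \<psi> j = (real (Y (N j)) - n * \<psi> j) / n" using n by (simp add: field_simps)
        then have "\<bar>real (Y (N j)) / n - \<psi> j\<bar> = \<bar>real (Y (N j)) - n * \<psi> j\<bar> / n" by (simp add: abs_divide)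
        also have "\<dots> \<le> 3 * (n * \<eta>) / n" using YN[OF that] by (intro divide_right_mono) auto
        finally show ?thesis using n by simp
      qed
      have k: "\<bar>real (card (A \<inter> {block_start m n j..<block_start m n (Suc j)})) - n / m * q j\<bar> \<le> 2 * n * \<eta> + real i0 + 1"
        if "j < m" for j
      proof -
        have cb: "real (card (A \<inter> {block_start m n j..<block_start m n (Suc j)})) = real (Y (N (Suc j))) - real (Y (N j))"
          using card_block[OF m, of A n j] unfolding Y_def N_def by simp
        have n\<eta>0: "0 \<le> n * \<eta>" using \<eta> by simp
        show ?thesis
        proof (cases "j = 0")
          case True
          then have "Y (N j) = 0" using m unfolding Y_def N_def by simp
          then show ?thesis using cb Y1 n\<eta>0 True by (simp add: q_def)
        next
          case False
          have gen: "\<bar>y' - y - x\<bar> \<le> 2 * e + i + 1" if "y' - s' = y - s + z" "\<bar>z - x\<bar> \<le> 1" "\<bar>s\<bar> \<le> e" "\<bar>s'\<bar> \<le> e" "0 \<le> i"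
            for y y' x s s' z e i :: real using that by linarith
          have "\<bar>real (Y (N (Suc j))) - real (Y (N j)) - n / m * q j\<bar> \<le> 2 * (n * \<eta>) + real i0 + 1"
            using False that S[of j] S[of "Suc j"] by (intro gen[OF step[of j] lq[OF that]]) auto
          then show ?thesis using cb by simp
        qed
      qed
      have \<psi>b: "\<phi> (real j / m) \<le> \<psi> j" "\<psi> j \<le> real j / m" "\<psi> j \<le> \<phi> (real j / m) + 1 / m" if "0 < j" "j \<le> m" for j
      proof -
        have "1 / real m \<le> real j / m" "real j / m \<le> 1" using that m by (auto simp: field_simps)
        moreover have "0 \<le> \<phi> (1 / m)" "\<phi> (1 / m) \<le> 1 / m" using m by (auto intro!: admissibleD(4,5)[OF \<phi>])
        ultimately show "\<phi> (real j / m) \<le> \<psi> j" "\<psi> j \<le> real j / m" "\<psi> j \<le> \<phi> (real j / m) + 1 / m"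
          using admissibleD(3)[OF \<phi>, of "1 / m" "real j / m"] unfolding \<psi>_def by auto
      qed
      have inblock: "\<bar>real (Y i) * v i - u j\<bar> \<le> 4 / j \<and> \<rho> \<le> real (Y i) * v i"
        if i: "i < n" "j = i * m div n" "0 < j" for i j
      proof -
        have j: "j < m" using blk that by simp
        have ij: "j * n \<le> i * m" "i * m < Suc j * n"
          using that n by (simp_all add: div_less_iff_less_mult less_eq_div_iff_mult_less_eq[symmetric] dividend_less_div_times)
        have iN: "N j \<le> i" "i < N (Suc j)"
          using ij less_block_start_iff[OF m, of i n] unfolding N_def by (auto simp: not_less[symmetric])
        have ii0: "i0 \<le> i" using iN N1[OF i(3)] by simp
        have ij': "real i \<le> (real j + 1) * n / m"
        proof -
          have "real i * real m \<le> (real j + 1) * real n"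
            using ij(2) by (metis less_imp_le of_nat_le_iff of_nat_mult of_nat_Suc add.commute)
          then show ?thesis using m by (simp add: field_simps)
        qed
        have Ylow: "Y (N j) \<le> Y i" unfolding Y_def using iN by (intro card_Int_lessThan_mono)
        have Yupp: "Y i \<le> Y (N j) + (i - N j)" unfolding Y_def using iN by (intro card_Int_lessThan_diff)
        have close: "\<bar>real (Y i) / n - \<psi> j\<bar> \<le> 2 / m"
        proof -
          have "real i - real (N j) \<le> n / m + 1" using l[of j] iN by linarith
          then have "real (Y i) - real (Y (N j)) \<le> n / m + 1" using Yupp iN by linarith
          then have "(real (Y i) - real (Y (N j))) / n \<le> (n / m + 1) / n" by (intro divide_right_mono) auto
          also have "(n / m + 1) / n = 1 / m + 1 / n" using n by (simp add: field_simps)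
          finally have "real (Y i) / n - real (Y (N j)) / n \<le> 1 / m + 1 / n" by (simp add: diff_divide_distrib)
          moreover have "real (Y (N j)) / n \<le> real (Y i) / n" using Ylow by (simp add: divide_right_mono)
          moreover have "1 / m + 1 / (2 * m) + 1 / (2 * m) = 2 / real m" using m by (simp add: field_simps)
          moreover have "0 \<le> 1 / real m" by simp
          ultimately show ?thesis using YN'[of j] i(3) j mn \<eta>1 by linarith
        qed
        \<comment> \<open>In block \<open>j\<close> the height is at least
          \<open>n * \<kappa> * (j - 1 / 2) / m\<close>, while
          \<open>i \<le> (j + 1) * n / m\<close>. The quotient \<open>(j - 1 / 2) / (j + 1)\<close>
          is smallest at \<open>j = 1\<close>, where it equals \<open>1 / 4\<close>.\<close>
        have "real (Y i) \<ge> \<kappa> / 4 * real i"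
        proof -
          have "\<kappa> * (real j / m) \<le> \<psi> j" using \<psi>b(1)[of j] \<kappa>(2)[of "real j / m"] j i(3) m by simp
          then have "\<kappa> * (real j / m) - \<kappa> / (2 * m) \<le> real (Y (N j)) / n"
            using YN'[of j] \<eta>2 i(3) j by linarith
          also have "\<dots> \<le> real (Y i) / n" using Ylow by (simp add: divide_right_mono)
          finally have "n * (\<kappa> * (real j / m) - \<kappa> / (2 * m)) \<le> real (Y i)" using n by (simp add: field_simps)
          moreover have "\<kappa> / 4 * real i \<le> \<kappa> / 4 * ((real j + 1) * n / m)" using ij' \<kappa> by (intro mult_left_mono) auto
          moreover have "\<kappa> / 4 * ((real j + 1) * n / m) \<le> n * (\<kappa> * (real j / m) - \<kappa> / (2 * m))"
          proof -
            have "1 \<le> real j" using i(3) by simp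
            then have "0 \<le> \<kappa> * n / (4 * m) * (3 * real j - 3)" using \<kappa> by (intro mult_nonneg_nonneg) auto
            moreover have "\<kappa> * n / (4 * m) * (3 * real j - 3)
               = n * (\<kappa> * (real j / m) - \<kappa> / (2 * m)) - \<kappa> / 4 * ((real j + 1) * n / m)"
              using m by (simp add: field_simps)
            ultimately show ?thesis by linarith
          qed
          ultimately show ?thesis by linarith
        qed
        then have "\<kappa> / 4 * real i * v i \<le> real (Y i) * v i" using v_nonneg by (rule mult_right_mono)
        moreover have "\<kappa> / 4 * (\<beta> / 2) \<le> \<kappa> / 4 * (real i * v i)" using i0(2)[OF ii0] \<kappa> by (intro mult_left_mono) auto
        ultimately have "\<rho> \<le> real (Y i) * v i" using \<rho>(3) by (simp add: mult_ac)
        moreover have "\<bar>real (Y i) * v i - u j\<bar> \<le> 4 / j"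
          unfolding u_def
        proof (rule block_ratio[OF m ij i(3) j _ _ close])
          show "0 \<le> \<psi> j" using \<psi>b(1)[of j] admissibleD(4)[OF \<phi>, of "real j / m"] i(3) j by simp
          show "\<psi> j \<le> real j / m" using \<psi>b(2)[of j] i(3) j by simp
        qed (use Yi i0(1)[OF ii0] \<beta> in auto)
        ultimately show ?thesis by blast
      qed
      define e where "e i = (if i \<in> A then c (i * m div n) else d (i * m div n))" for i
      have "path_weight bk n A \<le> exp (\<Sum>i<n. e i) * path_weight (kern v) n A"
      proof (rule path_weight_compare)
        fix i assume i: "i < n"
        define j where "j = i * m div n"
        have jm: "j < m" using blk[OF i] unfolding j_def .
        have kb: "0 \<le> kern v i (Y i)" "kern v i (Y i) \<le> 1" using kern_bounds[OF Yi] by auto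
        have bkb: "0 \<le> bk i (Y i)" "bk i (Y i) \<le> 1" using bk01[OF i Yi] by auto
        have k\<rho>: "\<rho> \<le> kern v i (Y i)" if "i0 \<le> i"
        proof -
          have "real (Y i) * v i \<le> real i * v i" using Yi v_nonneg by (intro mult_right_mono) auto
          then show ?thesis using i0(3)[OF that] \<rho>(2) unfolding kern_def by (simp add: field_simps)
        qed
        have ij0: "i0 \<le> i" if "0 < j"
        proof -
          have "1 \<le> i * m div n" using that unfolding j_def by simp
          then have "n \<le> i * m" using n by (simp add: less_eq_div_iff_mult_less_eq)
          then have "m * i0 \<le> m * i" using n(3) by (metis le_trans mult.commute)
          then show ?thesis using m by simp
        qed
        have pos: "0 < P j" "0 < U j" unfolding P_def U_def using \<rho>(1) by auto
        have ke: "exp (c j) * P j = q j" "exp (d j) * U j = 1 - q j" if "0 < j"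
          using that pos chord[OF jm] unfolding c_def d_def q_def by auto
        have PU: "P j \<le> kern v i (Y i)" "U j \<le> 1 - kern v i (Y i)" if "0 < j"
          using inblock[OF i j_def that] k\<rho>[OF ij0[OF that]] unfolding P_def U_def kern_def by auto
        have c0: "exp (c 0) = 1 / \<rho>" "exp (d 0) = 1" unfolding c_def d_def using \<rho>(1) by auto
        show "0 \<le> bk i (card (A \<inter> {..<i})) \<and>
          bk i (card (A \<inter> {..<i})) \<le> exp (e i) * kern v i (card (A \<inter> {..<i}))" if iA: "i \<in> A"
        proof -
          have "bk i (Y i) \<le> exp (c j) * kern v i (Y i)"
          proof (cases "j = 0")
            case True
            show ?thesis
            proof (cases "i < i0")
              case True
              have "1 * kern v i (Y i) \<le> 1 / \<rho> * kern v i (Y i)"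
                using kb \<rho>(1) \<rho>1 by (intro mult_right_mono) auto
              then show ?thesis using True \<open>j = 0\<close> c0 unfolding bk_def by simp
            next
              case False
              then have "1 / \<rho> * \<rho> \<le> 1 / \<rho> * kern v i (Y i)" using k\<rho> \<rho>(1) by (intro mult_left_mono) auto
              then show ?thesis using False True c0 \<rho>(1) unfolding bk_def j_def[symmetric] by (simp add: q_def)
            qed
          next
            case False
            then have "bk i (Y i) = exp (c j) * P j" using ke ij0 unfolding bk_def j_def[symmetric] by simp
            also have "\<dots> \<le> exp (c j) * kern v i (Y i)" using PU False by (intro mult_left_mono) auto
            finally show ?thesis .
          qed
          then show ?thesis using bkb iA unfolding e_def Y_def[symmetric] j_def[symmetric] by simp
        qed
        show "0 \<le> 1 - bk i (card (A \<inter> {..<i})) \<and>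
          1 - bk i (card (A \<inter> {..<i})) \<le> exp (e i) * (1 - kern v i (card (A \<inter> {..<i})))" if iA: "i \<notin> A"
        proof -
          have "1 - bk i (Y i) \<le> exp (d j) * (1 - kern v i (Y i))"
          proof (cases "j = 0")
            case True
            then show ?thesis using c0 kb unfolding bk_def j_def[symmetric] by (simp add: q_def)
          next
            case False
            then have "1 - bk i (Y i) = exp (d j) * U j" using ke ij0 unfolding bk_def j_def[symmetric] by simp
            also have "\<dots> \<le> exp (d j) * (1 - kern v i (Y i))" using PU False by (intro mult_left_mono) auto
            finally show ?thesis .
          qed
          then show ?thesis using bkb iA unfolding e_def Y_def[symmetric] j_def[symmetric] by simp
        qed
      qed
      also have "(\<Sum>i<n. e i) \<le> E"
      proof -
        have "\<bar>(\<Sum>i<n. e i) - n / m * (\<Sum>j<m. q j * c j + (1 - q j) * d j)\<bar> \<le> (2 * n * \<eta> + real i0 + 1 + 1) * C"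
          unfolding e_def C_def by (rule sum_block_values[OF m n(1) k])
        moreover have "n / m * (\<Sum>j<m. q j * c j + (1 - q j) * d j) = n * J"
          unfolding J using m by simp
        moreover have "2 * n * \<eta> + real i0 + 1 + 1 = 2 * n * \<eta> + real i0 + 2" by simp
        ultimately show ?thesis unfolding E_def by (simp only: abs_le_iff) linarith
      qed
      then have "exp (\<Sum>i<n. e i) * path_weight (kern v) n A \<le> exp E * path_weight (kern v) n A"
        using kern_bounds by (intro mult_right_mono path_weight_nonneg) auto
      finally have weight: "path_weight bk n A \<le> exp E * path_weight (kern v) n A" .
      \<comment> \<open>Within a block the path and \<open>\<phi>\<close> move by at most
        \<open>1 / m\<close> each, \<open>\<psi>\<close> exceeds \<open>\<phi>\<close> by at most
        \<open>1 / m\<close>, and the path misses \<open>\<psi>\<close> by at most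
        \<open>1 / (2 * m)\<close> at the block start. The width \<open>5 / m\<close> covers the
        sum.\<close>
      have "\<bar>path_fn n A t - \<phi> t\<bar> \<le> \<delta>" if t: "0 \<le> t" "t \<le> 1" for t
      proof -
        define j where "j = nat \<lfloor>m * t\<rfloor>"
        have "real j \<le> m * t" "m * t \<le> real j + 1" unfolding j_def using t m
          by (auto simp: of_nat_nat)
        then have jt: "real j / m \<le> t" "t \<le> real j / m + 1 / m" using m by (auto simp: field_simps)
        have "real j \<le> m" using \<open>real j \<le> m * t\<close> t m by (smt (verit) mult_left_le of_nat_0_le_iff)
        then have jm: "j \<le> m" by simp
        have m1: "0 \<le> 1 / real m" by simp
        have \<delta>': "1 / m + 1 / m + 1 / m + 1 / m + 1 / m \<le> \<delta>" using \<delta> by simp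
        show ?thesis
        proof (cases "j = 0")
          case True
          then have "t \<le> 1 / m" using jt by simp
          then show ?thesis
            using admissibleD(4,5)[OF \<phi>, of t] admissibleD(4,5)[OF path_fn_admissible[OF n(1)], of t A] t \<delta>' m1
            by linarith
        next
          case False
          have "real (N j) / n - real j / m = (real (N j) - real j * n / m) / n" using n by (simp add: field_simps)
          moreover have "0 \<le> (real (N j) - real j * n / m) / n" "(real (N j) - real j * n / m) / n \<le> 1 / n"
            using Nb[of j] by (auto intro: divide_right_mono)
          ultimately have Nj: "real j / m \<le> real (N j) / n" "real (N j) / n \<le> real j / m + 1 / n" by linarith+
          have "1 / (2 * m) \<le> 1 / real m" using m by (simp add: field_simps)
          have "\<bar>path_fn n A t - path_fn n A (real (N j) / n)\<bar> \<le> \<bar>t - real (N j) / n\<bar>"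
            using t Nn[OF jm] n by (intro admissibleD(6)[OF path_fn_admissible]) auto
          moreover have "path_fn n A (real (N j) / n) = real (Y (N j)) / n"
            using path_fn_grid[OF n(1) Nn[OF jm], of A] unfolding Y_def .
          moreover have "\<bar>\<phi> t - \<phi> (real j / m)\<bar> \<le> \<bar>t - real j / m\<bar>"
            using t jm m by (intro admissibleD(6)[OF \<phi>]) auto
          ultimately show ?thesis
            using YN'[of j] \<psi>b[of j] False jm jt Nj mn \<eta>1 \<delta>' m1 \<open>1 / (2 * m) \<le> 1 / real m\<close> by linarith
        qed
      qed
      then have "A \<in> tube" using AG unfolding tube_def G_def by auto
      then show ?thesis using weight by blast
    qed
    have fin: "finite tube" "finite G" unfolding tube_def G_def by (auto intro: finite_subset[of _ "Pow {..<n}"])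
    have "1 - real (card {..m}) * real n / (n * \<eta>)\<^sup>2 \<le> (\<Sum>A\<in>G. path_weight bk n A)"
      unfolding G_def using bk01 Nn \<eta> n by (intro path_weight_chebyshev) auto
    moreover have "real (card {..m}) * real n / (n * \<eta>)\<^sup>2 \<le> 1 / 2"
    proof -
      have "real (card {..m}) * real n / (n * \<eta>)\<^sup>2 = (real m + 1) / (n * \<eta>\<^sup>2)"
        using n by (simp add: power2_eq_square add.commute)
      also have "\<dots> \<le> 1 / 2" using n\<eta>2 n \<eta> by (simp add: pos_divide_le_eq)
      finally show ?thesis .
    qed
    ultimately have "1 / 2 \<le> (\<Sum>A\<in>G. path_weight bk n A)" by linarith
    also have "\<dots> = (\<Sum>A\<in>{A \<in> G. path_weight bk n A \<noteq> 0}. path_weight bk n A)"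
      using fin by (intro sum.mono_neutral_right) auto
    also have "\<dots> \<le> (\<Sum>A\<in>{A \<in> G. path_weight bk n A \<noteq> 0}. exp E * path_weight (kern v) n A)"
      using good by (intro sum_mono) auto
    also have "\<dots> \<le> (\<Sum>A\<in>tube. exp E * path_weight (kern v) n A)"
      using good fin kern_bounds by (intro sum_mono2) (auto intro!: mult_nonneg_nonneg path_weight_nonneg)
    also have "\<dots> = exp E * (\<Sum>A\<in>tube. path_weight (kern v) n A)" by (simp add: sum_distrib_left)
    finally have half: "1 / 2 \<le> exp E * (\<Sum>A\<in>tube. path_weight (kern v) n A)" .
    have "n * (2 * \<eta> * C) \<le> n * ((b - J) / 2)" using \<eta>C by (intro mult_left_mono) auto
    then have "E + ln 2 \<le> n * b" unfolding E_def using nC by (simp add: algebra_simps)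
    then have "exp (- (real n * b)) \<le> exp (- E - ln 2)" by simp
    also have "\<dots> = exp (- E) * (1 / 2)" by (simp add: exp_diff)
    also have "\<dots> \<le> exp (- E) * (exp E * (\<Sum>A\<in>tube. path_weight (kern v) n A))"
      using half by (intro mult_left_mono) auto
    also have "\<dots> = (\<Sum>A\<in>tube. path_weight (kern v) n A)" by (simp add: mult.assoc[symmetric] exp_add[symmetric])
    finally show ?case unfolding tube_def .
  qed
qed

section \<open>The rate function as a limit of Riemann sums\<close>

text \<open>The relative entropy of a Bernoulli law with success probability \<open>q\<close> with
  respect to one with success probability \<open>1 - u\<close>; \<open>u\<close> is the probability
  of a flat step.\<close>

definition rel_ent :: "real \<Rightarrow> real \<Rightarrow> real" where
  "rel_ent q u = q * ln (q / (1 - u)) + (1 - q) * ln ((1 - q) / u)"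

text \<open>From \<open>ln z \<le> z - 1\<close> at \<open>z = y / x\<close>. Added over two
  complementary probabilities it is Gibbs' inequality.\<close>

lemma mult_ln_ge: "0 \<le> x \<Longrightarrow> 0 < y \<Longrightarrow> x - y \<le> x * ln (x / y)" for x y :: real
proof (cases "x = 0")
  case False
  assume xy: "0 \<le> x" "0 < y"
  then have "ln (y / x) \<le> y / x - 1" using False by (intro ln_le_minus_one) auto
  then have "x * ln (y / x) \<le> x * (y / x - 1)" using xy by (intro mult_left_mono) auto
  moreover have "ln (x / y) = - ln (y / x)" using xy False by (simp add: ln_div)
  moreover have "x * (y / x - 1) = y - x" using False by (simp add: field_simps)
  ultimately show ?thesis by simp
qed auto

lemma rel_ent_nonneg:
  assumes "0 \<le> q" "q \<le> 1" "0 < u" "u < 1"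
  shows "0 \<le> rel_ent q u"
  using mult_ln_ge[of q "1 - u"] mult_ln_ge[of "1 - q" u] assms unfolding rel_ent_def by simp

text \<open>Scale the reference weights by \<open>k = (a + b) / (x + y)\<close> before applying
  \<open>mult_ln_ge\<close>: the total masses then agree and the linear terms cancel.\<close>

lemma log_sum_inequality:
  fixes a b x y :: real
  assumes "0 \<le> a" "0 < b" "0 < x" "0 < y"
  shows "(a + b) * ln ((a + b) / (x + y)) \<le> a * ln (a / x) + b * ln (b / y)"
proof -
  define k where "k = (a + b) / (x + y)"
  have k: "0 < k" unfolding k_def using assms by simp
  have "a - k * x \<le> a * ln (a / (k * x))" "b - k * y \<le> b * ln (b / (k * y))"
    using assms k by (intro mult_ln_ge; simp)+
  moreover have "a * ln (a / (k * x)) = a * ln (a / x) - a * ln k"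
    using assms k by (cases "a = 0") (auto simp: ln_div ln_mult algebra_simps)
  moreover have "b * ln (b / (k * y)) = b * ln (b / y) - b * ln k"
    using assms k by (auto simp: ln_div ln_mult algebra_simps)
  moreover have "k * (x + y) = a + b" unfolding k_def using assms by simp
  ultimately have "0 \<le> a * ln (a / x) + b * ln (b / y) - (a + b) * ln k" by (simp add: algebra_simps)
  then show ?thesis unfolding k_def by simp
qed

text \<open>Joint convexity, from the log-sum inequality for up-steps and for flat steps. The point
  mixed in, slope \<open>c\<close> with flat-step probability \<open>1 - c\<close>, has relative
  entropy 0.\<close>

lemma rel_ent_mix_le:
  assumes q: "0 \<le> q" "q \<le> 1" and u: "0 < u" "u < 1" and e: "0 < e" "e < 1" and c: "0 < c" "c < 1"
  shows "rel_ent ((1 - e) * q + e * c) ((1 - e) * u + e * (1 - c)) \<le> rel_ent q u"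
proof -
  have *: "((1 - e) * a + e * b) * ln (((1 - e) * a + e * b) / ((1 - e) * x + e * b)) \<le> (1 - e) * (a * ln (a / x))"
    if "0 \<le> a" "0 < b" "0 < x" for a b x :: real
    using log_sum_inequality[of "(1 - e) * a" "e * b" "(1 - e) * x" "e * b"] that e by simp
  have "((1 - e) * q + e * c) * ln (((1 - e) * q + e * c) / ((1 - e) * (1 - u) + e * c)) \<le> (1 - e) * (q * ln (q / (1 - u)))"
    using q u c by (intro *) auto
  moreover have "((1 - e) * (1 - q) + e * (1 - c)) * ln (((1 - e) * (1 - q) + e * (1 - c)) / ((1 - e) * u + e * (1 - c)))
      \<le> (1 - e) * ((1 - q) * ln ((1 - q) / u))"
    using q u c by (intro *) auto
  moreover have "1 - ((1 - e) * q + e * c) = (1 - e) * (1 - q) + e * (1 - c)"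
    "1 - ((1 - e) * u + e * (1 - c)) = (1 - e) * (1 - u) + e * c" by (simp_all add: algebra_simps)
  ultimately have "rel_ent ((1 - e) * q + e * c) ((1 - e) * u + e * (1 - c)) \<le> (1 - e) * rel_ent q u"
    unfolding rel_ent_def by (simp add: distrib_left)
  also have "\<dots> \<le> rel_ent q u"
    using rel_ent_nonneg[OF q u] e by (simp add: mult_left_le_one_le)
  finally show ?thesis .
qed

text \<open>Continuity of \<open>x * ln x\<close> up to 0, where the product is 0 in HOL as well.
  Near 0 it is dominated by \<open>2 * sqrt x\<close>, which is \<open>mult_ln_ge\<close> at
  \<open>sqrt x\<close>.\<close>

lemma tendsto_mult_ln:
  fixes x :: "nat \<Rightarrow> real"
  assumes x: "x \<longlonglongrightarrow> l" "\<And>n. 0 \<le> x n"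
  shows "(\<lambda>n. x n * ln (x n)) \<longlonglongrightarrow> l * ln l"
proof (cases "l = 0")
  case False
  moreover have "0 \<le> l" using x by (metis LIMSEQ_le_const)
  ultimately show ?thesis using x(1) by (auto intro!: tendsto_intros)
next
  case True
  have "\<forall>\<^sub>F n in sequentially. x n < 1" using x(1) True by (intro order_tendstoD(2)) auto
  then have "\<forall>\<^sub>F n in sequentially. norm (x n * ln (x n)) \<le> 2 * sqrt (x n)"
  proof eventually_elim
    case (elim n)
    show ?case
    proof (cases "x n = 0")
      case False
      then have p: "0 < x n" "0 < sqrt (x n)" using x(2)[of n] by auto
      have "sqrt (x n) - 1 \<le> sqrt (x n) * ln (sqrt (x n))" using mult_ln_ge[of "sqrt (x n)" 1] p by simp
      then have "- 1 \<le> sqrt (x n) * ln (sqrt (x n))" using p by linarith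
      then have "2 * sqrt (x n) * (- 1) \<le> 2 * sqrt (x n) * (sqrt (x n) * ln (sqrt (x n)))"
        using p by (intro mult_left_mono) auto
      also have "\<dots> = x n * (2 * ln (sqrt (x n)))" using p by (simp add: real_sqrt_mult_self mult.assoc[symmetric] power2_eq_square[symmetric])
      also have "2 * ln (sqrt (x n)) = ln (x n)" using p by (simp add: ln_sqrt)
      finally have "- (2 * sqrt (x n)) \<le> x n * ln (x n)" by simp
      moreover have "x n * ln (x n) \<le> 0" using p elim by (simp add: mult_le_0_iff)
      ultimately show ?thesis by simp
    qed auto
  qed
  moreover have "(\<lambda>n. 2 * sqrt (x n)) \<longlonglongrightarrow> 2 * sqrt 0" using x(1) True by (intro tendsto_intros) auto
  ultimately show ?thesis using True by (auto intro: Lim_null_comparison)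
qed

text \<open>Since \<alpha> > 1 and \<open>\<phi> t \<le> t\<close>, the denominator
  \<open>\<alpha> * t - \<phi> t\<close> is positive and the up-step term is finite. Only the
  flat-step term can be infinite, namely at a zero of \<open>\<phi>\<close>.\<close>

lemma rate_integrand_eq:
  assumes \<alpha>: "1 < \<alpha>" and t: "0 < t" "t < 1" and \<phi>: "0 \<le> \<phi> t" "\<phi> t \<le> t" and D: "0 \<le> deriv \<phi> t" "deriv \<phi> t \<le> 1"
  shows "0 < \<phi> t \<Longrightarrow> rate_integrand \<alpha> \<phi> t = ereal (rel_ent (deriv \<phi> t) (1 / \<alpha> * \<phi> t / t))"
    and "\<phi> t = 0 \<Longrightarrow> deriv \<phi> t \<noteq> 1 \<Longrightarrow> rate_integrand \<alpha> \<phi> t = \<infinity>"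
proof -
  define D where "D = deriv \<phi> t"
  have "t < \<alpha> * t" using \<alpha> t by simp
  then have p: "0 < \<alpha> * t - \<phi> t" using \<phi> by linarith
  then have 1: "xlog_quot D (\<alpha> * t * D) (\<alpha> * t - \<phi> t) = ereal (D * ln (D / (1 - 1 / \<alpha> * \<phi> t / t)))"
  proof -
    have "\<alpha> * t * D / (\<alpha> * t - \<phi> t) = D / (1 - 1 / \<alpha> * \<phi> t / t)" using p \<alpha> t by (simp add: field_simps)
    then show ?thesis using p unfolding xlog_quot_def by auto
  qed
  show "rate_integrand \<alpha> \<phi> t = ereal (rel_ent (deriv \<phi> t) (1 / \<alpha> * \<phi> t / t))" if "0 < \<phi> t"
  proof -
    have "\<alpha> * t * (1 - D) / \<phi> t = (1 - D) / (1 / \<alpha> * \<phi> t / t)" using that \<alpha> t by (simp add: field_simps)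
    then have "xlog_quot (1 - D) (\<alpha> * t * (1 - D)) (\<phi> t) = ereal ((1 - D) * ln ((1 - D) / (1 / \<alpha> * \<phi> t / t)))"
      unfolding xlog_quot_def by (simp only:) (use that in auto)
    then show ?thesis using 1 unfolding rate_integrand_def rel_ent_def D_def by simp
  qed
  show "rate_integrand \<alpha> \<phi> t = \<infinity>" if "\<phi> t = 0" "deriv \<phi> t \<noteq> 1"
    using 1 that unfolding rate_integrand_def D_def by (simp add: xlog_quot_def)
qed

lemma admissible_differentiable_ae:
  assumes \<phi>: "admissible \<phi>"
  obtains N where "negligible N"
    "\<And>t. t \<in> {0..1} - N \<Longrightarrow> 0 < t \<and> t < 1 \<and> \<phi> differentiable (at t) \<and> 0 \<le> deriv \<phi> t \<and> deriv \<phi> t \<le> 1"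
proof -
  \<comment> \<open>Clamping the argument extends \<open>\<phi>\<close> from the unit interval to
    the whole line. The endpoints join the exceptional set because differentiability is two-sided
    and \<open>\<phi>\<close> is arbitrary outside.\<close>
  define F where "F x = \<phi> (min 1 (max 0 x))" for x
  obtain N where N: "negligible N" "\<And>x. x \<notin> N \<Longrightarrow> F differentiable (at x)"
  proof (rule mono_lipschitz_differentiable_ae[of F])
    fix x y :: real assume "x \<le> y"
    then have "min 1 (max 0 x) \<le> min 1 (max 0 y)" "min 1 (max 0 y) - min 1 (max 0 x) \<le> y - x"
      "0 \<le> min 1 (max 0 x)" "min 1 (max 0 y) \<le> 1" by auto
    then show "F x \<le> F y" "F y - F x \<le> y - x"
      unfolding F_def using admissibleD(2,3)[OF \<phi>, of "min 1 (max 0 x)" "min 1 (max 0 y)"] by linarith+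
  qed metis
  show ?thesis
  proof (rule that[of "N \<union> {0, 1}"])
    show "negligible (N \<union> {0, 1})" using N by simp
    fix t assume "t \<in> {0..1} - (N \<union> {0, 1})"
    then have t: "0 < t" "t < 1" "t \<notin> N" by auto
    have ev: "\<forall>\<^sub>F x in nhds t. F x = \<phi> x"
      using eventually_nhds_in_open[of "{0<..<1}" t] t by (auto elim!: eventually_mono simp: F_def)
    obtain D where "(F has_real_derivative D) (at t)" using N(2)[OF t(3)] by (auto simp: real_differentiable_def)
    then have D: "(\<phi> has_real_derivative D) (at t)"
      using DERIV_cong_ev[OF refl ev refl] by blast
    have dD: "deriv \<phi> t = D" using D by (rule DERIV_imp_deriv)
    have lim: "((\<lambda>h. (\<phi> (t + h) - \<phi> t) / h) \<longlongrightarrow> D) (at_right 0)"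
      using D unfolding DERIV_def by (rule filterlim_mono) (auto simp: at_le)
    have evh: "\<forall>\<^sub>F h in at_right 0. 0 < h \<and> h < 1 - t"
      using t by (auto simp: eventually_at_right_field intro: exI[of _ "1 - t"])
    have "0 \<le> D"
      by (rule tendsto_lowerbound[OF lim]) (use evh t in \<open>auto elim!: eventually_mono intro!: divide_nonneg_nonneg simp: admissibleD(2)[OF \<phi>]\<close>)
    moreover have "D \<le> 1"
    proof (rule tendsto_upperbound[OF lim])
      show "\<forall>\<^sub>F h in at_right 0. (\<phi> (t + h) - \<phi> t) / h \<le> 1"
        using evh
      proof eventually_elim
        case (elim h)
        then have "\<phi> (t + h) - \<phi> t \<le> h" using admissibleD(3)[OF \<phi>, of t "t + h"] t by simp
        then show ?case using elim by simp
      qed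
    qed simp
    ultimately show "0 < t \<and> t < 1 \<and> \<phi> differentiable (at t) \<and> 0 \<le> deriv \<phi> t \<and> deriv \<phi> t \<le> 1"
      using t D dD real_differentiable_def by blast
  qed
qed

section \<open>The block containing a fixed time, difference quotients and step functions\<close>

abbreviation block_at :: "nat \<Rightarrow> real \<Rightarrow> nat" where
  "block_at m t \<equiv> nat \<lfloor>real m * t\<rfloor>"

lemma block_at_bounds:
  assumes "0 < m" "0 \<le> t"
  shows "real (block_at m t) / m \<le> t" "t < real (block_at m t) / m + 1 / m" "t < real (Suc (block_at m t)) / m"
proof -
  have *: "real (block_at m t) \<le> m * t" "m * t < real (block_at m t) + 1" using assms by auto
  show "real (block_at m t) / m \<le> t" using * assms by (simp add: field_simps)
  show "t < real (block_at m t) / m + 1 / m" "t < real (Suc (block_at m t)) / m" using * assms by (simp_all add: field_simps)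
qed

lemma block_at_less: "0 < m \<Longrightarrow> 0 \<le> t \<Longrightarrow> t < 1 \<Longrightarrow> block_at m t < m"
proof -
  assume a: "0 < m" "0 \<le> t" "t < 1"
  have "real (block_at m t) / m < 1" using block_at_bounds(1)[OF a(1,2)] a by linarith
  then show ?thesis using a by simp
qed

lemma tendsto_block_at_div:
  assumes "0 \<le> t"
  shows "(\<lambda>m. real (block_at m t) / real m) \<longlonglongrightarrow> t"
proof -
  have "\<forall>\<^sub>F m in sequentially. norm (real (block_at m t) / real m - t) \<le> 1 / real m"
    using eventually_gt_at_top[of 0]
  proof eventually_elim
    case (elim m)
    then show ?case using block_at_bounds[OF elim assms] by simp
  qed
  then have "(\<lambda>m. real (block_at m t) / real m - t) \<longlonglongrightarrow> 0"
    using lim_1_over_n by (rule Lim_null_comparison)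
  then show ?thesis by (simp add: LIM_zero_iff)
qed

lemma tendsto_inverse_block_at:
  assumes "0 < t"
  shows "(\<lambda>m. K / real (block_at m t)) \<longlonglongrightarrow> 0"
proof -
  have "(\<lambda>m. (K / real m) / (real (block_at m t) / real m)) \<longlonglongrightarrow> 0 / t"
    using assms by (intro tendsto_divide tendsto_block_at_div lim_const_over_n) auto
  moreover have "\<forall>\<^sub>F m in sequentially. (K / real m) / (real (block_at m t) / real m) = K / real (block_at m t)"
    using eventually_gt_at_top[of 0] by eventually_elim auto
  ultimately have "(\<lambda>m. K / real (block_at m t)) \<longlonglongrightarrow> 0 / t" by (rule Lim_transform_eventually)
  then show ?thesis by simp
qed

lemma eventually_block_at_pos:
  assumes "0 < t"
  shows "\<forall>\<^sub>F m in sequentially. 0 < block_at m t"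
proof -
  have "\<forall>\<^sub>F m in sequentially. 0 < real (block_at m t) / real m"
    using tendsto_block_at_div[of t] assms by (intro order_tendstoD(1)) auto
  then show ?thesis by eventually_elim (auto simp: zero_less_divide_iff)
qed

text \<open>Both ends of the difference quotient move, but \<open>t\<close> lies between them. The
  errors \<open>e * (t - a)\<close> and \<open>e * (b - t)\<close> add up to
  \<open>e * (b - a)\<close>, so nothing is lost on dividing by the length.\<close>

lemma tendsto_chord:
  assumes t: "0 < t" and D: "(\<phi> has_real_derivative D) (at t)"
  shows "(\<lambda>m. chord \<phi> m (block_at m t)) \<longlonglongrightarrow> D"
proof (rule LIMSEQ_I)
  fix r :: real assume "0 < r"
  define e where "e = r / 2"
  have e: "0 < e" "e < r" unfolding e_def using \<open>0 < r\<close> by auto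
  obtain d where d: "d > 0" "\<And>y. \<bar>y - t\<bar> < d \<Longrightarrow> \<bar>\<phi> y - \<phi> t - D * (y - t)\<bar> \<le> e * \<bar>y - t\<bar>"
    using D e(1) unfolding has_field_derivative_def has_derivative_at_alt by auto
  obtain m0 where m0: "1 / real (Suc m0) < d" using d(1) nat_approx_posE by blast
  show "\<exists>no. \<forall>m\<ge>no. norm (chord \<phi> m (block_at m t) - D) < r"
  proof (intro exI[of _ "Suc m0"] allI impI)
    fix m assume m: "Suc m0 \<le> m"
    then have m0': "0 < m" by simp
    have "1 / real m \<le> 1 / real (Suc m0)" using m by (simp add: frac_le)
    then have md: "1 / real m < d" using m0 by linarith
    define a where "a = real (block_at m t) / m"
    define b where "b = real (Suc (block_at m t)) / m"
    have ab: "a \<le> t" "t < b" "b = a + 1 / m"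
      using block_at_bounds[OF m0', of t] t unfolding a_def b_def by (auto simp: add_divide_distrib)
    have "\<bar>\<phi> a - \<phi> t - D * (a - t)\<bar> \<le> e * (t - a)" "\<bar>\<phi> b - \<phi> t - D * (b - t)\<bar> \<le> e * (b - t)"
    proof -
      have eqs: "\<bar>a - t\<bar> = t - a" "\<bar>b - t\<bar> = b - t" using ab by auto
      show "\<bar>\<phi> a - \<phi> t - D * (a - t)\<bar> \<le> e * (t - a)" using d(2)[of a, unfolded eqs] ab md by linarith
      show "\<bar>\<phi> b - \<phi> t - D * (b - t)\<bar> \<le> e * (b - t)" using d(2)[of b, unfolded eqs] ab md by linarith
    qed
    moreover have "\<phi> b - \<phi> a - D * (b - a) = (\<phi> b - \<phi> t - D * (b - t)) - (\<phi> a - \<phi> t - D * (a - t))"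
      by (simp add: algebra_simps)
    moreover have "e * (t - a) + e * (b - t) = e * (1 / m)" unfolding ab(3) by (simp add: algebra_simps)
    ultimately have "\<bar>\<phi> b - \<phi> a - D * (b - a)\<bar> \<le> e * (1 / m)" by linarith
    then have "real m * \<bar>\<phi> b - \<phi> a - D * (b - a)\<bar> \<le> real m * (e * (1 / m))" by (intro mult_left_mono) auto
    also have "real m * (e * (1 / m)) = e" using m0' by simp
    also have "real m * \<bar>\<phi> b - \<phi> a - D * (b - a)\<bar> = \<bar>real m * (\<phi> b - \<phi> a - D * (b - a))\<bar>" by (simp add: abs_mult)
    also have "real m * (\<phi> b - \<phi> a - D * (b - a)) = chord \<phi> m (block_at m t) - D"
      unfolding chord_def a_def[symmetric] b_def[symmetric] ab(3) using m0' by (simp add: algebra_simps)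
    finally show "norm (chord \<phi> m (block_at m t) - D) < r" using e by simp
  qed
qed

text \<open>Makes a Riemann mean the integral of a step function, the form in which the convergence
  theorems apply. Right endpoints are exceptional because the floor jumps there.\<close>

lemma has_integral_block_step:
  fixes F :: "nat \<Rightarrow> real"
  assumes m: "0 < m"
  shows "((\<lambda>t. F (block_at m t)) has_integral (\<Sum>j<m. F j) / m) {0..1}"
proof -
  have "k \<le> m \<Longrightarrow> ((\<lambda>t. F (block_at m t)) has_integral (\<Sum>j<k. F j) / m) {0..real k / m}" for k
  proof (induction k)
    case (Suc k)
    have le: "0 \<le> real k / m" "real k / m \<le> real (Suc k) / m" using m by (auto simp: field_simps)
    have "((\<lambda>t. F k) has_integral (real (Suc k) / m - real k / m) *\<^sub>R F k) {real k / m..real (Suc k) / m}"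
      using has_integral_const_real[of "F k" "real k / m" "real (Suc k) / m"]
      by (simp only: content_real[OF le(2)])
    then have "((\<lambda>t. F (block_at m t)) has_integral (real (Suc k) / m - real k / m) *\<^sub>R F k) {real k / m..real (Suc k) / m}"
    proof (rule has_integral_spike_finite[of "{real (Suc k) / m}", rotated 2])
      fix t assume "t \<in> {real k / m..real (Suc k) / m} - {real (Suc k) / m}"
      then have "real k / m \<le> t" "t < real (Suc k) / m" by auto
      then have "real k \<le> m * t" "m * t < real k + 1" using m by (auto simp: field_simps)
      then have "\<lfloor>m * t\<rfloor> = int k" by (intro floor_unique) auto
      then show "F (block_at m t) = F k" by simp
    qed simp
    moreover have "(real (Suc k) / m - real k / m) *\<^sub>R F k = F k / m" by (simp add: add_divide_distrib)
    ultimately have "((\<lambda>t. F (block_at m t)) has_integral (\<Sum>j<k. F j) / m + F k / m) {0..real (Suc k) / m}"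
      using Suc le by (intro has_integral_combine[OF le]) auto
    then show ?case by (simp add: add_divide_distrib)
  qed (use has_integral_refl(2)[of "\<lambda>t. F (block_at m t)" "0::real"] in simp)
  from this[of m] show ?thesis using m by simp
qed

text \<open>Measurability of \<open>g\<close> is part of the conclusion: it comes from the
  completeness of Lebesgue measure.\<close>

lemma lebesgue_on_spike:
  fixes f g :: "real \<Rightarrow> real"
  assumes S: "S \<in> sets lebesgue" and f: "integrable (lebesgue_on S) f" and N: "negligible N"
    and eq: "\<And>x. x \<in> S - N \<Longrightarrow> g x = f x"
  shows "integrable (lebesgue_on S) g" "integral\<^sup>L (lebesgue_on S) g = integral\<^sup>L (lebesgue_on S) f"
proof -
  have "f absolutely_integrable_on S" using f S by (simp add: integrable_restrict_space set_integrable_def)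
  then have "g absolutely_integrable_on S" using absolutely_integrable_spike[OF _ N] eq by metis
  then show g: "integrable (lebesgue_on S) g" using S by (simp add: integrable_restrict_space set_integrable_def)
  show "integral\<^sup>L (lebesgue_on S) g = integral\<^sup>L (lebesgue_on S) f"
    using lebesgue_integral_eq_integral[OF f S] lebesgue_integral_eq_integral[OF g S] integral_spike[OF N, of S g f] eq by metis
qed

lemma AE_lebesgue_on_iff_negligible:
  assumes "S \<in> sets lebesgue"
  shows "(AE x in lebesgue_on S. P x) \<longleftrightarrow> (\<exists>N. negligible N \<and> (\<forall>x\<in>S - N. P x))"
proof -
  have "(AE x in lebesgue_on S. P x) \<longleftrightarrow> (AE x in lebesgue. x \<in> S \<longrightarrow> P x)"
    using assms by (subst AE_restrict_space_iff) auto
  also have "\<dots> \<longleftrightarrow> (\<exists>N. negligible N \<and> (\<forall>x\<in>S - N. P x))"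
  proof
    assume "AE x in lebesgue. x \<in> S \<longrightarrow> P x"
    then obtain N where "N \<in> null_sets lebesgue" "{x \<in> space lebesgue. \<not> (x \<in> S \<longrightarrow> P x)} \<subseteq> N"
      unfolding eventually_ae_filter by blast
    then show "\<exists>N. negligible N \<and> (\<forall>x\<in>S - N. P x)"
      by (auto simp: negligible_iff_null_sets)
  next
    assume "\<exists>N. negligible N \<and> (\<forall>x\<in>S - N. P x)"
    then show "AE x in lebesgue. x \<in> S \<longrightarrow> P x"
      by (auto simp: negligible_iff_null_sets intro!: AE_I')
  qed
  finally show ?thesis .
qed

text \<open>The condition \<open>0 \<le> deriv \<phi> t \<le> 1\<close> says that
  \<open>\<phi>\<close> and \<open>x - \<phi> x\<close> have nonnegative derivative almost
  everywhere. Both are absolutely continuous, hence nondecreasing.\<close>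

lemma rate_finite_admissible:
  assumes "rate_finite \<alpha> \<phi>"
  shows "admissible \<phi>"
proof -
  have ac: "absolutely_continuous_on {0..1} \<phi>" and z: "\<phi> 0 = 0"
    using assms unfolding rate_finite_def by auto
  obtain N1 where N1: "negligible N1" "\<And>t. t \<in> {0..1} - N1 \<Longrightarrow> \<phi> differentiable (at t)"
  proof -
    have "AE t in lebesgue_on {0..1}. \<phi> differentiable (at t)" using assms unfolding rate_finite_def by blast
    then show ?thesis using that by (auto simp: AE_lebesgue_on_iff_negligible)
  qed
  obtain N2 where N2: "negligible N2" "\<And>t. t \<in> {0..1} - N2 \<Longrightarrow> 0 \<le> deriv \<phi> t \<and> deriv \<phi> t \<le> 1"
  proof -
    have "AE t in lebesgue_on {0..1}. 0 \<le> deriv \<phi> t \<and> deriv \<phi> t \<le> 1" using assms unfolding rate_finite_def by blast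
    then show ?thesis using that by (subst (asm) AE_lebesgue_on_iff_negligible) auto
  qed
  have N: "negligible (N1 \<union> N2)" using N1 N2 by simp
  have der: "(\<phi> has_real_derivative deriv \<phi> x) (at x within S)" if "x \<in> {0..1} - (N1 \<union> N2)" for x S
    using N1(2)[of x] that by (auto simp: DERIV_deriv_iff_real_differentiable intro: has_field_derivative_at_within)
  show ?thesis
    unfolding admissible_def
  proof (intro conjI allI impI z)
    fix s t :: real assume st: "0 \<le> s \<and> s \<le> t \<and> t \<le> 1"
    then have sub: "{s..t} \<subseteq> {0..1}" by auto
    have "\<phi> s \<le> \<phi> t"
      by (rule absolutely_continuous_on_nondecreasing[OF absolutely_continuous_on_subset[OF ac sub] _ N, of "deriv \<phi>"])
        (use st N2(2) der in auto)
    then show "0 \<le> \<phi> t - \<phi> s" by simp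
    have "s - \<phi> s \<le> t - \<phi> t"
      by (rule absolutely_continuous_on_nondecreasing[OF absolutely_continuous_on_subset[OF absolutely_continuous_on_ident_minus[OF ac] sub] _ N,
          of "\<lambda>x. 1 - deriv \<phi> x"])
        (use st N2(2) in \<open>auto intro!: derivative_intros der\<close>)
    then show "\<phi> t - \<phi> s \<le> t - s" by simp
  qed
qed

lemma admissible_tendsto:
  assumes \<phi>: "admissible \<phi>" and x: "x \<longlonglongrightarrow> t" "\<And>n. 0 \<le> x n \<and> x n \<le> 1" and t: "0 \<le> t" "t \<le> 1"
  shows "(\<lambda>n. \<phi> (x n)) \<longlonglongrightarrow> \<phi> t"
proof -
  have "(\<lambda>n. x n - t) \<longlonglongrightarrow> 0" using x(1) by (simp add: LIM_zero_iff)
  then have "(\<lambda>n. \<phi> (x n) - \<phi> t) \<longlonglongrightarrow> 0"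
    by (rule Lim_null_comparison[rotated, OF tendsto_norm_zero])
      (use admissibleD(6)[OF \<phi>] x(2) t in auto)
  then show ?thesis by (simp add: LIM_zero_iff)
qed

text \<open>An interior zero of a nonnegative function is a minimum. In particular the slope there
  is not 1, which makes \<open>rate_integrand\<close> infinite at such a point.\<close>

lemma admissible_deriv_zero:
  assumes \<phi>: "admissible \<phi>" and t: "0 < t" "t < 1" "\<phi> t = 0"
    and D: "\<phi> differentiable (at t)" "0 \<le> deriv \<phi> t"
  shows "deriv \<phi> t = 0"
proof (rule ccontr)
  assume "deriv \<phi> t \<noteq> 0"
  then have "0 < deriv \<phi> t" "DERIV \<phi> t :> deriv \<phi> t"
    using D by (auto simp: DERIV_deriv_iff_real_differentiable)
  then obtain d where d: "0 < d" "\<And>h. 0 < h \<Longrightarrow> h < d \<Longrightarrow> \<phi> (t - h) < \<phi> t"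
    using DERIV_pos_inc_left by blast
  define h where "h = min (d / 2) t"
  have "0 < h" "h < d" "h \<le> t" unfolding h_def using d t by auto
  then show False using d(2)[of h] admissibleD(4)[OF \<phi>, of "t - h"] t by auto
qed

text \<open>The quotients are split into differences of logarithms and \<open>r\<close> is replaced
  by \<open>q\<close> at the price of \<open>ln (1 + 2 / m)\<close>. The products
  \<open>q * ln q\<close> are continuous up to slopes 0 and 1, so this bound has a limit at almost
  every time.\<close>

definition upper_rate_minorant :: "real \<Rightarrow> (real \<Rightarrow> real) \<Rightarrow> nat \<Rightarrow> nat \<Rightarrow> real" where
  "upper_rate_minorant \<beta> \<phi> m j =
     (let q = chord \<phi> m j; u = \<beta> * \<phi> (real j / real m) / (real j / real m)
      in q * ln q + (1 - q) * ln (1 - q) - ln (1 + 2 / real m)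
         - q * ln (1 - u + 4 / real j) - (1 - q) * ln (u + 4 / real j))"

lemma admissible_ratio_bounds:
  assumes \<phi>: "admissible \<phi>" and j: "0 < j" "j \<le> m" and \<beta>: "0 < \<beta>" "\<beta> < 1"
  shows "0 \<le> \<beta> * \<phi> (real j / m) / (real j / m)" "\<beta> * \<phi> (real j / m) / (real j / m) \<le> \<beta>"
proof -
  have m: "0 < m" using j by simp
  have t: "0 < real j / m" "real j / m \<le> 1" using j m by auto
  have b: "0 \<le> \<phi> (real j / m)" "\<phi> (real j / m) \<le> real j / m" using admissibleD(4,5)[OF \<phi>] t by auto
  show "0 \<le> \<beta> * \<phi> (real j / m) / (real j / m)" using b t \<beta> by (intro divide_nonneg_pos mult_nonneg_nonneg) auto
  show "\<beta> * \<phi> (real j / m) / (real j / m) \<le> \<beta>"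
    unfolding pos_divide_le_eq[OF t(1)] using b \<beta> by (intro mult_left_mono) auto
qed

text \<open>The first bound holds because \<open>r\<close> is at least
  \<open>q / (1 + 2 / m)\<close>, and likewise for \<open>1 - r\<close>. The constant is
  \<open>-7 = -1 - 2 - 4\<close>: at least -1 from the entropy terms, at most 2 for
  \<open>ln (1 + 2 / m)\<close>, at most 4 for the averaged logarithms of the perturbed
  probabilities. A uniform lower bound is what Fatou's lemma asks for.\<close>

lemma upper_rate_ge:
  assumes \<phi>: "admissible \<phi>" and j: "0 < j" "j < m" and \<beta>: "0 < \<beta>" "\<beta> < 1"
  shows "upper_rate_minorant \<beta> \<phi> m j \<le> upper_rate \<beta> \<phi> m j" "-7 \<le> upper_rate_minorant \<beta> \<phi> m j"
proof -
  define q where "q = chord \<phi> m j"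
  define u where "u = \<beta> * \<phi> (real j / m) / (real j / m)"
  define r where "r = (q + 1 / m) / (1 + 2 / m)"
  have q: "0 \<le> q" "q \<le> 1" unfolding q_def using chord_bounds[OF \<phi> j(2)] by auto
  have u: "0 \<le> u" "u \<le> 1" unfolding u_def using admissible_ratio_bounds[OF \<phi> j(1) less_imp_le[OF j(2)] \<beta>] \<beta> by auto
  have m: "0 < 1 / real m" "1 / real m \<le> 1" using j by auto
  have m2: "0 < 1 + 2 / real m" by (intro add_pos_nonneg) auto
  have r': "1 - r = (1 - q + 1 / m) / (1 + 2 / m)" unfolding r_def using m2 by (simp add: field_simps)
  have r: "0 < r" unfolding r_def using q(1) m(1) m2 by (intro divide_pos_pos) linarith+
  have r1: "0 < 1 - r" unfolding r' using q(2) m(1) m2 by (intro divide_pos_pos) linarith+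
  have pos: "0 < 1 - u + 4 / j" "0 < u + 4 / j" using u j by (auto intro: add_nonneg_pos)
  have ln_r: "x * ln x - x * ln (1 + 2 / m) \<le> x * ln ((x + 1 / m) / (1 + 2 / m))" if "0 \<le> x" for x
  proof (cases "x = 0")
    case False
    then have x: "0 < x" using that by simp
    have x': "0 < x + 1 / m" using x m(1) by (rule add_pos_pos)
    have "ln x \<le> ln (x + 1 / m)" using x x' m(1) by (subst ln_le_cancel_iff) linarith+
    then have "ln x - ln (1 + 2 / m) \<le> ln ((x + 1 / m) / (1 + 2 / m))" using x' m2 by (simp only: ln_divide_pos)
    then have "x * (ln x - ln (1 + 2 / m)) \<le> x * ln ((x + 1 / m) / (1 + 2 / m))" using x by (intro mult_left_mono) auto
    then show ?thesis by (simp add: algebra_simps)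
  qed simp
  have "upper_rate \<beta> \<phi> m j = q * ln r + (1 - q) * ln (1 - r) - q * ln (1 - u + 4 / j) - (1 - q) * ln (u + 4 / j)"
    using j r r1 pos unfolding upper_rate_def Let_def q_def[symmetric] u_def[symmetric] r_def[symmetric]
    by (simp add: ln_div right_diff_distrib)
  moreover have "upper_rate_minorant \<beta> \<phi> m j =
      (q * ln q - q * ln (1 + 2 / m)) + ((1 - q) * ln (1 - q) - (1 - q) * ln (1 + 2 / m)) - q * ln (1 - u + 4 / j) - (1 - q) * ln (u + 4 / j)"
    unfolding upper_rate_minorant_def Let_def q_def[symmetric] u_def[symmetric] by (simp add: algebra_simps)
  ultimately show "upper_rate_minorant \<beta> \<phi> m j \<le> upper_rate \<beta> \<phi> m j"
    using ln_r[of q] ln_r[of "1 - q"] q unfolding r' unfolding r_def by simp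
  have "-1 \<le> q * ln q + (1 - q) * ln (1 - q)"
    using mult_ln_ge[of q 1] mult_ln_ge[of "1 - q" 1] q by simp
  moreover have "ln (1 + 2 / m) \<le> 2"
  proof -
    have "2 / real m = 2 * (1 / real m)" by simp
    then show ?thesis using ln_le_minus_one[OF m2] m(2) by linarith
  qed
  moreover have "q * ln (1 - u + 4 / j) + (1 - q) * ln (u + 4 / j) \<le> 4"
  proof -
    have "4 / real j \<le> 4" using frac_le[of 4 4 1 "real j"] j by simp
    then have "ln (1 - u + 4 / j) \<le> 4" "ln (u + 4 / j) \<le> 4"
      using ln_le_minus_one[OF pos(1)] ln_le_minus_one[OF pos(2)] u by linarith+
    then have "q * ln (1 - u + 4 / j) + (1 - q) * ln (u + 4 / j) \<le> q * 4 + (1 - q) * 4"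
      using q by (intro add_mono mult_left_mono) auto
    then show ?thesis by simp
  qed
  ultimately show "-7 \<le> upper_rate_minorant \<beta> \<phi> m j"
    unfolding upper_rate_minorant_def Let_def q_def[symmetric] u_def[symmetric] by simp
qed

lemma rel_ent_expand:
  assumes "0 \<le> q" "q \<le> 1" "0 < u" "u < 1"
  shows "rel_ent q u = q * ln q + (1 - q) * ln (1 - q) - q * ln (1 - u) - (1 - q) * ln u"
proof -
  have "q * ln (q / (1 - u)) = q * ln q - q * ln (1 - u)"
    using assms by (cases "q = 0") (auto simp: ln_div right_diff_distrib)
  moreover have "(1 - q) * ln ((1 - q) / u) = (1 - q) * ln (1 - q) - (1 - q) * ln u"
    using assms by (cases "q = 1") (auto simp: ln_div right_diff_distrib)
  ultimately show ?thesis unfolding rel_ent_def by simp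
qed

lemma block_ratio_tendsto:
  assumes \<phi>: "admissible \<phi>" and t: "0 < t" "t < 1"
  shows "(\<lambda>m. \<beta> * \<phi> (real (block_at m t) / m) / (real (block_at m t) / m)) \<longlonglongrightarrow> \<beta> * \<phi> t / t"
proof -
  have b: "0 \<le> real (block_at m t) / real m \<and> real (block_at m t) / real m \<le> 1" for m
  proof (cases "m = 0")
    case False
    then have "real (block_at m t) / real m \<le> t" using t by (intro block_at_bounds(1)) auto
    moreover have "0 \<le> real (block_at m t) / real m" by (rule divide_nonneg_nonneg[OF of_nat_0_le_iff of_nat_0_le_iff])
    ultimately show ?thesis using t by linarith
  qed auto
  have "(\<lambda>m. \<phi> (real (block_at m t) / real m)) \<longlonglongrightarrow> \<phi> t"
    using t b by (intro admissible_tendsto[OF \<phi>] tendsto_block_at_div) auto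
  then show ?thesis using t by (intro tendsto_intros tendsto_block_at_div) auto
qed

lemma chord_block_at_bounds:
  assumes \<phi>: "admissible \<phi>" and t: "0 < t" "t < 1"
  shows "0 \<le> chord \<phi> m (block_at m t)" "chord \<phi> m (block_at m t) \<le> 1"
proof -
  show "0 \<le> chord \<phi> m (block_at m t)" "chord \<phi> m (block_at m t) \<le> 1"
    using chord_bounds[OF \<phi>, of "block_at m t" m] block_at_less[of m t] t
    by (cases "m = 0"; simp add: chord_def)+
qed

text \<open>If \<open>\<phi> t = 0\<close>, then the slope is 0, so the weight \<open>1 - q\<close>
  of the flat-step term tends to 1 while \<open>u + 4 / j\<close> tends to 0 from above. This is how
  paths that stay at 0 for a while acquire infinite rate.\<close>

lemma upper_rate_minorant_tendsto:
  assumes \<phi>: "admissible \<phi>" and t: "0 < t" "t < 1" and \<beta>: "0 < \<beta>" "\<beta> < 1"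
    and D: "\<phi> differentiable (at t)" "0 \<le> deriv \<phi> t" "deriv \<phi> t \<le> 1"
  shows "0 < \<phi> t \<Longrightarrow> (\<lambda>m. upper_rate_minorant \<beta> \<phi> m (block_at m t)) \<longlonglongrightarrow> rel_ent (deriv \<phi> t) (\<beta> * \<phi> t / t)"
    and "\<phi> t = 0 \<Longrightarrow> filterlim (\<lambda>m. upper_rate_minorant \<beta> \<phi> m (block_at m t)) at_top sequentially"
proof -
  define q where "q m = chord \<phi> m (block_at m t)" for m
  define u where "u m = \<beta> * \<phi> (real (block_at m t) / m) / (real (block_at m t) / m)" for m
  define U where "U = \<beta> * \<phi> t / t"
  have q: "q \<longlonglongrightarrow> deriv \<phi> t" unfolding q_def using t D
    by (intro tendsto_chord) (auto simp: DERIV_deriv_iff_real_differentiable)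
  have q01: "0 \<le> q m" "q m \<le> 1" for m unfolding q_def using chord_block_at_bounds[OF \<phi> t] by auto
  have u: "u \<longlonglongrightarrow> U" unfolding u_def U_def by (rule block_ratio_tendsto[OF \<phi> t])
  have "\<phi> t \<le> t" using admissibleD(5)[OF \<phi>, of t] t by simp
  then have "\<beta> * \<phi> t \<le> \<beta> * t" using \<beta> by simp
  then have U1: "U < 1" unfolding U_def using \<beta> t by (simp add: pos_divide_less_eq le_less_trans[of _ "\<beta> * t"])
  have H: "(\<lambda>m. q m * ln (q m) + (1 - q m) * ln (1 - q m) - ln (1 + 2 / real m))
      \<longlonglongrightarrow> deriv \<phi> t * ln (deriv \<phi> t) + (1 - deriv \<phi> t) * ln (1 - deriv \<phi> t) - ln (1 + 0)"
    using q q01 by (intro tendsto_intros tendsto_mult_ln lim_const_over_n) auto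
  have L1: "(\<lambda>m. q m * ln (1 - u m + 4 / block_at m t)) \<longlonglongrightarrow> deriv \<phi> t * ln (1 - U + 0)"
    using q u t U1 by (intro tendsto_intros tendsto_inverse_block_at) auto
  have uj: "(\<lambda>m. u m + 4 / block_at m t) \<longlonglongrightarrow> U + 0"
    using u t by (intro tendsto_intros tendsto_inverse_block_at) auto
  have eq: "(\<lambda>m. upper_rate_minorant \<beta> \<phi> m (block_at m t)) =
     (\<lambda>m. (q m * ln (q m) + (1 - q m) * ln (1 - q m) - ln (1 + 2 / real m)) - q m * ln (1 - u m + 4 / block_at m t)
        - (1 - q m) * ln (u m + 4 / block_at m t))"
    unfolding upper_rate_minorant_def Let_def q_def u_def ..
  {
    assume "0 < \<phi> t"
    then have U0: "0 < U" unfolding U_def using \<beta> t by simp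
    have "(\<lambda>m. (1 - q m) * ln (u m + 4 / block_at m t)) \<longlonglongrightarrow> (1 - deriv \<phi> t) * ln (U + 0)"
      using U0 by (intro tendsto_mult[OF tendsto_diff[OF tendsto_const q] tendsto_ln[OF uj]]) auto
    from tendsto_diff[OF tendsto_diff[OF H L1] this]
    show "(\<lambda>m. upper_rate_minorant \<beta> \<phi> m (block_at m t)) \<longlonglongrightarrow> rel_ent (deriv \<phi> t) (\<beta> * \<phi> t / t)"
      unfolding eq U_def[symmetric] rel_ent_expand[OF D(2,3) U0 U1] by simp
  }
  {
    assume z: "\<phi> t = 0"
    then have U0: "U = 0" unfolding U_def by simp
    have D0: "deriv \<phi> t = 0" by (rule admissible_deriv_zero[OF \<phi> t z D(1,2)])
    have "\<forall>\<^sub>F m in sequentially. 0 < u m + 4 / block_at m t"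
      using eventually_block_at_pos[OF t(1)]
    proof eventually_elim
      case (elim m)
      then have "block_at m t < m" using t by (intro block_at_less) (auto intro!: Nat.gr0I)
      then have "0 \<le> u m" unfolding u_def using elim by (intro admissible_ratio_bounds(1)[OF \<phi> _ _ \<beta>]) auto
      then show ?case using elim by (intro add_nonneg_pos) auto
    qed
    then have "filterlim (\<lambda>m. u m + 4 / block_at m t) (at_right 0) sequentially"
      using uj U0 by (auto simp: filterlim_at eventually_mono)
    then have "filterlim (\<lambda>m. ln (u m + 4 / block_at m t)) at_bot sequentially"
      by (rule filterlim_compose[OF ln_at_0])
    moreover have "(\<lambda>m. 1 - q m) \<longlonglongrightarrow> 1" using q D0 by (auto intro!: tendsto_eq_intros)
    ultimately have "filterlim (\<lambda>m. (1 - q m) * ln (u m + 4 / block_at m t)) at_bot sequentially"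
      using filterlim_tendsto_pos_mult_at_bot by fastforce
    then have "filterlim (\<lambda>m. - ((1 - q m) * ln (u m + 4 / block_at m t))) at_top sequentially"
      by (simp add: filterlim_uminus_at_bot)
    from filterlim_tendsto_add_at_top[OF tendsto_diff[OF H L1] this]
    show "filterlim (\<lambda>m. upper_rate_minorant \<beta> \<phi> m (block_at m t)) at_top sequentially"
      unfolding eq by simp
  }
qed

section \<open>The rate as a lower bound for upper Riemann sums\<close>

lemma borel_measurable_block_at [measurable]: "(\<lambda>t. F m (block_at m t)) \<in> borel_measurable borel"
  for F :: "nat \<Rightarrow> nat \<Rightarrow> real"
proof -
  have "(\<lambda>t. \<lfloor>real m * t\<rfloor>) \<in> borel \<rightarrow>\<^sub>M count_space UNIV" by measurable
  then show ?thesis by (rule measurable_compose) simp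
qed

text \<open>If all Riemann means were at most \<open>a\<close>, Fatou's lemma would make the limit
  of the integrands integrable with integral at most \<open>a\<close>, so \<open>rate_finite\<close>
  would hold with a value at most \<open>a\<close>. Arguing by contradiction treats finite and
  infinite rates at once.\<close>

lemma rate_less_upper_rate:
  assumes \<phi>: "admissible \<phi>" and \<alpha>: "1 < \<alpha>" and a: "ereal a < rate \<alpha> \<phi>"
  shows "\<exists>m>0. a < (\<Sum>j<m. upper_rate (1 / \<alpha>) \<phi> m j) / real m"
proof (rule ccontr)
  define \<beta> where "\<beta> = 1 / \<alpha>"
  assume "\<not> ?thesis"
  then have le: "(\<Sum>j<m. upper_rate \<beta> \<phi> m j) / real m \<le> a" if "0 < m" for m
    using that unfolding \<beta>_def by (meson not_less)
  have \<beta>: "0 < \<beta>" "\<beta> < 1" unfolding \<beta>_def using \<alpha> by auto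
  obtain N1 where N1: "negligible N1"
    "\<And>t. t \<in> {0..1} - N1 \<Longrightarrow> 0 < t \<and> t < 1 \<and> \<phi> differentiable (at t) \<and> 0 \<le> deriv \<phi> t \<and> deriv \<phi> t \<le> 1"
    using admissible_differentiable_ae[OF \<phi>] by metis
  \<comment> \<open>The shift by 7 makes the integrand nonnegative. The point \<open>t = 1\<close>
    is left out since \<open>block_at m 1 = m\<close> is not the index of a block.\<close>
  define f where "f m t = (if t \<in> {0..<1} then upper_rate \<beta> \<phi> m (block_at m t) + 7 else 0)" for m t
  have ge: "upper_rate_minorant \<beta> \<phi> m (block_at m t) \<le> upper_rate \<beta> \<phi> m (block_at m t)"
    if "t \<in> {0..<1}" "0 < block_at m t" for m t
    using that by (intro upper_rate_ge(1)[OF \<phi> _ _ \<beta>] block_at_less) (auto intro!: Nat.gr0I)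
  have f0: "0 \<le> f m t" if "0 < m" for m t
  proof (cases "t \<in> {0..<1}")
    case True
    then have "block_at m t < m" using that by (intro block_at_less) auto
    then have "-7 \<le> upper_rate \<beta> \<phi> m (block_at m t)"
      using upper_rate_ge[OF \<phi> _ _ \<beta>, of "block_at m t" m]
      by (cases "block_at m t = 0") (auto simp: upper_rate_def)
    then show ?thesis unfolding f_def by auto
  qed (auto simp: f_def)
  have fm [measurable]: "f m \<in> borel_measurable borel" for m
    unfolding f_def by measurable
  have nn: "(\<integral>\<^sup>+t. ennreal (f m t) \<partial>lborel) \<le> ennreal (a + 7)" if m: "0 < m" for m
  proof -
    have "((\<lambda>t. upper_rate \<beta> \<phi> m (block_at m t) + 7) has_integral (\<Sum>j<m. upper_rate \<beta> \<phi> m j + 7) / m) {0..1}"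
      by (rule has_integral_block_step[OF m])
    then have "((\<lambda>t. if t \<in> {0..1} then upper_rate \<beta> \<phi> m (block_at m t) + 7 else 0) has_integral (\<Sum>j<m. upper_rate \<beta> \<phi> m j + 7) / m) UNIV"
      by (simp only: has_integral_restrict_UNIV)
    then have "(f m has_integral (\<Sum>j<m. upper_rate \<beta> \<phi> m j + 7) / m) UNIV"
      by (rule has_integral_spike_finite[of "{1}", rotated 2]) (auto simp: f_def)
    then have "(\<integral>\<^sup>+t. ennreal (f m t) \<partial>lborel) = ennreal ((\<Sum>j<m. upper_rate \<beta> \<phi> m j + 7) / m)"
      using f0[OF m] by (intro nn_integral_has_integral_lborel) auto
    also have "(\<Sum>j<m. upper_rate \<beta> \<phi> m j + 7) / m = (\<Sum>j<m. upper_rate \<beta> \<phi> m j) / m + 7"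
      using m by (simp add: sum.distrib add_divide_distrib)
    finally show ?thesis using le[OF m] by (simp add: ennreal_leI)
  qed
  define Lf where "Lf t = liminf (\<lambda>m. ennreal (f m t))" for t
  have Lfm: "Lf \<in> borel_measurable lborel" unfolding Lf_def by measurable
  have "(\<integral>\<^sup>+t. Lf t \<partial>lborel) \<le> liminf (\<lambda>m. \<integral>\<^sup>+t. ennreal (f m t) \<partial>lborel)"
    unfolding Lf_def by (rule nn_integral_liminf) measurable
  also have "\<dots> \<le> ennreal (a + 7)"
    by (rule Liminf_le) (use nn in \<open>auto intro: eventually_mono[OF eventually_gt_at_top[of 0]]\<close>)
  finally have Lfint: "(\<integral>\<^sup>+t. Lf t \<partial>lborel) \<le> ennreal (a + 7)" .
  then have "AE t in lborel. Lf t \<noteq> \<infinity>"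
    using Lfm by (intro nn_integral_noteq_infinite) (auto simp: top_unique)
  then have "AE t in lebesgue. Lf t \<noteq> \<infinity>" by (rule AE_completion)
  then obtain N2 where "N2 \<in> null_sets lebesgue" "{t \<in> space lebesgue. \<not> Lf t \<noteq> \<infinity>} \<subseteq> N2"
    unfolding eventually_ae_filter by blast
  then have N2: "negligible N2" "\<And>t. t \<notin> N2 \<Longrightarrow> Lf t \<noteq> \<infinity>" by (auto simp: negligible_iff_null_sets)
  have N: "negligible (N1 \<union> N2)" using N1 N2 by simp
  \<comment> \<open>As a limit of step functions \<open>h\<close> is Borel measurable, which spares
    an argument for the measurability of \<open>deriv \<phi>\<close>. The maximum with 0 makes it
    nonnegative also on the null set where the limit is not controlled.\<close>
  define h where "h t = max 0 (lim (\<lambda>m. upper_rate_minorant \<beta> \<phi> m (block_at m t)))" for t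
  have hm [measurable]: "h \<in> borel_measurable borel" unfolding h_def by measurable
  have main: "rate_integrand \<alpha> \<phi> t = ereal (h t) \<and> ennreal (h t + 7) \<le> Lf t" if t: "t \<in> {0..1} - (N1 \<union> N2)" for t
  proof -
    have t1: "0 < t" "t < 1" "\<phi> differentiable (at t)" "0 \<le> deriv \<phi> t" "deriv \<phi> t \<le> 1" using N1(2)[of t] t by auto
    have \<phi>t: "0 \<le> \<phi> t" "\<phi> t \<le> t" using admissibleD(4,5)[OF \<phi>, of t] t1 by auto
    have ev: "\<forall>\<^sub>F m in sequentially. ennreal (upper_rate_minorant \<beta> \<phi> m (block_at m t) + 7) \<le> ennreal (f m t)"
      using eventually_block_at_pos[OF t1(1)]
      by eventually_elim (use ge[of t] t1 in \<open>auto simp: f_def intro!: ennreal_leI\<close>)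
    then have liminf_le: "liminf (\<lambda>m. ennreal (upper_rate_minorant \<beta> \<phi> m (block_at m t) + 7)) \<le> Lf t"
      unfolding Lf_def by (rule Liminf_mono)
    have pos: "0 < \<phi> t"
    proof (rule ccontr)
      assume "\<not> 0 < \<phi> t"
      then have "\<phi> t = 0" using \<phi>t by simp
      then have "filterlim (\<lambda>m. upper_rate_minorant \<beta> \<phi> m (block_at m t)) at_top sequentially"
        by (rule upper_rate_minorant_tendsto(2)[OF \<phi> t1(1,2) \<beta> t1(3-5)])
      then have "filterlim (\<lambda>m. 7 + upper_rate_minorant \<beta> \<phi> m (block_at m t)) at_top sequentially"
        by (rule filterlim_tendsto_add_at_top[OF tendsto_const])
      then have "(\<lambda>m. ennreal (7 + upper_rate_minorant \<beta> \<phi> m (block_at m t))) \<longlonglongrightarrow> \<infinity>"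
        by (simp add: ennreal_tendsto_top_eq_at_top)
      then have "liminf (\<lambda>m. ennreal (upper_rate_minorant \<beta> \<phi> m (block_at m t) + 7)) = \<infinity>"
        by (intro lim_imp_Liminf) (auto simp: add.commute)
      then show False using liminf_le N2(2)[of t] t by (simp add: top_unique)
    qed
    have lim: "(\<lambda>m. upper_rate_minorant \<beta> \<phi> m (block_at m t)) \<longlonglongrightarrow> rel_ent (deriv \<phi> t) (\<beta> * \<phi> t / t)"
      by (rule upper_rate_minorant_tendsto(1)[OF \<phi> t1(1,2) \<beta> t1(3-5) pos])
    have "\<beta> * \<phi> t / t \<le> \<beta>" "0 < \<beta> * \<phi> t / t" using \<phi>t \<beta> t1(1) pos by (auto simp: pos_divide_le_eq)
    moreover from this have "\<beta> * \<phi> t / t < 1" using \<beta> by linarith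
    ultimately have nonneg: "0 \<le> rel_ent (deriv \<phi> t) (\<beta> * \<phi> t / t)" using t1 by (intro rel_ent_nonneg)
    have h: "h t = rel_ent (deriv \<phi> t) (\<beta> * \<phi> t / t)" using limI[OF lim] nonneg unfolding h_def by simp
    have "(\<lambda>m. ennreal (upper_rate_minorant \<beta> \<phi> m (block_at m t) + 7)) \<longlonglongrightarrow> ennreal (h t + 7)"
      unfolding h by (intro tendsto_ennrealI tendsto_add lim tendsto_const)
    then have "liminf (\<lambda>m. ennreal (upper_rate_minorant \<beta> \<phi> m (block_at m t) + 7)) = ennreal (h t + 7)"
      by (intro lim_imp_Liminf) auto
    then show ?thesis using liminf_le rate_integrand_eq(1)[OF \<alpha> t1(1,2) \<phi>t t1(4,5) pos] h unfolding \<beta>_def by auto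
  qed
  define h1 where "h1 t = indicator {0..1} t * h t" for t :: real
  have h1m [measurable]: "h1 \<in> borel_measurable borel" unfolding h1_def by measurable
  have h0: "0 \<le> h t" "0 \<le> h1 t" for t unfolding h1_def h_def by auto
  have "(\<integral>\<^sup>+t. ennreal (h1 t) \<partial>lborel) + ennreal 7 = (\<integral>\<^sup>+t. ennreal (h1 t) + ennreal 7 * indicator {0..1} t \<partial>lborel)"
    by (subst nn_integral_add) (auto simp: nn_integral_cmult_indicator)
  also have "\<dots> \<le> (\<integral>\<^sup>+t. Lf t \<partial>lborel)"
  proof (rule nn_integral_mono_AE)
    have "AE t in lebesgue. t \<notin> N1 \<union> N2" using N by (intro AE_not_in) (simp only: negligible_iff_null_sets)
    then have "AE t in lebesgue. ennreal (h1 t) + ennreal 7 * indicator {0..1} t \<le> Lf t"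
    proof eventually_elim
      case (elim t)
      show ?case
      proof (cases "t \<in> {0..1}")
        case True
        then have "ennreal (h t + 7) \<le> Lf t" using main[of t] elim by auto
        then show ?thesis using True h0 unfolding h1_def by (simp add: ennreal_plus)
      qed (simp add: h1_def)
    qed
    then show "AE t in lborel. ennreal (h1 t) + ennreal 7 * indicator {0..1} t \<le> Lf t"
      by (simp add: AE_completion_iff)
  qed
  also note Lfint
  finally have hint: "(\<integral>\<^sup>+t. ennreal (h1 t) \<partial>lborel) + ennreal 7 \<le> ennreal (a + 7)" .
  then have "(\<integral>\<^sup>+t. ennreal (h1 t) \<partial>lborel) < top"
    by (intro le_less_trans[OF order_trans[OF _ hint] ennreal_less_top]) simp
  then obtain x where x: "0 \<le> x" "(\<integral>\<^sup>+t. ennreal (h1 t) \<partial>lborel) = ennreal x"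
    by (metis enn2real_nonneg ennreal_enn2real)
  \<comment> \<open>\<open>a + 7\<close> may be negative, and \<open>ennreal\<close> would truncate
    it to 0; \<open>x + 7 > 0\<close> excludes this case.\<close>
  have "x \<le> a"
  proof -
    have "ennreal (x + 7) \<le> ennreal (a + 7)" using hint x by (simp add: ennreal_plus)
    then show ?thesis using x by (subst (asm) ennreal_le_iff2) auto
  qed
  have "integrable lborel h1 \<and> integral\<^sup>L lborel h1 = x"
    using x h0 by (subst nn_integral_eq_integrable[symmetric]) auto
  then have "integrable lebesgue h1" "integral\<^sup>L lebesgue h1 = x"
    by (simp_all add: integrable_completion integral_completion)
  then have "integrable (lebesgue_on {0..1}) h" "integral\<^sup>L (lebesgue_on {0..1}) h = x"
    unfolding h1_def by (simp_all add: integrable_restrict_space integral_restrict_space)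
  then have int: "integrable (lebesgue_on {0..1}) (\<lambda>t. real_of_ereal (rate_integrand \<alpha> \<phi> t))"
     "integral\<^sup>L (lebesgue_on {0..1}) (\<lambda>t. real_of_ereal (rate_integrand \<alpha> \<phi> t)) = x"
    using lebesgue_on_spike[of "{0..1}" h "N1 \<union> N2" "\<lambda>t. real_of_ereal (rate_integrand \<alpha> \<phi> t)"] N main by auto
  have "rate_finite \<alpha> \<phi>"
    unfolding rate_finite_def
  proof (intro conjI int)
    show "absolutely_continuous_on {0..1} \<phi>"
    proof (rule lipschitz_absolutely_continuous_on)
      fix x y :: real assume "x \<in> {0..1}" "y \<in> {0..1}" "x \<le> y"
      then show "\<bar>\<phi> y - \<phi> x\<bar> \<le> y - x" using admissibleD(6)[OF \<phi>, of x y] by simp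
    qed
    show "\<phi> 0 = 0" by (rule admissibleD(1)[OF \<phi>])
    have AE: "AE t in lebesgue_on {0..1}. P t" if "\<And>t. t \<in> {0..1} - (N1 \<union> N2) \<Longrightarrow> P t" for P
      using N that by (subst AE_lebesgue_on_iff_negligible) (simp, blast)
    show "AE t in lebesgue_on {0..1}. \<phi> differentiable (at t)" by (rule AE) (use N1(2) in blast)
    show "AE t in lebesgue_on {0..1}. 0 \<le> deriv \<phi> t \<and> deriv \<phi> t \<le> 1" by (rule AE) (use N1(2) in blast)
    show "AE t in lebesgue_on {0..1}. \<bar>rate_integrand \<alpha> \<phi> t\<bar> \<noteq> \<infinity>" by (rule AE) (use main in simp)
  qed
  then have "rate \<alpha> \<phi> = ereal x" unfolding rate_def using int by simp
  then show False using a \<open>x \<le> a\<close> by simp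
qed

text \<open>The integrand is a relative entropy wherever \<open>\<phi> t > 0\<close>. At a zero of
  \<open>\<phi>\<close> it is infinite and \<open>real_of_ereal\<close> turns it into 0.\<close>

lemma rate_nonneg:
  assumes \<alpha>: "1 < \<alpha>"
  shows "0 \<le> rate \<alpha> \<phi>"
proof (cases "rate_finite \<alpha> \<phi>")
  case True
  then have \<phi>: "admissible \<phi>" by (rule rate_finite_admissible)
  obtain N where N: "negligible N"
    "\<And>t. t \<in> {0..1} - N \<Longrightarrow> 0 < t \<and> t < 1 \<and> \<phi> differentiable (at t) \<and> 0 \<le> deriv \<phi> t \<and> deriv \<phi> t \<le> 1"
    using admissible_differentiable_ae[OF \<phi>] by metis
  have "AE t in lebesgue_on {0..1}. 0 \<le> real_of_ereal (rate_integrand \<alpha> \<phi> t)"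
  proof (subst AE_lebesgue_on_iff_negligible, simp, intro exI[of _ N] conjI N(1) ballI)
    fix t assume "t \<in> {0..1} - N"
    then have t: "0 < t" "t < 1" "\<phi> differentiable (at t)" "0 \<le> deriv \<phi> t" "deriv \<phi> t \<le> 1" using N(2) by auto
    have \<phi>t: "0 \<le> \<phi> t" "\<phi> t \<le> t" using admissibleD(4,5)[OF \<phi>, of t] t by auto
    show "0 \<le> real_of_ereal (rate_integrand \<alpha> \<phi> t)"
    proof (cases "\<phi> t = 0")
      case True
      then have "deriv \<phi> t = 0" using admissible_deriv_zero[OF \<phi> t(1,2) _ t(3,4)] by simp
      then show ?thesis using rate_integrand_eq(2)[OF \<alpha> t(1,2) \<phi>t t(4,5) True] by simp
    next
      case False
      then have pos: "0 < \<phi> t" using \<phi>t by simp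
      have "1 / \<alpha> * \<phi> t / t \<le> 1 / \<alpha>" "0 < 1 / \<alpha> * \<phi> t / t" "1 / \<alpha> < 1"
        using \<phi>t \<alpha> t pos by (auto simp: divide_le_eq field_simps)
      then have "0 \<le> rel_ent (deriv \<phi> t) (1 / \<alpha> * \<phi> t / t)" using t by (intro rel_ent_nonneg; linarith)
      then show ?thesis using rate_integrand_eq(1)[OF \<alpha> t(1,2) \<phi>t t(4,5) pos] by simp
    qed
  qed
  then show ?thesis unfolding rate_def using True by (simp add: integral_nonneg_AE)
qed (simp add: rate_def)

section \<open>The rate as an upper bound for lower Riemann sums of mixed paths\<close>

lemma abs_mult_ln_div_le:
  fixes x y \<rho> :: real
  assumes "0 < \<rho>" "\<rho> \<le> x" "x \<le> 1" "\<rho> \<le> y" "y \<le> 1"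
  shows "\<bar>x * ln (x / y)\<bar> \<le> ln (1 / \<rho>)"
proof -
  have p: "0 < x" "0 < y" using assms by auto
  have ln: "ln \<rho> \<le> ln x" "ln x \<le> 0" "ln \<rho> \<le> ln y" "ln y \<le> 0" using assms p by auto
  have "ln (x / y) = ln x - ln y" "ln (1 / \<rho>) = - ln \<rho>" using p assms by (simp_all add: ln_div)
  then have "\<bar>ln (x / y)\<bar> \<le> ln (1 / \<rho>)" using ln by linarith
  moreover have "\<bar>x * ln (x / y)\<bar> \<le> 1 * \<bar>ln (x / y)\<bar>"
    unfolding abs_mult using assms p by (intro mult_right_mono) auto
  ultimately show ?thesis by (metis mult_1 order_trans)
qed

text \<open>
  Mixing with the line of slope \<open>c = 1 / (1 + 1 / \<alpha>)\<close>, on which the rate function vanishes, keeps the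
  slopes and the transition probabilities away from \<open>0\<close> and \<open>1\<close>; by joint convexity of the relative
  entropy it does not increase the rate.
\<close>

definition tilt :: "real \<Rightarrow> real \<Rightarrow> (real \<Rightarrow> real) \<Rightarrow> real \<Rightarrow> real" where
  "tilt e c \<phi> = (\<lambda>t. (1 - e) * \<phi> t + e * c * t)"

lemma tilt_admissible:
  assumes \<phi>: "admissible \<phi>" and e: "0 < e" "e < 1" and c: "0 < c" "c < 1"
  shows "admissible (tilt e c \<phi>)"
    and "\<And>t. 0 \<le> t \<Longrightarrow> t \<le> 1 \<Longrightarrow> e * c * t \<le> tilt e c \<phi> t"
    and "\<And>t. 0 \<le> t \<Longrightarrow> t \<le> 1 \<Longrightarrow> \<bar>tilt e c \<phi> t - \<phi> t\<bar> \<le> e"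
    and "\<And>m j. 0 < m \<Longrightarrow> chord (tilt e c \<phi>) m j = (1 - e) * chord \<phi> m j + e * c"
proof -
  show "admissible (tilt e c \<phi>)"
    unfolding admissible_def
  proof (intro conjI allI impI)
    show "tilt e c \<phi> 0 = 0" using admissibleD(1)[OF \<phi>] by (simp add: tilt_def)
    fix s t :: real assume st: "0 \<le> s \<and> s \<le> t \<and> t \<le> 1"
    have eq: "tilt e c \<phi> t - tilt e c \<phi> s = (1 - e) * (\<phi> t - \<phi> s) + e * (c * (t - s))"
      by (simp add: tilt_def algebra_simps)
    have d: "0 \<le> \<phi> t - \<phi> s" "\<phi> t - \<phi> s \<le> t - s" using admissibleD(2,3)[OF \<phi>, of s t] st by auto
    show "0 \<le> tilt e c \<phi> t - tilt e c \<phi> s"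
      unfolding eq using d e c st by (intro add_nonneg_nonneg mult_nonneg_nonneg) auto
    have "c * (t - s) \<le> 1 * (t - s)" using c st by (intro mult_right_mono) auto
    then have "(1 - e) * (\<phi> t - \<phi> s) + e * (c * (t - s)) \<le> (1 - e) * (t - s) + e * (1 * (t - s))"
      using d e by (intro add_mono mult_left_mono) auto
    then show "tilt e c \<phi> t - tilt e c \<phi> s \<le> t - s" unfolding eq by (simp add: algebra_simps)
  qed
  fix t :: real assume t: "0 \<le> t" "t \<le> 1"
  have b: "0 \<le> \<phi> t" "\<phi> t \<le> t" using admissibleD(4,5)[OF \<phi>] t by auto
  show "e * c * t \<le> tilt e c \<phi> t" unfolding tilt_def using b e by simp
  have "tilt e c \<phi> t - \<phi> t = e * (c * t - \<phi> t)" by (simp add: tilt_def algebra_simps)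
  moreover have "\<bar>c * t - \<phi> t\<bar> \<le> 1"
  proof -
    have "0 \<le> c * t" "c * t \<le> 1" using c t mult_mono[of c 1 t 1] by auto
    then show ?thesis using b t by linarith
  qed
  ultimately show "\<bar>tilt e c \<phi> t - \<phi> t\<bar> \<le> e" using e by (simp add: abs_mult mult_left_le)
next
  fix m j :: nat assume "0 < m"
  then show "chord (tilt e c \<phi>) m j = (1 - e) * chord \<phi> m j + e * c"
    unfolding chord_def tilt_def by (simp add: field_simps)
qed

text \<open>The bounds on \<open>\<rho>\<close> put the slopes \<open>q\<close>,
  \<open>1 - q\<close> and the limits \<open>U\<close>, \<open>1 - U\<close> above
  \<open>\<rho>\<close>. So both summands of \<open>lower_rate\<close> are bounded by
  \<open>ln (1 / \<rho>)\<close>, giving the dominating constant \<open>2 * ln (1 / \<rho>)\<close>.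
  Block 0 disappears in the limit, since a fixed \<open>t > 0\<close> eventually leaves it.\<close>

lemma lower_rate_less_rate:
  fixes \<alpha> e \<rho> \<kappa> :: real
  defines "\<beta> \<equiv> 1 / \<alpha>" and "c \<equiv> 1 / (1 + 1 / \<alpha>)"
  assumes \<alpha>: "1 < \<alpha>" and fin: "rate_finite \<alpha> \<phi>" and e: "0 < e" "e < 1"
    and \<rho>: "0 < \<rho>" "\<rho> \<le> e * c" "\<rho> \<le> e * (1 - c)" "\<rho> \<le> 1 - \<beta>" and \<kappa>: "0 < \<kappa>"
  shows "\<forall>\<^sub>F m in sequentially. ereal ((\<Sum>j<m. lower_rate \<beta> \<rho> (tilt e c \<phi>) m j) / m) < rate \<alpha> \<phi> + ereal \<kappa>"
proof -
  have \<beta>: "0 < \<beta>" "\<beta> < 1" unfolding \<beta>_def using \<alpha> by auto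
  have c': "c = 1 / (1 + \<beta>)" unfolding c_def \<beta>_def ..
  have c: "0 < c" "c < 1" unfolding c' using \<beta> by auto
  \<comment> \<open>On the line of slope \<open>c\<close> a flat step has limiting probability
    \<open>\<beta> * c\<close>. The equation says that an up-step then has probability
    \<open>c\<close>: the line is the typical path of the chain.\<close>
  have \<beta>c: "\<beta> * c = 1 - c" unfolding c' using \<beta> by (simp add: field_simps)
  have \<rho>1: "\<rho> \<le> 1" using \<rho>(4) \<beta> by simp
  have \<phi>: "admissible \<phi>" by (rule rate_finite_admissible[OF fin])
  define \<psi> where "\<psi> = tilt e c \<phi>"
  note \<psi> = tilt_admissible[OF \<phi> e c, folded \<psi>_def]
  define g where "g t = real_of_ereal (rate_integrand \<alpha> \<phi> t)" for t
  have intg: "integrable (lebesgue_on {0..1}) g" using fin unfolding rate_finite_def g_def by blast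
  define r where "r = integral\<^sup>L (lebesgue_on {0..1}) g"
  have rate: "rate \<alpha> \<phi> = ereal r" unfolding rate_def r_def g_def using fin by simp
  have gint: "(g has_integral r) {0..1}" unfolding r_def by (rule has_integral_integral_lebesgue_on[OF intg]) simp
  obtain N1 where N1: "negligible N1"
    "\<And>t. t \<in> {0..1} - N1 \<Longrightarrow> 0 < t \<and> t < 1 \<and> \<phi> differentiable (at t) \<and> 0 \<le> deriv \<phi> t \<and> deriv \<phi> t \<le> 1"
    using admissible_differentiable_ae[OF \<phi>] by metis
  have "AE t in lebesgue_on {0..1}. \<bar>rate_integrand \<alpha> \<phi> t\<bar> \<noteq> \<infinity>" using fin unfolding rate_finite_def by blast
  then obtain N2 where N2: "negligible N2" "\<And>t. t \<in> {0..1} - N2 \<Longrightarrow> \<bar>rate_integrand \<alpha> \<phi> t\<bar> \<noteq> \<infinity>"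
    by (subst (asm) AE_lebesgue_on_iff_negligible) auto
  define N where "N = N1 \<union> N2"
  have N: "negligible N" unfolding N_def using N1 N2 by simp
  define G where "G t = (if t \<in> N then 0 else rel_ent (deriv \<psi> t) (\<beta> * \<psi> t / t))" for t
  define f where "f m t = (if t \<in> N then 0 else lower_rate \<beta> \<rho> \<psi> m (block_at m t))" for m t
  have main: "(\<lambda>m. lower_rate \<beta> \<rho> \<psi> m (block_at m t)) \<longlonglongrightarrow> rel_ent (deriv \<psi> t) (\<beta> * \<psi> t / t)
      \<and> rel_ent (deriv \<psi> t) (\<beta> * \<psi> t / t) \<le> g t" if t: "t \<in> {0..1} - N" for t
  proof -
    have t1: "0 < t" "t < 1" "\<phi> differentiable (at t)" "0 \<le> deriv \<phi> t" "deriv \<phi> t \<le> 1"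
      using N1(2)[of t] t unfolding N_def by auto
    have \<phi>t: "0 \<le> \<phi> t" "\<phi> t \<le> t" using admissibleD(4,5)[OF \<phi>, of t] t1 by auto
    have pos: "0 < \<phi> t"
    proof (rule ccontr)
      assume "\<not> 0 < \<phi> t"
      then have z: "\<phi> t = 0" using \<phi>t by simp
      have "deriv \<phi> t = 0" by (rule admissible_deriv_zero[OF \<phi> t1(1,2) z t1(3,4)])
      then show False using rate_integrand_eq(2)[OF \<alpha> t1(1,2) \<phi>t t1(4,5) z] N2(2)[of t] t unfolding N_def by simp
    qed
    have gt: "g t = rel_ent (deriv \<phi> t) (\<beta> * \<phi> t / t)"
      using rate_integrand_eq(1)[OF \<alpha> t1(1,2) \<phi>t t1(4,5) pos] unfolding g_def \<beta>_def by simp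
    have u: "\<beta> * \<phi> t / t \<le> \<beta>" "0 < \<beta> * \<phi> t / t" using \<phi>t \<beta> t1(1) pos by (auto simp: pos_divide_le_eq)
    have d\<psi>: "(\<psi> has_real_derivative (1 - e) * deriv \<phi> t + e * c) (at t)"
      unfolding \<psi>_def tilt_def using t1(3)
      by (auto intro!: derivative_eq_intros simp: DERIV_deriv_iff_real_differentiable[symmetric])
    then have D: "deriv \<psi> t = (1 - e) * deriv \<phi> t + e * c" by (rule DERIV_imp_deriv)
    define U where "U = \<beta> * \<psi> t / t"
    have U: "U = (1 - e) * (\<beta> * \<phi> t / t) + e * (1 - c)"
      unfolding U_def \<beta>c[symmetric] \<psi>_def tilt_def using t1(1) by (simp add: field_simps)
    have le: "rel_ent (deriv \<psi> t) U \<le> g t"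
      unfolding D U gt using u \<beta> by (intro rel_ent_mix_le e c t1) auto
    have D01: "0 < deriv \<psi> t" "deriv \<psi> t < 1"
    proof -
      show "0 < deriv \<psi> t" unfolding D using t1 e c by (intro add_nonneg_pos) auto
      have "(1 - e) * deriv \<phi> t \<le> (1 - e) * 1" "e * c < e * 1" using t1 e c by (auto intro!: mult_left_mono mult_strict_left_mono simp del: mult_1_right)
      from add_le_less_mono[OF this] show "deriv \<psi> t < 1" unfolding D by simp
    qed
    have U01: "\<rho> \<le> U" "\<rho> \<le> 1 - U"
    proof -
      have "0 \<le> (1 - e) * (\<beta> * \<phi> t / t)" using u e by (intro mult_nonneg_nonneg) auto
      then show "\<rho> \<le> U" unfolding U using \<rho>(3) by linarith
      have "\<psi> t \<le> t" using admissibleD(5)[OF \<psi>(1), of t] t1 by simp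
      then have "U \<le> \<beta>" unfolding U_def using \<beta> t1(1) by (auto simp: pos_divide_le_eq)
      then show "\<rho> \<le> 1 - U" using \<rho>(4) by linarith
    qed
    define q where "q m = chord \<psi> m (block_at m t)" for m
    define u where "u m = \<beta> * (\<psi> (real (block_at m t) / m) + 1 / m - \<psi> (1 / m)) / (real (block_at m t) / m)" for m
    have q: "q \<longlonglongrightarrow> deriv \<psi> t" unfolding q_def using tendsto_chord[OF t1(1) d\<psi>] D by simp
    have "\<And>m. 0 \<le> real (block_at m t) / real m \<and> real (block_at m t) / real m \<le> 1"
    proof -
      fix m show "0 \<le> real (block_at m t) / real m \<and> real (block_at m t) / real m \<le> 1"
      proof (cases "m = 0")
        case False
        then have "real (block_at m t) / real m \<le> t" using t1 by (intro block_at_bounds(1)) auto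
        moreover have "0 \<le> real (block_at m t) / real m" by (rule divide_nonneg_nonneg[OF of_nat_0_le_iff of_nat_0_le_iff])
        ultimately show ?thesis using t1 by linarith
      qed auto
    qed
    then have l1: "(\<lambda>m. \<psi> (real (block_at m t) / real m)) \<longlonglongrightarrow> \<psi> t"
      using t1 by (intro admissible_tendsto[OF \<psi>(1)] tendsto_block_at_div) auto
    have "(\<lambda>m. \<psi> (1 / real m)) \<longlonglongrightarrow> \<psi> 0"
      by (intro admissible_tendsto[OF \<psi>(1)] lim_1_over_n) (auto simp: divide_le_eq)
    then have l2: "(\<lambda>m. \<psi> (1 / real m)) \<longlonglongrightarrow> 0" using admissibleD(1)[OF \<psi>(1)] by simp
    have u: "u \<longlonglongrightarrow> \<beta> * (\<psi> t + 0 - 0) / t" unfolding u_def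
      using t1 by (intro tendsto_divide tendsto_mult tendsto_const tendsto_diff tendsto_add l1 l2 lim_1_over_n tendsto_block_at_div) auto
    then have u: "u \<longlonglongrightarrow> U" unfolding U_def by simp
    \<comment> \<open>The truncation at \<open>\<rho>\<close> is inactive in the limit by
      \<open>U01\<close>; it only bounds the logarithms for finite \<open>m\<close>.\<close>
    have P: "(\<lambda>m. max \<rho> (1 - u m - 4 / block_at m t)) \<longlonglongrightarrow> max \<rho> (1 - U - 0)"
      using t1 u by (intro tendsto_max tendsto_const tendsto_diff tendsto_inverse_block_at) auto
    have Q: "(\<lambda>m. max \<rho> (u m - 4 / block_at m t)) \<longlonglongrightarrow> max \<rho> (U - 0)"
      using t1 u by (intro tendsto_max tendsto_const tendsto_diff tendsto_inverse_block_at) auto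
    have "(\<lambda>m. q m * ln (q m / max \<rho> (1 - u m - 4 / block_at m t)) + (1 - q m) * ln ((1 - q m) / max \<rho> (u m - 4 / block_at m t)))
       \<longlonglongrightarrow> deriv \<psi> t * ln (deriv \<psi> t / max \<rho> (1 - U - 0)) + (1 - deriv \<psi> t) * ln ((1 - deriv \<psi> t) / max \<rho> (U - 0))"
      using D01 \<rho>(1) by (intro tendsto_add tendsto_mult q tendsto_ln tendsto_divide P Q tendsto_diff tendsto_const) auto
    moreover have "max \<rho> (1 - U - 0) = 1 - U" "max \<rho> (U - 0) = U" using U01 by auto
    ultimately have lim: "(\<lambda>m. q m * ln (q m / max \<rho> (1 - u m - 4 / block_at m t)) + (1 - q m) * ln ((1 - q m) / max \<rho> (u m - 4 / block_at m t)))
       \<longlonglongrightarrow> rel_ent (deriv \<psi> t) U" unfolding rel_ent_def by simp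
    have "\<forall>\<^sub>F m in sequentially. q m * ln (q m / max \<rho> (1 - u m - 4 / block_at m t)) + (1 - q m) * ln ((1 - q m) / max \<rho> (u m - 4 / block_at m t))
       = lower_rate \<beta> \<rho> \<psi> m (block_at m t)"
      using eventually_block_at_pos[OF t1(1)]
      by eventually_elim (simp add: lower_rate_def Let_def q_def u_def)
    then have "(\<lambda>m. lower_rate \<beta> \<rho> \<psi> m (block_at m t)) \<longlonglongrightarrow> rel_ent (deriv \<psi> t) U"
      by (rule Lim_transform_eventually[OF lim])
    then show ?thesis using le unfolding U_def by blast
  qed
  have bound: "\<bar>lower_rate \<beta> \<rho> \<psi> m j\<bar> \<le> 2 * ln (1 / \<rho>)" if j: "j < m" for m j
  proof -
    have L0: "0 \<le> ln (1 / \<rho>)" using \<rho>(1) \<rho>1 by simp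
    show ?thesis
    proof (cases "j = 0")
      case True
      then show ?thesis using L0 by (simp add: lower_rate_def)
    next
      case False
      have m: "0 < m" using j by simp
      define q where "q = chord \<psi> m j"
      define u where "u = \<beta> * (\<psi> (real j / m) + 1 / m - \<psi> (1 / m)) / (real j / m)"
      have u: "0 \<le> u" "u \<le> 1"
      proof -
        have t: "0 < real j / m" "real j / m \<le> 1" "1 / real m \<le> real j / m" "0 < 1 / real m" using False j m by (auto simp: field_simps)
        have "0 \<le> \<psi> (real j / m)" "\<psi> (1 / m) \<le> 1 / m" "\<psi> (real j / m) - \<psi> (1 / m) \<le> real j / m - 1 / m"
          using admissibleD(3,4,5)[OF \<psi>(1)] t by auto
        then have "0 \<le> \<psi> (real j / m) + 1 / m - \<psi> (1 / m)" "\<psi> (real j / m) + 1 / m - \<psi> (1 / m) \<le> real j / m" by linarith+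
        then have "0 \<le> \<beta> * (\<psi> (real j / m) + 1 / m - \<psi> (1 / m))" "\<beta> * (\<psi> (real j / m) + 1 / m - \<psi> (1 / m)) \<le> 1 * (real j / m)"
          using \<beta> by (intro mult_nonneg_nonneg mult_mono; linarith)+
        then show "0 \<le> u" "u \<le> 1" unfolding u_def using t(1) by (auto simp only: pos_divide_le_eq intro!: divide_nonneg_pos)
      qed
      have qe: "q = (1 - e) * chord \<phi> m j + e * c" unfolding q_def by (rule \<psi>(4)[OF m])
      have cb: "0 \<le> chord \<phi> m j" "chord \<phi> m j \<le> 1" using chord_bounds[OF \<phi> j] by auto
      have "0 \<le> (1 - e) * chord \<phi> m j" "(1 - e) * chord \<phi> m j \<le> (1 - e) * 1"
        using cb e by (auto intro!: mult_left_mono simp del: mult_1_right)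
      then have "e * c \<le> q" "e * (1 - c) \<le> 1 - q" unfolding qe by (auto simp: algebra_simps)
      then have q: "\<rho> \<le> q" "\<rho> \<le> 1 - q" using \<rho> by linarith+
      have h: "0 \<le> 4 / real j" by simp
      have mx: "max \<rho> (1 - u - 4 / j) \<le> 1" "max \<rho> (u - 4 / j) \<le> 1"
        using u \<rho>1 h by (intro max.boundedI; linarith)+
      have "\<bar>q * ln (q / max \<rho> (1 - u - 4 / j))\<bar> \<le> ln (1 / \<rho>)"
        using q \<rho>(1) mx by (intro abs_mult_ln_div_le max.cobounded1; linarith)
      moreover have "\<bar>(1 - q) * ln ((1 - q) / max \<rho> (u - 4 / j))\<bar> \<le> ln (1 / \<rho>)"
        using q \<rho>(1) mx by (intro abs_mult_ln_div_le max.cobounded1; linarith)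
      ultimately show ?thesis using False unfolding lower_rate_def Let_def q_def[symmetric] u_def[symmetric]
        by simp
    qed
  qed
  have fint: "(f m has_integral (\<Sum>j<m. lower_rate \<beta> \<rho> \<psi> m j) / m) {0..1}" if "0 < m" for m
    by (rule has_integral_spike[OF N _ has_integral_block_step[OF that]]) (simp add: f_def)
  have NN: "negligible (N \<union> {1})" using N by simp
  \<comment> \<open>The shift avoids \<open>m = 0\<close>, where there are no blocks, and
    \<open>t = 1\<close> is again not in a block.\<close>
  define f' where "f' m t = (if t = 1 then 0 else f (Suc m) t)" for m t
  define G' where "G' t = (if t = 1 then 0 else G t)" for t
  have f'int: "(f' m has_integral (\<Sum>j<Suc m. lower_rate \<beta> \<rho> \<psi> (Suc m) j) / Suc m) {0..1}" for m
    by (rule has_integral_spike_finite[of "{1}", OF _ _ fint]) (auto simp: f'_def)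
  have conv: "(\<lambda>m. f' m t) \<longlonglongrightarrow> G' t" if "t \<in> {0..1}" for t
  proof (cases "t \<in> N \<union> {1}")
    case True
    then show ?thesis by (auto simp: f'_def G'_def f_def G_def)
  next
    case False
    then have "(\<lambda>m. lower_rate \<beta> \<rho> \<psi> (Suc m) (block_at (Suc m) t)) \<longlonglongrightarrow> rel_ent (deriv \<psi> t) (\<beta> * \<psi> t / t)"
      using main[of t] that by (intro LIMSEQ_Suc) auto
    then show ?thesis using False by (simp add: f'_def G'_def f_def G_def)
  qed
  have dom: "norm (f' m t) \<le> 2 * ln (1 / \<rho>)" if "t \<in> {0..1}" for m t
  proof -
    have "0 \<le> 2 * ln (1 / \<rho>)" using \<rho>(1) \<rho>1 by simp
    moreover have "block_at (Suc m) t < Suc m" if "t \<noteq> 1" using that \<open>t \<in> {0..1}\<close> by (intro block_at_less) auto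
    ultimately show ?thesis using bound[of "block_at (Suc m) t" "Suc m"] unfolding f'_def f_def by auto
  qed
  have G'int: "G' integrable_on {0..1}" and lim: "(\<lambda>m. integral {0..1} (f' m)) \<longlonglongrightarrow> integral {0..1} G'"
    using dominated_convergence[of f' "{0..1}" "\<lambda>_. 2 * ln (1 / \<rho>)" G'] f'int dom conv
    by (auto simp: integrable_on_def integrable_const_ivl)
  have "integral {0..1} G' \<le> r"
  proof -
    have "((\<lambda>t. if t \<in> N \<union> {1} then 0 else g t) has_integral r) {0..1}"
      by (rule has_integral_spike[OF NN _ gint]) simp
    moreover have "(G' has_integral integral {0..1} G') {0..1}" using G'int by (rule integrable_integral)
    ultimately show ?thesis
      using has_integral_le[of G' "integral {0..1} G'" "{0..1}" "\<lambda>t. if t \<in> N \<union> {1} then 0 else g t" r] main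
      by (auto simp: G'_def G_def)
  qed
  then have "integral {0..1} G' < r + \<kappa>" using \<kappa> by simp
  with lim have "\<forall>\<^sub>F m in sequentially. integral {0..1} (f' m) < r + \<kappa>" by (rule order_tendstoD(2))
  moreover have "integral {0..1} (f' m) = (\<Sum>j<Suc m. lower_rate \<beta> \<rho> \<psi> (Suc m) j) / Suc m" for m
    using f'int by (rule integral_unique)
  ultimately have "\<forall>\<^sub>F m in sequentially. (\<Sum>j<Suc m. lower_rate \<beta> \<rho> \<psi> (Suc m) j) / Suc m < r + \<kappa>" by simp
  then have "\<forall>\<^sub>F m in sequentially. (\<Sum>j<m. lower_rate \<beta> \<rho> \<psi> m j) / m < r + \<kappa>"
    by (subst (asm) eventually_sequentially_Suc)
  then show ?thesis unfolding rate \<psi>_def by simp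
qed

section \<open>Large deviations from local bounds\<close>

lemma space_borel_sets_of [simp]: "space (borel_sets_of m) = mspace m"
  unfolding borel_sets_of_def by (intro space_measure_of) (auto dest!: openin_subset)

lemma openin_sets_borel_sets_of: "openin (mtopology_of m) U \<Longrightarrow> U \<in> sets (borel_sets_of m)"
  unfolding borel_sets_of_def by (subst sets_measure_of) (auto dest!: openin_subset)

lemma mcball_sets_borel_sets_of: "{y \<in> mspace m. mdist m x y \<le> \<delta>} \<in> sets (borel_sets_of m)" if "x \<in> mspace m"
proof -
  interpret Metric_space "mspace m" "mdist m" by simp
  have "closedin (mtopology_of m) (mcball x \<delta>)" unfolding mtopology_of_def by (rule closedin_mcball)
  then have "openin (mtopology_of m) (mspace m - mcball x \<delta>)" by (simp add: closedin_def)
  then have "mspace m - (mspace m - mcball x \<delta>) \<in> sets (borel_sets_of m)"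
    using sets.compl_sets[OF openin_sets_borel_sets_of] by fastforce
  moreover have "mspace m - (mspace m - mcball x \<delta>) = {y \<in> mspace m. mdist m x y \<le> \<delta>}"
    using that by (auto simp: mcball_def)
  ultimately show ?thesis by metis
qed

lemma log_prob_le: "0 < n \<Longrightarrow> 0 \<le> p \<Longrightarrow> p \<le> exp (- (real n * a)) \<Longrightarrow> ereal (1 / real n) * log_prob p \<le> ereal (- a)"
proof -
  assume n: "0 < n" "0 \<le> p" "p \<le> exp (- (real n * a))"
  show ?thesis
  proof (cases "p = 0")
    case False
    then have "ln p \<le> - (real n * a)" using n False ln_le_cancel_iff[of p "exp (- (real n * a))"] by simp
    then have "1 / real n * ln p \<le> - a" using n by (simp add: field_simps)
    then show ?thesis using False by (simp add: log_prob_def)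
  qed (use n in \<open>simp add: log_prob_def\<close>)
qed

lemma log_prob_ge: "0 < n \<Longrightarrow> exp (- (real n * a)) \<le> p \<Longrightarrow> ereal (- a) \<le> ereal (1 / real n) * log_prob p"
proof -
  assume n: "0 < n" "exp (- (real n * a)) \<le> p"
  then have p: "0 < p" using exp_gt_zero less_le_trans by blast
  then have "- (real n * a) \<le> ln p" using n by (subst ln_ge_iff) auto
  then have "- a \<le> 1 / real n * ln p" using n by (simp add: field_simps)
  then show ?thesis using p by (simp add: log_prob_def)
qed

text \<open>For large \<open>n\<close> the compact set \<open>K\<close> carries \<open>X n\<close>
  almost surely, so exponential tightness is built in. One ball inside the interior gives the lower
  bound. For the upper bound finitely many balls cover the part of the closure in \<open>K\<close>,
  and the probability of their union decays like the largest of theirs.\<close>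

lemma large_deviation_principle_local:
  fixes X :: "nat \<Rightarrow> 'w \<Rightarrow> 'a" and I :: "'a \<Rightarrow> ereal"
  assumes "prob_space M" and X: "\<And>n. 1 \<le> n \<Longrightarrow> X n \<in> measurable M (borel_sets_of m)"
    and K: "compactin (mtopology_of m) K" and I0: "\<And>x. x \<in> mspace m \<Longrightarrow> 0 \<le> I x"
    and IK: "\<And>x. x \<in> mspace m \<Longrightarrow> x \<notin> K \<Longrightarrow> I x = \<infinity>"
    and XK: "\<forall>\<^sub>F n in sequentially. AE \<omega> in M. X n \<omega> \<in> K"
    and upper: "\<And>x a. x \<in> K \<Longrightarrow> ereal a < I x \<Longrightarrow>
      \<exists>\<delta>>0. \<forall>\<^sub>F n in sequentially. \<P>(\<omega> in M. mdist m x (X n \<omega>) \<le> \<delta>) \<le> exp (- (real n * a))"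
    and lower: "\<And>x b \<delta>. x \<in> K \<Longrightarrow> I x < ereal b \<Longrightarrow> 0 < \<delta> \<Longrightarrow>
      \<forall>\<^sub>F n in sequentially. exp (- (real n * b)) \<le> \<P>(\<omega> in M. mdist m x (X n \<omega>) \<le> \<delta>)"
  shows "large_deviation_principle M m X I"
proof -
  interpret prob_space M by fact
  interpret Metric_space "mspace m" "mdist m" by simp
  have mtop: "mtopology_of m = mtopology" by (simp add: mtopology_of_def)
  have KM: "K \<subseteq> mspace m" using K unfolding mtop by (simp add: compactin_subspace)
  have Kcl: "closedin mtopology K" using K unfolding mtop by (intro compactin_imp_closedin Hausdorff_space_mtopology)
  have XM: "X n \<omega> \<in> mspace m" if "1 \<le> n" "\<omega> \<in> space M" for n \<omega>
    using measurable_space[OF X[OF that(1)] that(2)] by simp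
  have ev: "{\<omega> \<in> space M. X n \<omega> \<in> U} \<in> events" if "U \<in> sets (borel_sets_of m)" "1 \<le> n" for U n
    using measurable_sets[OF X[OF that(2)] that(1)] by (simp add: vimage_def Int_def conj_commute)
  have ball_ev: "{\<omega> \<in> space M. mdist m x (X n \<omega>) \<le> \<delta>} \<in> events" if "x \<in> mspace m" "1 \<le> n" for x \<delta> n
  proof -
    have "{\<omega> \<in> space M. mdist m x (X n \<omega>) \<le> \<delta>} = {\<omega> \<in> space M. X n \<omega> \<in> {y \<in> mspace m. mdist m x y \<le> \<delta>}}"
      using XM[OF that(2)] by auto
    then show ?thesis using ev[OF mcball_sets_borel_sets_of[OF that(1)] that(2)] by simp
  qed
  \<comment> \<open>Lower semicontinuity comes for free: the lower bound at \<open>y\<close> near \<open>x\<close> is limited by the upper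
    bound at \<open>x\<close>.\<close>
  have lsc: "\<exists>r>0. \<forall>y\<in>mball x r. ereal a < I y" if x: "x \<in> mspace m" and a: "ereal a < I x" for x a
  proof (cases "x \<in> K")
    case False
    have "openin mtopology (mspace m - K)" using Kcl by (simp add: closedin_def)
    then obtain r where r: "r > 0" "mball x r \<subseteq> mspace m - K"
      using x False unfolding openin_mtopology by blast
    have "I y = \<infinity>" if "y \<in> mball x r" for y using IK r that by blast
    then show ?thesis using r by auto
  next
    case True
    obtain a' where a': "a < a'" "ereal a' < I x"
      using ereal_dense2[OF a] by auto
    obtain \<delta> where \<delta>: "\<delta> > 0" "\<forall>\<^sub>F n in sequentially. prob {\<omega> \<in> space M. mdist m x (X n \<omega>) \<le> \<delta>} \<le> exp (- (real n * a'))"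
      using upper[OF True a'(2)] by blast
    have "ereal a < I y" if y: "y \<in> mball x (\<delta> / 2)" for y
    proof (rule ccontr)
      assume "\<not> ereal a < I y"
      then have Iy: "I y \<le> ereal a" by simp
      have yM: "y \<in> mspace m" using y by simp
      then have yK: "y \<in> K" using Iy IK by fastforce
      \<comment> \<open>At rate \<open>b\<close> strictly between, the lower bound
        \<open>exp (- (n * b))\<close> for a ball around \<open>y\<close> exceeds the upper bound
        \<open>exp (- (n * a'))\<close> for the larger ball around \<open>x\<close> that contains
        it.\<close>
      define b where "b = (a + a') / 2"
      have b: "a < b" "b < a'" unfolding b_def using a'(1) by auto
      have Iyb: "I y < ereal b" using Iy b(1) by (meson ereal_less_eq(3) le_less_trans less_ereal.simps(1))
      have "\<delta> / 2 > 0" using \<delta>(1) by simp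
      from lower[OF yK Iyb this]
      have "\<forall>\<^sub>F n in sequentially. exp (- (real n * b)) \<le> prob {\<omega> \<in> space M. mdist m y (X n \<omega>) \<le> \<delta> / 2}" .
      then have "\<forall>\<^sub>F n::nat in sequentially. False"
        using \<delta>(2) eventually_ge_at_top[of 1]
      proof eventually_elim
        case (elim n)
        have "prob {\<omega> \<in> space M. mdist m y (X n \<omega>) \<le> \<delta> / 2} \<le> prob {\<omega> \<in> space M. mdist m x (X n \<omega>) \<le> \<delta>}"
        proof (rule finite_measure_mono)
          show "{\<omega> \<in> space M. mdist m y (X n \<omega>) \<le> \<delta> / 2} \<subseteq> {\<omega> \<in> space M. mdist m x (X n \<omega>) \<le> \<delta>}"
          proof clarify
            fix \<omega> assume \<omega>: "\<omega> \<in> space M" "mdist m y (X n \<omega>) \<le> \<delta> / 2"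
            have "mdist m x (X n \<omega>) \<le> mdist m x y + mdist m y (X n \<omega>)"
              using x yM XM[OF elim(3) \<omega>(1)] by (intro triangle)
            then show "mdist m x (X n \<omega>) \<le> \<delta>" using \<omega> y by simp
          qed
          show "{\<omega> \<in> space M. mdist m x (X n \<omega>) \<le> \<delta>} \<in> events" by (rule ball_ev[OF x elim(3)])
        qed
        then have "exp (- (real n * b)) \<le> exp (- (real n * a'))" using elim by linarith
        then have "real n * a' \<le> real n * b" by simp
        then show False using b elim(3) by simp
      qed
      then show False by simp
    qed
    then show ?thesis using \<delta>(1) by (intro exI[of _ "\<delta> / 2"]) auto
  qed
  have good: "good_rate_function m I"
    unfolding good_rate_function_def mtop
  proof (intro conjI ballI allI I0)
    fix a :: real
    have "openin mtopology {x \<in> mspace m. ereal a < I x}"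
      unfolding openin_mtopology using lsc by fastforce
    moreover have "mspace m - {x \<in> mspace m. ereal a < I x} = {x \<in> mspace m. I x \<le> ereal a}" by auto
    ultimately have "closedin mtopology {x \<in> mspace m. I x \<le> ereal a}"
      using closedin_def by (metis (no_types, lifting) Diff_subset double_diff mem_Collect_eq subsetI topspace_mtopology)
    moreover have "{x \<in> mspace m. I x \<le> ereal a} \<subseteq> K" using IK by fastforce
    ultimately show "compactin mtopology {x \<in> mspace m. I x \<le> ereal a}"
      using K unfolding mtop by (blast intro: closed_compactin)
  qed
  define p where "p U n = ereal (1 / real n) * log_prob (prob {\<omega> \<in> space M. X n \<omega> \<in> U})" for U n
  have low: "- (INF x\<in>mtopology interior_of U. I x) \<le> liminf (p U)" if U: "U \<in> sets (borel_sets_of m)" for U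
  proof -
    have "- liminf (p U) \<le> I x" if x: "x \<in> mtopology interior_of U" for x
    proof (rule dense_ge)
      fix z assume z: "I x < z"
      have xM: "x \<in> mspace m" using x interior_of_subset_topspace by fastforce
      have xK: "x \<in> K" using IK[OF xM] z by fastforce
      obtain r where r: "r > 0" "mball x r \<subseteq> mtopology interior_of U"
        using x openin_interior_of[of mtopology U] unfolding openin_mtopology by blast
      show "- liminf (p U) \<le> z"
      proof (cases z)
        case (real b)
        have r2: "0 < r / 2" using r(1) by simp
        have "\<forall>\<^sub>F n in sequentially. ereal (- b) \<le> p U n"
          using lower[OF xK z[unfolded real] r2] eventually_ge_at_top[of 1]
        proof eventually_elim
          case (elim n)
          have "prob {\<omega> \<in> space M. mdist m x (X n \<omega>) \<le> r / 2} \<le> prob {\<omega> \<in> space M. X n \<omega> \<in> U}"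
          proof (rule finite_measure_mono)
            show "{\<omega> \<in> space M. mdist m x (X n \<omega>) \<le> r / 2} \<subseteq> {\<omega> \<in> space M. X n \<omega> \<in> U}"
            proof clarify
              fix \<omega> assume "\<omega> \<in> space M" "mdist m x (X n \<omega>) \<le> r / 2"
              then have "X n \<omega> \<in> mball x r" using xM XM[OF elim(2)] r(1) by simp
              then show "X n \<omega> \<in> U" using r(2) interior_of_subset[of mtopology U] by (meson subsetD)
            qed
            show "{\<omega> \<in> space M. X n \<omega> \<in> U} \<in> events" by (rule ev[OF U elim(2)])
          qed
          then show ?case unfolding p_def using elim by (intro log_prob_ge) auto
        qed
        then have "ereal (- b) \<le> liminf (p U)" by (rule Liminf_bounded)
        then have "- liminf (p U) \<le> - ereal (- b)" by (rule ereal_minus_le_minus[THEN iffD2])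
        then show ?thesis using real by simp
      qed (use z I0[OF xM] in auto)
    qed
    then have "- liminf (p U) \<le> (INF x\<in>mtopology interior_of U. I x)" by (intro INF_greatest)
    then show ?thesis by (simp add: ereal_uminus_le_reorder)
  qed
  have upp: "limsup (p U) \<le> - (INF x\<in>mtopology closure_of U. I x)" if U: "U \<in> sets (borel_sets_of m)" for U
  proof (rule dense_ge)
    fix z assume z: "- (INF x\<in>mtopology closure_of U. I x) < z"
    define C where "C = mtopology closure_of U"
    show "limsup (p U) \<le> z"
    proof (cases z)
      case (real z')
      define a where "a = - z'"
      have "ereal a < (INF x\<in>C. I x)" using z real unfolding a_def C_def by (simp add: ereal_uminus_less_reorder)
      then obtain a' where a': "a < a'" "ereal a' < (INF x\<in>C. I x)" using ereal_dense2 by fastforce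
      have "compactin mtopology (C \<inter> K)"
        using K unfolding mtop C_def by (intro closed_Int_compactin closedin_closure_of)
      have IC: "ereal a' < I x" if "x \<in> C" for x using a'(2) that by (meson INF_lower less_le_trans)
      define Q where "Q x d \<longleftrightarrow> (\<forall>\<^sub>F n in sequentially. prob {\<omega> \<in> space M. mdist m x (X n \<omega>) \<le> d} \<le> exp (- (real n * a')))" for x d
      have "\<exists>d>0. Q x d" if "x \<in> C \<inter> K" for x
        unfolding Q_def using upper[OF IntD2[OF that] IC[OF IntD1[OF that]]] .
      then obtain \<delta> where \<delta>: "\<And>x. x \<in> C \<inter> K \<Longrightarrow> 0 < \<delta> x" "\<And>x. x \<in> C \<inter> K \<Longrightarrow> Q x (\<delta> x)"
        by metis
      have cover: "\<exists>\<F>. finite \<F> \<and> \<F> \<subseteq> (\<lambda>x. mball x (\<delta> x)) ` (C \<inter> K) \<and> C \<inter> K \<subseteq> \<Union>\<F>"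
        using \<delta>(1) KM by (intro compactinD[OF \<open>compactin mtopology (C \<inter> K)\<close>]) force+
      obtain \<F> where F: "finite \<F>" "\<F> \<subseteq> (\<lambda>x. mball x (\<delta> x)) ` (C \<inter> K)" "C \<inter> K \<subseteq> \<Union>\<F>"
        using cover by (elim exE conjE)
      obtain T where T: "T \<subseteq> C \<inter> K" "finite T" "\<F> = (\<lambda>x. mball x (\<delta> x)) ` T"
        using finite_subset_image[OF F(1,2)] by (elim exE conjE)
      then have T: "finite T" "T \<subseteq> C \<inter> K" "C \<inter> K \<subseteq> (\<Union>x\<in>T. mball x (\<delta> x))"
        using F(3) by simp_all
      have evT: "\<forall>\<^sub>F n in sequentially. \<forall>x\<in>T. prob {\<omega> \<in> space M. mdist m x (X n \<omega>) \<le> \<delta> x} \<le> exp (- (real n * a'))"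
        by (rule eventually_ball_finite[OF T(1)]) (use T(2) \<delta>(2) in \<open>auto simp: Q_def\<close>)
      have "\<forall>\<^sub>F n in sequentially. p U n \<le> ereal (- a)"
        using evT XK eventually_ge_at_top[of 1] eventually_real_ge[of "ln (real (card T) + 1) / (a' - a)"]
      proof eventually_elim
        case (elim n)
        have evx: "{\<omega> \<in> space M. mdist m x (X n \<omega>) \<le> \<delta> x} \<in> events" if "x \<in> T" for x
          using that T(2) KM by (intro ball_ev elim(3)) auto
        define V where "V x = {\<omega> \<in> space M. mdist m x (X n \<omega>) \<le> \<delta> x}" for x
        define W where "W = {\<omega> \<in> space M. X n \<omega> \<in> U}"
        have V: "V x \<in> events" if "x \<in> T" for x unfolding V_def by (rule evx[OF that])
        have "U \<subseteq> mspace m" using sets.sets_into_space[OF U] by simp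
        then have UC: "U \<subseteq> C" unfolding C_def by (intro closure_of_subset) simp
        have "AE \<omega> in M. \<omega> \<in> W \<longrightarrow> \<omega> \<in> (\<Union>x\<in>T. V x)"
          using elim(2)
        proof eventually_elim
          case (elim \<omega>)
          show ?case
          proof
            assume "\<omega> \<in> W"
            then have \<omega>: "\<omega> \<in> space M" "X n \<omega> \<in> U" unfolding W_def by auto
            then have "X n \<omega> \<in> C \<inter> K" using elim UC by auto
            then obtain x where "x \<in> T" "X n \<omega> \<in> mball x (\<delta> x)" using subsetD[OF T(3)] by auto
            moreover from this have "\<omega> \<in> V x" using \<omega>(1) unfolding V_def by auto
            ultimately show "\<omega> \<in> (\<Union>x\<in>T. V x)" by blast
          qed
        qed
        then have "prob W \<le> prob (\<Union>x\<in>T. V x)"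
          by (rule finite_measure_mono_AE) (use T(1) V in auto)
        also have "\<dots> \<le> (\<Sum>x\<in>T. prob (V x))"
          using T(1) V by (intro finite_measure_subadditive_finite) auto
        also have "\<dots> \<le> (\<Sum>x\<in>T. exp (- (real n * a')))" using elim(1) unfolding V_def by (intro sum_mono) auto
        \<comment> \<open>The number of balls is absorbed by the gap \<open>a' - a\<close> for large
          \<open>n\<close>; the 1 keeps the logarithm of this factor meaningful when
          \<open>T\<close> is empty.\<close>
        also have "\<dots> \<le> (real (card T) + 1) * exp (- (real n * a'))" by (simp add: distrib_right)
        also have "\<dots> = exp (ln (real (card T) + 1) - real n * a')"
          by (simp add: exp_diff exp_minus field_simps add_nonneg_pos)
        also have "\<dots> \<le> exp (- (real n * a))"
        proof -
          have "ln (real (card T) + 1) \<le> real n * (a' - a)" using elim(4) a'(1) by (simp add: field_simps)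
          then show ?thesis by (simp add: algebra_simps)
        qed
        finally show ?case unfolding p_def W_def using elim(3) by (intro log_prob_le) auto
      qed
      then have "limsup (p U) \<le> ereal (- a)" by (rule Limsup_bounded)
      then show ?thesis using real unfolding a_def by simp
    qed (use z in auto)
  qed
  show ?thesis
    unfolding large_deviation_principle_def mtop
    using X good low upp unfolding p_def
    by (auto intro!: Liminf_le_Limsup)
qed

section \<open>The compact set of admissible paths in the path space\<close>

lemma mspace_C01: "mspace C01 = {f. f \<in> extensional {0..1} \<and> continuous_on {0..1} f}"
proof -
  have "compactin (top_of_set {0..1::real}) (topspace (top_of_set {0..1}))" by (simp add: compactin_subtopology)
  from compactin_mspace_cfunspace[OF this, of "euclidean_metric :: real metric"]
  show ?thesis unfolding C01_def by auto
qed

lemma mdist_C01_le: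
  assumes "f \<in> mspace C01" "g \<in> mspace C01"
  shows "mdist C01 f g \<le> a \<longleftrightarrow> (\<forall>t\<in>{0..1}. \<bar>f t - g t\<bar> \<le> a)"
  using cfunspace_mdist_le[of f "top_of_set {0..1}" euclidean_metric g a] assms
  unfolding C01_def by (simp add: dist_real_def)

lemma admissible_continuous_on: "admissible \<phi> \<Longrightarrow> continuous_on {0..1} \<phi>"
  unfolding continuous_on_iff dist_real_def using admissibleD(6) by (metis atLeastAtMost_iff le_less_trans)

text \<open>Arzela-Ascoli: admissible functions take values between 0 and 1 and share the Lipschitz
  constant 1. The defining conditions are closed and pass to pointwise limits.\<close>

lemma compactin_admissible: "compactin (mtopology_of C01) {\<phi> \<in> mspace C01. admissible \<phi>}"
proof -
  interpret Metric_space "mspace C01" "mdist C01" by simp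
  have "\<exists>l r. l \<in> {\<phi> \<in> mspace C01. admissible \<phi>} \<and> strict_mono r \<and> limitin mtopology (\<sigma> \<circ> r) l sequentially"
    if \<sigma>: "range \<sigma> \<subseteq> {\<phi> \<in> mspace C01. admissible \<phi>}" for \<sigma> :: "nat \<Rightarrow> real \<Rightarrow> real"
  proof -
    have adm: "admissible (\<sigma> n)" and \<sigma>M: "\<sigma> n \<in> mspace C01" for n using \<sigma> by auto
    obtain g r where g: "continuous_on {0..1} g" "strict_mono (r :: nat \<Rightarrow> nat)"
      "\<And>e. 0 < e \<Longrightarrow> \<exists>N. \<forall>n x. n \<ge> N \<and> x \<in> {0..1} \<longrightarrow> norm (\<sigma> (r n) x - g x) < e"
    proof (rule Arzela_Ascoli[of "{0..1::real}" \<sigma> 1])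
      show "norm (\<sigma> n x) \<le> 1" if "x \<in> {0..1}" for n x using admissibleD(4,5)[OF adm, of x n] that by auto
      show "\<exists>d. 0 < d \<and> (\<forall>n y. y \<in> {0..1} \<and> norm (x - y) < d \<longrightarrow> norm (\<sigma> n x - \<sigma> n y) < e)"
        if "x \<in> {0..1}" "0 < e" for x e
      proof (intro exI[of _ e] conjI allI impI that(2))
        fix n y assume "y \<in> {0..1} \<and> norm (x - y) < e"
        then show "norm (\<sigma> n x - \<sigma> n y) < e" using admissibleD(6)[OF adm, of y x n] that by auto
      qed
    qed auto
    have lim: "(\<lambda>n. \<sigma> (r n) x) \<longlonglongrightarrow> g x" if "x \<in> {0..1}" for x
      unfolding LIMSEQ_iff using g(3) that by blast
    \<comment> \<open>Arzela-Ascoli controls the limit only on the unit interval; a point of the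
      path space must also be \<open>undefined\<close> outside.\<close>
    define l where "l = restrict g {0..1}"
    have "admissible l"
      unfolding admissible_def
    proof (intro conjI allI impI)
      have "(\<lambda>n. \<sigma> (r n) 0) \<longlonglongrightarrow> g 0" by (rule lim) simp
      then show "l 0 = 0" using admissibleD(1)[OF adm] by (simp add: l_def LIMSEQ_const_iff)
      fix s t :: real assume st: "0 \<le> s \<and> s \<le> t \<and> t \<le> 1"
      have d: "(\<lambda>n. \<sigma> (r n) t - \<sigma> (r n) s) \<longlonglongrightarrow> l t - l s"
        using lim[of s] lim[of t] st by (auto intro!: tendsto_diff simp: l_def)
      show "0 \<le> l t - l s" using admissibleD(2)[OF adm, of s t] st by (intro LIMSEQ_le_const[OF d]) auto
      show "l t - l s \<le> t - s" using admissibleD(3)[OF adm, of s t] st by (intro LIMSEQ_le_const2[OF d]) auto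
    qed
    moreover from this have lM: "l \<in> mspace C01"
    unfolding mspace_C01 using admissible_continuous_on[of l] by (auto simp only: mem_Collect_eq l_def restrict_extensional)
    moreover have "limitin mtopology (\<sigma> \<circ> r) l sequentially"
      unfolding limit_metric_sequentially
    proof (intro conjI allI impI lM)
      fix e :: real assume "0 < e"
      then obtain N where N: "\<And>n x. n \<ge> N \<Longrightarrow> x \<in> {0..1} \<Longrightarrow> norm (\<sigma> (r n) x - g x) < e / 2"
        using g(3)[of "e / 2"] by auto
      show "\<exists>N. \<forall>n\<ge>N. (\<sigma> \<circ> r) n \<in> mspace C01 \<and> mdist C01 ((\<sigma> \<circ> r) n) l < e"
      proof (intro exI[of _ N] allI impI conjI)
        fix n assume n: "N \<le> n"
        show "(\<sigma> \<circ> r) n \<in> mspace C01" using \<sigma>M by simp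
        have "mdist C01 (\<sigma> (r n)) l \<le> e / 2"
          unfolding mdist_C01_le[OF \<sigma>M lM] using N[OF n] by (auto simp: l_def intro: less_imp_le)
        then show "mdist C01 ((\<sigma> \<circ> r) n) l < e" using \<open>0 < e\<close> by simp
      qed
    qed
    ultimately show ?thesis using g(2) by blast
  qed
  then show ?thesis unfolding mtopology_of_def compactin_sequentially by auto
qed

section \<open>The Markov chain\<close>

text \<open>
  The position at time \<open>i / n\<close>, times \<open>n\<close>: the chain is delayed by \<open>k0 - 1\<close> and preceded by \<open>k0\<close>
  up-steps.
\<close>

definition extended_path :: "nat \<Rightarrow> (nat \<Rightarrow> nat) \<Rightarrow> nat \<Rightarrow> nat" where
  "extended_path k0 z i = (if i < k0 then i else z (i - k0 + 1))"

text \<open>Turns the two branches and the floor into the same clamped sum as in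
  \<open>path_fn\<close>. The increments of \<open>z\<close> are arbitrary here, so continuity and
  measurability can be shown at every sample point and not only almost surely.\<close>

lemma trajectory_eq:
  assumes n: "0 < n" and z: "z 1 = k0" and t: "t \<in> {0..1}"
  shows "trajectory k0 z n t =
    (\<Sum>i<n. (real (extended_path k0 z (Suc i)) - real (extended_path k0 z i)) * min 1 (max 0 (real n * t - real i))) / real n"
proof -
  define Y where "Y = extended_path k0 z"
  define x where "x = real n * t"
  define k where "k = nat \<lfloor>x\<rfloor>"
  have x: "0 \<le> x" "x \<le> n" unfolding x_def using n t by (auto simp: mult_left_le)
  have k: "real k \<le> x" "x \<le> real k + 1" "of_int \<lfloor>x\<rfloor> = real k" unfolding k_def using x by auto
  then have kn: "k \<le> n" using x by linarith
  have Y0: "Y 0 = 0" using z unfolding Y_def extended_path_def by simp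
  have Yk0: "Y i = i" if "i \<le> k0" for i using z that unfolding Y_def extended_path_def by auto
  have "(\<Sum>i<n. (real (Y (Suc i)) - real (Y i)) * min 1 (max 0 (x - real i)))
      = (\<Sum>i<k. real (Y (Suc i)) - real (Y i)) + (if k < n then (x - real k) * (real (Y (Suc k)) - real (Y k)) else 0)"
    by (rule sum_clamp_floor[OF k(1,2) kn])
  also have "(\<Sum>i<k. real (Y (Suc i)) - real (Y i)) = real (Y k)"
    using sum_lessThan_telescope[of "\<lambda>i. real (Y i)" k] Y0 by simp
  also have "(if k < n then (x - real k) * (real (Y (Suc k)) - real (Y k)) else 0) = (x - real k) * (real (Y (Suc k)) - real (Y k))"
    using kn x k by auto
  finally have sum: "(\<Sum>i<n. (real (Y (Suc i)) - real (Y i)) * min 1 (max 0 (x - real i)))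
      = real (Y k) + (x - real k) * (real (Y (Suc k)) - real (Y k))" .
  have "trajectory k0 z n t = (real (Y k) + (x - real k) * (real (Y (Suc k)) - real (Y k))) / n"
  proof (cases "t \<le> real k0 / real n")
    case True
    then have xk0: "x \<le> k0" unfolding x_def using n by (simp add: field_simps)
    have "real (Y k) + (x - real k) * (real (Y (Suc k)) - real (Y k)) = x"
    proof (cases "k < k0")
      case True
      then show ?thesis using Yk0[of k] Yk0[of "Suc k"] by simp
    next
      case False
      then have "k = k0" "x = k0" using xk0 k by linarith+
      then show ?thesis using Yk0[of k] by simp
    qed
    then show ?thesis using True t n unfolding trajectory_def x_def by simp
  next
    case False
    then have "k0 < x" unfolding x_def using n by (simp add: field_simps)
    then have "k0 \<le> k" using k by linarith
    then have "Y k = z (k - k0 + 1)" "Y (Suc k) = z (k - k0 + 1 + 1)"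
      unfolding Y_def extended_path_def by (auto simp: Suc_diff_le)
    moreover have "trajectory k0 z n t = 1 / n * real (z (k - k0 + 1)) +
        (x - of_int \<lfloor>x\<rfloor>) / n * (real (z (k - k0 + 1 + 1)) - real (z (k - k0 + 1)))"
      using False t unfolding trajectory_def k_def x_def by (simp add: Let_def)
    ultimately show ?thesis unfolding k(3) by (simp add: add_divide_distrib)
  qed
  then show ?thesis using sum unfolding Y_def x_def by simp
qed

lemma trajectory_mspace:
  assumes "0 < n" "z 1 = k0"
  shows "trajectory k0 z n \<in> mspace C01"
proof -
  have "continuous_on {0..1} (\<lambda>t. (\<Sum>i<n. (real (extended_path k0 z (Suc i)) - real (extended_path k0 z i)) * min 1 (max 0 (real n * t - real i))) / real n)"
    using assms by (intro continuous_intros) auto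
  then have "continuous_on {0..1} (trajectory k0 z n)"
    by (rule continuous_on_eq) (use trajectory_eq[of n z k0, OF assms] in auto)
  moreover have "trajectory k0 z n \<in> extensional {0..1}" unfolding trajectory_def by simp
  ultimately show ?thesis unfolding mspace_C01 by blast
qed

lemma trajectory_eq_path_fn:
  assumes n: "0 < n" and z: "z 1 = k0" and A: "\<And>i. i \<le> n \<Longrightarrow> extended_path k0 z i = card (A \<inter> {..<i})"
  shows "trajectory k0 z n = path_fn n A"
proof
  fix t
  show "trajectory k0 z n t = path_fn n A t"
  proof (cases "t \<in> {0..1}")
    case True
    have "trajectory k0 z n t = (\<Sum>i<n. of_bool (i \<in> A) * min 1 (max 0 (real n * t - real i))) / real n"
      unfolding trajectory_eq[of n z k0, OF n z True] using A
      by (intro arg_cong2[of _ _ _ _ divide] sum.cong refl) (simp add: card_Int_lessThan_Suc)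
    then show ?thesis unfolding path_fn_eq_sum[OF True] .
  qed (auto simp: trajectory_def path_fn_def)
qed

lemma card_Int_lessThan_inject:
  fixes A B :: "nat set"
  assumes "A \<subseteq> {..<n}" "B \<subseteq> {..<n}" "\<And>i. i \<le> n \<Longrightarrow> card (A \<inter> {..<i}) = card (B \<inter> {..<i})"
  shows "A = B"
proof -
  have "i \<in> A \<longleftrightarrow> i \<in> B" if "i < n" for i
    using assms(3)[of i] assms(3)[of "Suc i"] that by (simp add: card_Int_lessThan_Suc of_bool_def split: if_splits)
  then show ?thesis using assms(1,2) by blast
qed

locale urn_chain = prob_space M for M :: "'w measure" +
  fixes \<alpha> :: real and k0 :: nat and s :: "nat \<Rightarrow> real" and Z :: "nat \<Rightarrow> 'w \<Rightarrow> nat"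
  assumes \<alpha>: "1 < \<alpha>" and s_pos: "\<And>n. n \<ge> 1 \<Longrightarrow> s n > 0"
    and s_ge: "\<And>n. n \<ge> 1 \<Longrightarrow> s n \<ge> real k0 + real n - 1"
    and s_lim: "(\<lambda>n. s n / real n) \<longlonglongrightarrow> \<alpha>"
    and chain: "markov_chain M Z"
    and Z1: "\<And>\<omega>. \<omega> \<in> space M \<Longrightarrow> Z 1 \<omega> = k0"
    and up: "\<And>n z. n \<ge> 1 \<Longrightarrow> \<P>(\<omega> in M. Z n \<omega> = z) > 0 \<Longrightarrow>
           \<P>(\<omega> in M. int (Z (n + 1) \<omega>) - int (Z n \<omega>) = 1 \<bar> Z n \<omega> = z) = 1 - real z / s n"
    and stay: "\<And>n z. n \<ge> 1 \<Longrightarrow> \<P>(\<omega> in M. Z n \<omega> = z) > 0 \<Longrightarrow>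
           \<P>(\<omega> in M. int (Z (n + 1) \<omega>) - int (Z n \<omega>) = 0 \<bar> Z n \<omega> = z) = real z / s n"
begin

text \<open>With \<open>v i = 0\<close> the \<open>k0\<close> preliminary up-steps are certain under
  \<open>kern v\<close>; from then on time \<open>i\<close> is time \<open>i - k0 + 1\<close> of the
  chain.\<close>

definition v :: "nat \<Rightarrow> real" where
  "v i = (if i < k0 then 0 else 1 / s (i - k0 + 1))"

text \<open>The bound \<open>i * v i \<le> 1\<close> is the growth condition on \<open>s\<close> at
  index \<open>i - k0 + 1\<close>, where it reads \<open>s \<ge> i\<close>. The limit follows from
  that of \<open>s n / n\<close>, since the shift of the index changes the ratio by a factor tending
  to 1.\<close>

lemma urn_kernel_v: "urn_kernel v (1 / \<alpha>)"
proof
  fix i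
  show "0 \<le> v i" unfolding v_def using s_pos[of "i - k0 + 1"] by simp
  show "real i * v i \<le> 1"
    using s_pos[of "i - k0 + 1"] s_ge[of "i - k0 + 1"] by (auto simp: v_def of_nat_diff)
  show "0 < 1 / \<alpha>" "1 / \<alpha> < 1" using \<alpha> by auto
  have "(\<lambda>n. real (Suc n) / s (Suc n)) \<longlonglongrightarrow> inverse \<alpha>"
    using tendsto_inverse[OF s_lim] \<alpha> by (subst filterlim_sequentially_Suc) (simp add: inverse_eq_divide)
  moreover have "(\<lambda>n. 1 + (real k0 - 1) / real (Suc n)) \<longlonglongrightarrow> 1 + 0"
    by (intro tendsto_intros LIMSEQ_Suc lim_const_over_n)
  ultimately have "(\<lambda>n. (1 + (real k0 - 1) / real (Suc n)) * (real (Suc n) / s (Suc n))) \<longlonglongrightarrow> (1 + 0) * inverse \<alpha>"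
    by (intro tendsto_mult)
  moreover have "(1 + (real k0 - 1) / real (Suc n)) * (real (Suc n) / s (Suc n)) = real (n + k0) * v (n + k0)" for n
  proof -
    have "1 + (real k0 - 1) / real (Suc n) = real (n + k0) / real (Suc n)" by (simp add: field_simps)
    then show ?thesis unfolding v_def by (simp del: of_nat_Suc)
  qed
  ultimately have "(\<lambda>n. real (n + k0) * v (n + k0)) \<longlonglongrightarrow> 1 / \<alpha>" by (simp add: inverse_eq_divide)
  then show "(\<lambda>i. real i * v i) \<longlonglongrightarrow> 1 / \<alpha>" by (rule LIMSEQ_offset)
qed

section \<open>The law of the chain in terms of path weights\<close>

lemma Z_measurable: "n \<ge> 1 \<Longrightarrow> Z n \<in> measurable M (count_space UNIV)"
  using chain unfolding markov_chain_def by blast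

lemma Z_eq_event: "n \<ge> 1 \<Longrightarrow> {\<omega> \<in> space M. Z n \<omega> = z} \<in> events"
  using measurable_sets[OF Z_measurable, of n "{z}"] by (simp add: vimage_def Int_def conj_commute)

abbreviation Y :: "'w \<Rightarrow> nat \<Rightarrow> nat" where
  "Y \<omega> \<equiv> extended_path k0 (\<lambda>m. Z m \<omega>)"

definition path_event :: "nat \<Rightarrow> nat set \<Rightarrow> 'w set" where
  "path_event n A = {\<omega> \<in> space M. \<forall>i\<le>n. Y \<omega> i = card (A \<inter> {..<i})}"

lemma path_event_sets: "path_event n A \<in> events"
proof -
  have ev: "{\<omega> \<in> space M. Y \<omega> i = c} \<in> events" for i c
    by (cases "i < k0") (auto simp: extended_path_def Z_eq_event)
  have "{\<omega> \<in> space M. \<forall>i\<in>{..n}. Y \<omega> i = card (A \<inter> {..<i})} \<in> events"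
    by (rule sets.sets_Collect_finite_All[OF ev]) simp
  then show ?thesis unfolding path_event_def Ball_def atMost_iff .
qed

lemma transition:
  assumes N: "N \<ge> 1" and pos: "\<P>(\<omega> in M. Z N \<omega> = z) > 0"
  shows "\<P>(\<omega> in M. Z (N + 1) \<omega> = z + of_bool u \<bar> Z N \<omega> = z) = (if u then 1 - real z / s N else real z / s N)"
proof -
  have "\<P>(\<omega> in M. Z (N + 1) \<omega> = z + of_bool u \<bar> Z N \<omega> = z)
      = \<P>(\<omega> in M. int (Z (N + 1) \<omega>) - int (Z N \<omega>) = of_bool u \<bar> Z N \<omega> = z)"
    unfolding cond_prob_def by (intro arg_cong2[of _ _ _ _ divide] arg_cong[of _ _ prob]) auto
  then show ?thesis using up[OF N pos] stay[OF N pos] by (cases u) simp_all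
qed

text \<open>Induction on the length. During the first \<open>k0\<close> steps the path is forced
  upwards and the weight is 1 or 0 accordingly; afterwards the Markov property supplies one more
  factor.\<close>

lemma prob_path_event: "prob (path_event n A) = path_weight (kern v) n A"
proof (induction n)
  case 0
  have "path_event 0 A = space M" unfolding path_event_def extended_path_def using Z1 by auto
  then show ?case by (simp add: path_weight_def prob_space)
next
  case (Suc n)
  define z where "z = card (A \<inter> {..<n})"
  have w: "path_weight (kern v) (Suc n) A = path_weight (kern v) n A * (if n \<in> A then kern v n z else 1 - kern v n z)"
    unfolding path_weight_def z_def by simp
  have cS: "card (A \<inter> {..<Suc n}) = z + of_bool (n \<in> A)" unfolding z_def by (rule card_Int_lessThan_Suc)
  have E: "path_event (Suc n) A = {\<omega> \<in> path_event n A. Y \<omega> (Suc n) = z + of_bool (n \<in> A)}"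
    unfolding path_event_def cS[symmetric] by (auto simp: le_Suc_eq)
  show ?case
  proof (cases "n < k0")
    case True
    have Yn: "Y \<omega> n = n" "Y \<omega> (Suc n) = Suc n" if "\<omega> \<in> space M" for \<omega>
      using True Z1[OF that] by (auto simp: extended_path_def Suc_lessI)
    have k: "kern v n z = 1" unfolding kern_def v_def using True by simp
    have zn: "z = n" if "\<omega> \<in> path_event n A" for \<omega> using that Yn(1)[of \<omega>] unfolding path_event_def z_def by auto
    have "Y \<omega> (Suc n) = z + of_bool (n \<in> A) \<longleftrightarrow> n \<in> A" if "\<omega> \<in> path_event n A" for \<omega>
      using Yn(2)[of \<omega>] zn[OF that] that by (simp add: path_event_def of_bool_def)
    then have "path_event (Suc n) A = {\<omega> \<in> path_event n A. n \<in> A}"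
      unfolding E by (intro Collect_cong conj_cong refl)
    then have "path_event (Suc n) A = (if n \<in> A then path_event n A else {})" by simp
    then show ?thesis using Suc k unfolding w by simp
  next
    case False
    define N where "N = n - k0 + 1"
    have N: "N \<ge> 1" unfolding N_def by simp
    have YN: "Y \<omega> n = Z N \<omega>" "Y \<omega> (Suc n) = Z (N + 1) \<omega>" for \<omega>
      using False unfolding extended_path_def N_def by (auto simp: Suc_diff_le)
    have kv: "kern v n z = 1 - real z / s N" unfolding kern_def v_def N_def using False by simp
    define h where "h i = card (A \<inter> {..<i + k0 - 1})" for i
    have hN: "h N = z" unfolding h_def N_def z_def using False by simp
    \<comment> \<open>If the event is nonempty, then \<open>A\<close> starts with \<open>k0\<close>
      up-steps, and the conditions before time \<open>k0\<close> hold trivially. What is left is a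
      history of the chain, the form in which the Markov property is stated.\<close>
    have hist: "path_event n A = {\<omega> \<in> space M. \<forall>i\<in>{1..N}. Z i \<omega> = h i}" if ne: "path_event n A \<noteq> {}"
    proof -
      obtain \<omega>0 where \<omega>0: "\<forall>i\<le>n. Y \<omega>0 i = card (A \<inter> {..<i})" using ne unfolding path_event_def by blast
      have triv: "card (A \<inter> {..<i}) = i" if "i < k0" for i
        using \<omega>0[rule_format, of i] that False by (simp add: extended_path_def)
      have "(\<forall>i\<le>n. Y \<omega> i = card (A \<inter> {..<i})) \<longleftrightarrow> (\<forall>i\<in>{1..N}. Z i \<omega> = h i)" for \<omega>
      proof
        assume *: "\<forall>i\<le>n. Y \<omega> i = card (A \<inter> {..<i})"
        show "\<forall>i\<in>{1..N}. Z i \<omega> = h i"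
        proof
          fix i assume i: "i \<in> {1..N}"
          then have "i + k0 - 1 \<le> n" "\<not> i + k0 - 1 < k0" "i + k0 - 1 - k0 + 1 = i" using False unfolding N_def by auto
          then show "Z i \<omega> = h i" using *[rule_format, of "i + k0 - 1"] unfolding h_def extended_path_def by simp
        qed
      next
        assume *: "\<forall>i\<in>{1..N}. Z i \<omega> = h i"
        show "\<forall>i\<le>n. Y \<omega> i = card (A \<inter> {..<i})"
        proof (intro allI impI)
          fix i assume i: "i \<le> n"
          show "Y \<omega> i = card (A \<inter> {..<i})"
          proof (cases "i < k0")
            case True
            then show ?thesis using triv unfolding extended_path_def by simp
          next
            case False
            then have "i - k0 + 1 \<in> {1..N}" "i - k0 + 1 + k0 - 1 = i" using i unfolding N_def by auto
            then show ?thesis using * False unfolding h_def extended_path_def by simp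
          qed
        qed
      qed
      then show ?thesis unfolding path_event_def by simp
    qed
    \<comment> \<open>The transition law is available only for histories of positive probability;
      for a null history both sides vanish.\<close>
    show ?thesis
    proof (cases "prob (path_event n A) = 0")
      case True
      have "prob (path_event (Suc n) A) \<le> prob (path_event n A)"
        unfolding E by (intro finite_measure_mono path_event_sets) auto
      then show ?thesis using True Suc unfolding w by (simp add: measure_le_0_iff)
    next
      case False
      then have ne: "path_event n A \<noteq> {}" by auto
      have ppos: "0 < prob {\<omega> \<in> space M. \<forall>i\<in>{1..N}. Z i \<omega> = h i}"
        using False unfolding hist[OF ne] by (simp add: zero_less_measure_iff)
      have "prob {\<omega> \<in> space M. \<forall>i\<in>{1..N}. Z i \<omega> = h i} \<le> prob {\<omega> \<in> space M. Z N \<omega> = z}"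
        using N hN by (intro finite_measure_mono Z_eq_event) auto
      then have zpos: "0 < prob {\<omega> \<in> space M. Z N \<omega> = z}" using ppos by linarith
      have "\<P>(\<omega> in M. Z (N + 1) \<omega> = z + of_bool (n \<in> A) \<bar> \<forall>i\<in>{1..N}. Z i \<omega> = h i)
          = \<P>(\<omega> in M. Z (N + 1) \<omega> = z + of_bool (n \<in> A) \<bar> Z N \<omega> = z)"
        using chain N ppos unfolding markov_chain_def hN[symmetric] by blast
      also have "\<dots> = (if n \<in> A then kern v n z else 1 - kern v n z)"
        unfolding transition[OF N zpos] kv by simp
      finally have "prob {\<omega> \<in> space M. Z (N + 1) \<omega> = z + of_bool (n \<in> A) \<and> (\<forall>i\<in>{1..N}. Z i \<omega> = h i)}
          = (if n \<in> A then kern v n z else 1 - kern v n z) * prob (path_event n A)"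
        using ppos unfolding cond_prob_def hist[OF ne] by (simp add: field_simps)
      moreover have "{\<omega> \<in> space M. Z (N + 1) \<omega> = z + of_bool (n \<in> A) \<and> (\<forall>i\<in>{1..N}. Z i \<omega> = h i)} = path_event (Suc n) A"
        unfolding E hist[OF ne] YN by auto
      ultimately show ?thesis unfolding w Suc[symmetric] by (simp add: mult.commute)
    qed
  qed
qed

lemma path_event_disjoint: "disjoint_family_on (path_event n) (Pow {..<n})"
  unfolding disjoint_family_on_def
proof (intro ballI impI)
  fix A B assume AB: "A \<in> Pow {..<n}" "B \<in> Pow {..<n}" "A \<noteq> B"
  show "path_event n A \<inter> path_event n B = {}"
  proof (rule ccontr)
    assume "path_event n A \<inter> path_event n B \<noteq> {}"
    then obtain \<omega> where "\<omega> \<in> path_event n A" "\<omega> \<in> path_event n B" by blast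
    then have "\<And>i. i \<le> n \<Longrightarrow> card (A \<inter> {..<i}) = card (B \<inter> {..<i})" unfolding path_event_def by auto
    then show False using card_Int_lessThan_inject[of A n B] AB by auto
  qed
qed

text \<open>The path events are disjoint and their probabilities, the path weights, sum to 1. So
  almost surely all increments are 0 or 1.\<close>

lemma AE_path_event: "AE \<omega> in M. \<exists>A\<subseteq>{..<n}. \<omega> \<in> path_event n A"
proof -
  have "prob (\<Union>A\<in>Pow {..<n}. path_event n A) = (\<Sum>A\<in>Pow {..<n}. prob (path_event n A))"
    using path_event_sets path_event_disjoint by (intro finite_measure_finite_Union) auto
  also have "\<dots> = 1" unfolding prob_path_event by (rule sum_path_weight)
  finally have "AE \<omega> in M. \<omega> \<in> (\<Union>A\<in>Pow {..<n}. path_event n A)"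
    using path_event_sets by (subst (asm) prob_eq_1) auto
  then show ?thesis by eventually_elim auto
qed

lemma trajectory_path_event:
  assumes "0 < n" "\<omega> \<in> path_event n A"
  shows "trajectory k0 (\<lambda>m. Z m \<omega>) n = path_fn n A"
  using assms Z1 unfolding path_event_def by (intro trajectory_eq_path_fn) auto

lemma prob_trajectory:
  assumes n: "0 < n" and ev: "{\<omega> \<in> space M. P (trajectory k0 (\<lambda>m. Z m \<omega>) n)} \<in> events"
  shows "\<P>(\<omega> in M. P (trajectory k0 (\<lambda>m. Z m \<omega>) n)) = (\<Sum>A | A \<subseteq> {..<n} \<and> P (path_fn n A). path_weight (kern v) n A)"
proof -
  define S where "S = {A. A \<subseteq> {..<n} \<and> P (path_fn n A)}"
  have S: "finite S" "S \<subseteq> Pow {..<n}" unfolding S_def by (auto intro: finite_subset[of _ "Pow {..<n}"])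
  have "\<P>(\<omega> in M. P (trajectory k0 (\<lambda>m. Z m \<omega>) n)) = prob (\<Union>A\<in>S. path_event n A)"
  proof (rule finite_measure_eq_AE)
    show "AE \<omega> in M. (\<omega> \<in> {\<omega> \<in> space M. P (trajectory k0 (\<lambda>m. Z m \<omega>) n)}) = (\<omega> \<in> (\<Union>A\<in>S. path_event n A))"
      using AE_path_event[of n] AE_space
    proof eventually_elim
      case (elim \<omega>)
      then obtain A where A: "A \<subseteq> {..<n}" "\<omega> \<in> path_event n A" by blast
      show ?case
      proof
        assume "\<omega> \<in> {\<omega> \<in> space M. P (trajectory k0 (\<lambda>m. Z m \<omega>) n)}"
        then have "P (path_fn n A)" using trajectory_path_event[OF n A(2)] by simp
        then have "A \<in> S" using A(1) unfolding S_def by simp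
        then show "\<omega> \<in> (\<Union>A\<in>S. path_event n A)" using A(2) by blast
      next
        assume "\<omega> \<in> (\<Union>A\<in>S. path_event n A)"
        then obtain B where B: "B \<in> S" "\<omega> \<in> path_event n B" by blast
        then have "P (trajectory k0 (\<lambda>m. Z m \<omega>) n)" using trajectory_path_event[OF n B(2)] unfolding S_def by simp
        then show "\<omega> \<in> {\<omega> \<in> space M. P (trajectory k0 (\<lambda>m. Z m \<omega>) n)}" using elim by simp
      qed
    qed
    show "(\<Union>A\<in>S. path_event n A) \<in> events" using S path_event_sets by auto
  qed (rule ev)
  also have "\<dots> = (\<Sum>A\<in>S. prob (path_event n A))"
    using S path_event_sets disjoint_family_on_mono[OF S(2) path_event_disjoint]
    by (intro finite_measure_finite_Union) auto
  finally show ?thesis unfolding prob_path_event S_def .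
qed

text \<open>The trajectory is a function of finitely many values of the chain, that is, of a random
  list with countably many possible values. Every set of lists then has a measurable preimage,
  whatever the Borel sets of the path space are.\<close>

lemma trajectory_measurable:
  assumes n: "1 \<le> n"
  shows "(\<lambda>\<omega>. trajectory k0 (\<lambda>m. Z m \<omega>) n) \<in> measurable M (borel_sets_of C01)"
proof (rule measurableI)
  fix \<omega> assume "\<omega> \<in> space M"
  then show "trajectory k0 (\<lambda>m. Z m \<omega>) n \<in> space (borel_sets_of C01)"
    using trajectory_mspace[of n "\<lambda>m. Z m \<omega>" k0] n Z1 by simp
next
  fix U assume "U \<in> sets (borel_sets_of C01)"
  \<comment> \<open>The largest index read by \<open>trajectory\<close> is \<open>n + 2\<close>,
    reached for \<open>k0 = 0\<close> at \<open>t = 1\<close>. Entry 0 is a dummy, since nothing is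
    assumed about \<open>Z 0\<close>.\<close>
  define g where "g \<omega> = map (\<lambda>i. if i = 0 then 0 else Z i \<omega>) [0..<n + 3]" for \<omega>
  have g: "g \<in> measurable M (count_space UNIV)"
  proof (subst measurable_count_space_eq_countable, simp, intro conjI ballI)
    fix l :: "nat list"
    have len: "length (g \<omega>) = n + 3" for \<omega> unfolding g_def by simp
    have nth: "g \<omega> ! i = (if i = 0 then 0 else Z i \<omega>)" if "i < n + 3" for \<omega> i
      using that unfolding g_def by (subst nth_map) (simp_all del: upt_Suc)
    have "g \<omega> = l \<longleftrightarrow> length l = n + 3 \<and> (\<forall>i\<in>{..<n + 3}. (if i = 0 then 0 else Z i \<omega>) = l ! i)" for \<omega>
      unfolding list_eq_iff_nth_eq len Ball_def lessThan_iff using nth by metis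
    then have "g -` {l} \<inter> space M = {\<omega> \<in> space M. length l = n + 3 \<and> (\<forall>i\<in>{..<n + 3}. (if i = 0 then 0 else Z i \<omega>) = l ! i)}"
      by (simp only: vimage_def Int_def mem_Collect_eq singleton_iff conj_commute)
    also have "\<dots> \<in> events"
    proof (cases "length l = n + 3")
      case True
      have "{\<omega> \<in> space M. (if i = 0 then 0 else Z i \<omega>) = l ! i} \<in> events" for i
        by (cases "i = 0") (auto simp: Z_eq_event)
      then have "{\<omega> \<in> space M. \<forall>i\<in>{..<n + 3}. (if i = 0 then 0 else Z i \<omega>) = l ! i} \<in> events"
        by (rule sets.sets_Collect_finite_All) simp
      then show ?thesis using True by (simp only: simp_thms)
    qed simp
    finally show "g -` {l} \<inter> space M \<in> events" .
  qed auto
  define h where "h l = trajectory k0 (\<lambda>m. l ! m) n" for l :: "nat list"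
  have h: "h (g \<omega>) = trajectory k0 (\<lambda>m. Z m \<omega>) n" if "\<omega> \<in> space M" for \<omega>
  proof
    fix t
    have gm: "g \<omega> ! m = Z m \<omega>" if "1 \<le> m" "m \<le> n + 2" for m using that unfolding g_def by (simp del: upt_Suc)
    show "h (g \<omega>) t = trajectory k0 (\<lambda>m. Z m \<omega>) n t"
    proof (cases "t \<in> {0..1}")
      case True
      have "extended_path k0 (\<lambda>m. g \<omega> ! m) i = Y \<omega> i" if "i \<le> n" for i
        using gm[of "i - k0 + 1"] that unfolding extended_path_def by auto
      moreover have "extended_path k0 (\<lambda>m. g \<omega> ! m) (Suc i) = Y \<omega> (Suc i)" if "i \<le> n" for i
        using gm[of "Suc i - k0 + 1"] that unfolding extended_path_def by auto
      ultimately show ?thesis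
        unfolding h_def using n gm[of 1] Z1[OF \<open>\<omega> \<in> space M\<close>]
        by (subst trajectory_eq[of n "\<lambda>m. g \<omega> ! m" k0, OF _ _ True], simp, simp,
          subst trajectory_eq[of n "\<lambda>m. Z m \<omega>" k0, OF _ _ True]) (auto intro!: arg_cong2[of _ _ _ _ divide] sum.cong)
    qed (auto simp: h_def trajectory_def)
  qed
  have "(\<lambda>\<omega>. trajectory k0 (\<lambda>m. Z m \<omega>) n) -` U \<inter> space M = g -` {l. h l \<in> U} \<inter> space M"
    using h by auto
  also have "\<dots> \<in> events" using g by (rule measurable_sets) simp
  finally show "(\<lambda>\<omega>. trajectory k0 (\<lambda>m. Z m \<omega>) n) -` U \<inter> space M \<in> events" .
qed

lemma prob_trajectory_ball:
  assumes n: "1 \<le> n" and \<phi>: "\<phi> \<in> mspace C01"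
  shows "\<P>(\<omega> in M. mdist C01 \<phi> (trajectory k0 (\<lambda>m. Z m \<omega>) n) \<le> \<delta>)
    = (\<Sum>A | A \<subseteq> {..<n} \<and> (\<forall>t\<in>{0..1}. \<bar>path_fn n A t - \<phi> t\<bar> \<le> \<delta>). path_weight (kern v) n A)"
proof -
  have n0: "0 < n" using n by simp
  have Xm: "trajectory k0 (\<lambda>m. Z m \<omega>) n \<in> mspace C01" if "\<omega> \<in> space M" for \<omega>
    using trajectory_mspace[of n "\<lambda>m. Z m \<omega>" k0, OF n0] Z1[OF that] by simp
  have eq: "{\<omega> \<in> space M. \<forall>t\<in>{0..1}. \<bar>trajectory k0 (\<lambda>m. Z m \<omega>) n t - \<phi> t\<bar> \<le> \<delta>}
      = {\<omega> \<in> space M. mdist C01 \<phi> (trajectory k0 (\<lambda>m. Z m \<omega>) n) \<le> \<delta>}"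
    using mdist_C01_le[OF \<phi> Xm] by (auto simp: abs_minus_commute)
  have "{\<omega> \<in> space M. mdist C01 \<phi> (trajectory k0 (\<lambda>m. Z m \<omega>) n) \<le> \<delta>}
      = (\<lambda>\<omega>. trajectory k0 (\<lambda>m. Z m \<omega>) n) -` {y \<in> mspace C01. mdist C01 \<phi> y \<le> \<delta>} \<inter> space M"
    using Xm by auto
  also have "\<dots> \<in> events"
    using trajectory_measurable[OF n] mcball_sets_borel_sets_of[OF \<phi>] by (rule measurable_sets)
  finally have "{\<omega> \<in> space M. \<forall>t\<in>{0..1}. \<bar>trajectory k0 (\<lambda>m. Z m \<omega>) n t - \<phi> t\<bar> \<le> \<delta>} \<in> events" unfolding eq .
  from prob_trajectory[OF n0 this] show ?thesis unfolding eq .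
qed

section \<open>Local bounds for the trajectories and the conclusion\<close>

lemma path_fn_mspace: "0 < n \<Longrightarrow> path_fn n A \<in> mspace C01"
  unfolding mspace_C01 using admissible_continuous_on[OF path_fn_admissible] by (auto simp: path_fn_def)

lemma local_lower_bound:
  assumes \<phi>: "\<phi> \<in> mspace C01" and b: "rate \<alpha> \<phi> < ereal b" and \<delta>: "0 < \<delta>"
  shows "\<forall>\<^sub>F n in sequentially. exp (- (real n * b)) \<le> \<P>(\<omega> in M. mdist C01 \<phi> (trajectory k0 (\<lambda>m. Z m \<omega>) n) \<le> \<delta>)"
proof -
  interpret urn_kernel v "1 / \<alpha>" by (rule urn_kernel_v)
  have fin: "rate_finite \<alpha> \<phi>" using b unfolding rate_def by (auto split: if_splits)
  have adm: "admissible \<phi>" by (rule rate_finite_admissible[OF fin])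
  obtain r where r: "rate \<alpha> \<phi> = ereal r" unfolding rate_def using fin by simp
  define \<beta> where "\<beta> = 1 / \<alpha>"
  have \<beta>: "0 < \<beta>" "\<beta> < 1" unfolding \<beta>_def using \<alpha> by auto
  define c where "c = 1 / (1 + \<beta>)"
  have c: "0 < c" "c < 1" unfolding c_def using \<beta> by auto
  \<comment> \<open>Mixing moves the path by at most \<open>e \<le> \<delta> / 2\<close>; the other
    half of \<open>\<delta>\<close> is the width of the tube around the mixed path.\<close>
  define e where "e = min (1 / 2) (\<delta> / 2)"
  have e: "0 < e" "e < 1" "e \<le> \<delta> / 2" unfolding e_def using \<delta> by auto
  \<comment> \<open>The terms with \<open>e * c\<close> and \<open>e * (1 - c)\<close> keep the
    mixed slopes and flat-step probabilities above \<open>\<rho>\<close>. The remaining two are the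
    bounds required by \<open>lower_tube\<close> for \<open>\<kappa> = e * c\<close>, the slope of a
    line below the mixed path. None of them involves \<open>m\<close>, which is chosen
    afterwards.\<close>
  define \<rho> where "\<rho> = Min {e * c, e * (1 - c), (1 - \<beta>) / 2, \<beta> * (e * c) / 8}"
  have \<rho>: "0 < \<rho>" "\<rho> \<le> e * c" "\<rho> \<le> e * (1 - c)" "\<rho> \<le> (1 - \<beta>) / 2" "\<rho> \<le> \<beta> * (e * c) / 8"
  proof -
    show "0 < \<rho>" unfolding \<rho>_def using \<beta> c e by simp
    show "\<rho> \<le> e * c" "\<rho> \<le> e * (1 - c)" "\<rho> \<le> (1 - \<beta>) / 2" "\<rho> \<le> \<beta> * (e * c) / 8"
      unfolding \<rho>_def by (rule Min_le; simp)+
  qed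
  have \<rho>': "\<rho> \<le> 1 - \<beta>"
  proof -
    have "(1 - \<beta>) / 2 \<le> 1 - \<beta>" using \<beta> by simp
    with \<rho>(4) show ?thesis by (rule order_trans)
  qed
  define \<psi> where "\<psi> = tilt e c \<phi>"
  note \<psi> = tilt_admissible[OF adm e(1,2) c, folded \<psi>_def]
  have "0 < b - r" using b r by simp
  from lower_rate_less_rate[OF \<alpha> fin e(1,2) \<rho>(1), folded \<beta>_def, folded c_def, OF \<rho>(2,3) \<rho>' this, folded \<psi>_def]
  have "\<forall>\<^sub>F m in sequentially. (\<Sum>j<m. lower_rate \<beta> \<rho> \<psi> m j) / m < b"
    unfolding r by simp
  moreover have "\<forall>\<^sub>F m::nat in sequentially. 10 / \<delta> \<le> m" by (rule eventually_real_ge)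
  ultimately have "\<forall>\<^sub>F m::nat in sequentially. (\<Sum>j<m. lower_rate \<beta> \<rho> \<psi> m j) / m < b \<and> 10 / \<delta> \<le> m \<and> 0 < m"
    using eventually_gt_at_top[of 0] by eventually_elim auto
  then obtain m :: nat where m: "(\<Sum>j<m. lower_rate \<beta> \<rho> \<psi> m j) / m < b" "10 / \<delta> \<le> m" "0 < m"
    using eventually_happens'[OF sequentially_bot] by blast
  have "5 / m \<le> \<delta> / 2" using m(2,3) \<delta> by (simp add: field_simps)
  have ec: "0 < e * c" using e c by simp
  have chord: "0 < chord \<psi> m j \<and> chord \<psi> m j < 1" if "j < m" for j
  proof -
    have "0 \<le> (1 - e) * chord \<phi> m j" "(1 - e) * chord \<phi> m j \<le> (1 - e) * 1"
      using chord_bounds[OF adm that] e by (auto intro!: mult_left_mono simp del: mult_1_right)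
    moreover have "e * c < e" using e c by simp
    ultimately show ?thesis unfolding \<psi>(4)[OF m(3)] using ec by (simp only: mult_1_right) linarith
  qed
  have "\<forall>\<^sub>F n in sequentially. exp (- (real n * b)) \<le>
      (\<Sum>A | A \<subseteq> {..<n} \<and> (\<forall>t\<in>{0..1}. \<bar>path_fn n A t - \<psi> t\<bar> \<le> \<delta> / 2). path_weight (kern v) n A)"
    by (rule lower_tube[OF \<psi>(1) m(3) ec _ _ \<rho>(1,4,5)[unfolded \<beta>_def] \<open>5 / m \<le> \<delta> / 2\<close> m(1)[unfolded \<beta>_def]])
      (use \<psi>(2) chord in auto)
  then show ?thesis using eventually_ge_at_top[of 1]
  proof eventually_elim
    case (elim n)
    have "(\<Sum>A | A \<subseteq> {..<n} \<and> (\<forall>t\<in>{0..1}. \<bar>path_fn n A t - \<psi> t\<bar> \<le> \<delta> / 2). path_weight (kern v) n A)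
      \<le> (\<Sum>A | A \<subseteq> {..<n} \<and> (\<forall>t\<in>{0..1}. \<bar>path_fn n A t - \<phi> t\<bar> \<le> \<delta>). path_weight (kern v) n A)"
    proof (rule sum_mono2)
      show "finite {A. A \<subseteq> {..<n} \<and> (\<forall>t\<in>{0..1}. \<bar>path_fn n A t - \<phi> t\<bar> \<le> \<delta>)}"
        by (rule finite_subset[of _ "Pow {..<n}"]) auto
      show "{A. A \<subseteq> {..<n} \<and> (\<forall>t\<in>{0..1}. \<bar>path_fn n A t - \<psi> t\<bar> \<le> \<delta> / 2)}
          \<subseteq> {A. A \<subseteq> {..<n} \<and> (\<forall>t\<in>{0..1}. \<bar>path_fn n A t - \<phi> t\<bar> \<le> \<delta>)}"
      proof (intro Collect_mono impI conjI ballI; elim conjE)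
        fix A and t :: real
        assume *: "\<forall>t\<in>{0..1}. \<bar>path_fn n A t - \<psi> t\<bar> \<le> \<delta> / 2" "t \<in> {0..1}"
        then have "\<bar>path_fn n A t - \<psi> t\<bar> \<le> \<delta> / 2" "\<bar>\<psi> t - \<phi> t\<bar> \<le> e" using \<psi>(3)[of t] by auto
        then show "\<bar>path_fn n A t - \<phi> t\<bar> \<le> \<delta>" using e(3) by linarith
      qed
      show "0 \<le> path_weight (kern v) n A" for A
        using kern_bounds by (intro path_weight_nonneg) auto
    qed
    then show ?case using elim prob_trajectory_ball[OF elim(2) \<phi>, of \<delta>] by linarith
  qed
qed

lemma local_upper_bound:
  assumes \<phi>: "\<phi> \<in> mspace C01" "admissible \<phi>" and a: "ereal a < rate \<alpha> \<phi>"
  shows "\<exists>\<delta>>0. \<forall>\<^sub>F n in sequentially. \<P>(\<omega> in M. mdist C01 \<phi> (trajectory k0 (\<lambda>m. Z m \<omega>) n) \<le> \<delta>) \<le> exp (- (real n * a))"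
proof -
  interpret urn_kernel v "1 / \<alpha>" by (rule urn_kernel_v)
  obtain m where m: "0 < m" "a < (\<Sum>j<m. upper_rate (1 / \<alpha>) \<phi> m j) / real m"
    using rate_less_upper_rate[OF \<phi>(2) \<alpha> a] by blast
  obtain \<delta> where \<delta>: "0 < \<delta>" "\<forall>\<^sub>F n in sequentially.
      (\<Sum>A | A \<subseteq> {..<n} \<and> (\<forall>t\<in>{0..1}. \<bar>path_fn n A t - \<phi> t\<bar> \<le> \<delta>). path_weight (kern v) n A) \<le> exp (- (real n * a))"
    using upper_tube[OF \<phi>(2) m] by blast
  from \<delta>(2) eventually_ge_at_top[of 1]
  have "\<forall>\<^sub>F n in sequentially. \<P>(\<omega> in M. mdist C01 \<phi> (trajectory k0 (\<lambda>m. Z m \<omega>) n) \<le> \<delta>) \<le> exp (- (real n * a))"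
  proof eventually_elim
    case (elim n)
    then show ?case using prob_trajectory_ball[OF elim(2) \<phi>(1), of \<delta>] by simp
  qed
  then show ?thesis using \<delta>(1) by blast
qed

theorem large_deviation: "large_deviation_principle M C01 (\<lambda>n \<omega>. trajectory k0 (\<lambda>m. Z m \<omega>) n) (rate \<alpha>)"
proof (rule large_deviation_principle_local[OF prob_space_axioms trajectory_measurable compactin_admissible])
  show "0 \<le> rate \<alpha> \<phi>" for \<phi> by (rule rate_nonneg[OF \<alpha>])
  show "rate \<alpha> \<phi> = \<infinity>" if "\<phi> \<in> mspace C01" "\<phi> \<notin> {\<phi> \<in> mspace C01. admissible \<phi>}" for \<phi>
    using that rate_finite_admissible unfolding rate_def by auto
  show "\<forall>\<^sub>F n in sequentially. AE \<omega> in M. trajectory k0 (\<lambda>m. Z m \<omega>) n \<in> {\<phi> \<in> mspace C01. admissible \<phi>}"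
    using eventually_gt_at_top[of 0]
  proof eventually_elim
    case (elim n)
    from AE_path_event[of n] show ?case
    proof eventually_elim
      case (elim \<omega>)
      then obtain A where "\<omega> \<in> path_event n A" by blast
      then show ?case using trajectory_path_event[OF \<open>0 < n\<close>] path_fn_mspace path_fn_admissible \<open>0 < n\<close> by simp
    qed
  qed
qed (auto intro: local_upper_bound local_lower_bound)

end

theorem theorem1p3:
  fixes \<alpha> :: real and k0 :: nat and s :: "nat \<Rightarrow> real"
    and M :: "'w measure" and Z :: "nat \<Rightarrow> 'w \<Rightarrow> nat"
  assumes "1 < \<alpha>"
    and "\<And>n. n \<ge> 1 \<Longrightarrow> s n > 0"
    and "\<And>n. n \<ge> 1 \<Longrightarrow> s n \<ge> real k0 + real n - 1"
    and "(\<lambda>n. s n / real n) \<longlonglongrightarrow> \<alpha>"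
    and "prob_space M"
    and "markov_chain M Z"
    and "\<And>\<omega>. \<omega> \<in> space M \<Longrightarrow> Z 1 \<omega> = k0"
    and "\<And>n z. n \<ge> 1 \<Longrightarrow> \<P>(\<omega> in M. Z n \<omega> = z) > 0 \<Longrightarrow>
           \<P>(\<omega> in M. int (Z (n + 1) \<omega>) - int (Z n \<omega>) = 1 \<bar> Z n \<omega> = z) = 1 - real z / s n"
    and "\<And>n z. n \<ge> 1 \<Longrightarrow> \<P>(\<omega> in M. Z n \<omega> = z) > 0 \<Longrightarrow>
           \<P>(\<omega> in M. int (Z (n + 1) \<omega>) - int (Z n \<omega>) = 0 \<bar> Z n \<omega> = z) = real z / s n"
  shows "large_deviation_principle M C01
           (\<lambda>n \<omega>. trajectory k0 (\<lambda>m. Z m \<omega>) n) (rate \<alpha>)"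
proof -
  interpret prob_space M by fact
  interpret urn_chain M \<alpha> k0 s Z by unfold_locales (fact assms)+
  show ?thesis by (rule large_deviation)
qed

end
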